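(* Let $\mathcal{I}$ be an interval in $\mathbb{R}$ and let $t_0$ be a point in the interior of $\mathcal{I}$. Let $\mathcal{V}$ be a (real or complex) operator space with norms $\|\cdot\|_n$ on $\mathcal{V}^{n\times n}$, and let $\Xi\subseteq\mathcal{V}_{\rm nc}$ be a nonempty nc set, with $\Xi_n$ a closed subspace of the Banach space $\mathcal{V}^{n\times n}$ for every $n\in\operatorname{supp}\Xi$. Let $X_{0n}\in\Xi_n$, $n\in\operatorname{supp}\Xi$, and let $\{X_{0n}\}_{n\in\operatorname{supp}\Xi}$ be a nc set. Suppose that $g\colon\mathcal{I}\times\Xi\to\Xi$ satisfies: (i) for every $t\in\mathcal{I}$, $g(t,\cdot)$ maps $\Xi_n$ to itself for each $n\in\operatorname{supp}\Xi$, and respects direct sums of matrices; (ii) $g_n:=g|_{\mathcal{I}\times\Xi_n}$ is continuous for every $n\in\operatorname{supp}\Xi$; (iii) there is a constant $C>0$ such that $\|g(t,X)-g(t,Y)\|_n\le C\|X-Y\|_n$ for every $t\in\mathcal{I}$, $n\in\operatorname{supp}\Xi$, and $X,Y\in\Xi_n$. Let $d=\gcd\{n\colon n\in\operatorname{supp}\Xi\}$. Then: 1. There is a matrix $X_0\in\mathcal{V}^{d\times d}$ such that $X_{0n}=\bigoplus_{\alpha=1}^{n/d}X_0$ for every $n\in\operatorname{supp}\Xi$. 2. There is a continuously differentiable function $X_*\colon\mathcal{I}\to\mathcal{V}^{d\times d}$ such that, for every $n\in\operatorname{supp}\Xi$, $X_{*n}=\bigoplus_{\alpha=1}^{n/d}X_*\colon\mathcal{I}\to\Xi_n$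 is a unique solution of the initial value problem for the first-order ODE $$\dot X=g_n(t,X),\quad X(t_0)=X_{0n}.$$ 3. Suppose that, in addition, $g(t,\cdot)$ respects similarities of matrices, thus is a nc function, for every $t\in\mathcal{I}$. Then there exist: (a) for each $t\in\mathcal{I}$, a nc set $\widetilde\Xi(t)\subseteq\mathcal{V}_{\rm nc}$ with $\widetilde\Xi(t)\supseteq\Xi$ and $\operatorname{supp}\widetilde\Xi(t)=\mathbb{N}d$, so that for every $n\in\mathbb{N}d$ one has a fiber bundle $\Psi_n$ with the total space $\widetilde\Xi_n=\coprod_{t\in\mathcal{I}}\widetilde\Xi(t)_n\subseteq\mathcal{I}\times\mathcal{V}^{n\times n}$, the base space $\mathcal{I}$, and the projection $\pi_n\colon\widetilde\Xi_n\to\mathcal{I}$ sending each element of the fiber $\widetilde\Xi(t)_n$ to $t$; (b) a map $\widetilde g$ of the set $\coprod_{t\in\mathcal{I}}\widetilde\Xi(t)$ to itself such that $\widetilde g_n:=\widetilde g|_{\widetilde\Xi_n}$ is a continuous bundle endomorphism of $\Psi_n$ for every $n\in\mathbb{N}d$, and which extends the function $g$ (where all copies of $\Xi_n$ in $\widetilde\Xi(t)_n$, $t\in\mathcal{I}$, are identified); (c) for every $n\in\mathbb{N}d$, a unique continuously differentiable cross-section of the fiber bundle $\Psi_n$, $X_{*n}=\bigoplus_{\alpha=1}^{n/d}X_*\colon\mathcal{I}\to\widetilde\Xi_n$, which is a solution of the initial value problem for the first-order ODE $$\dot X=\widetilde g_n(t,X),\quad X(t_0)=\bigoplus_{\alp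ha=1}^{n/d}X_0.$$
   Context: For a vector space $\mathcal{V}$, $\mathcal{V}_{\rm nc}:=\coprod_{n=1}^\infty\mathcal{V}^{n\times n}$. For $\Xi\subseteq\mathcal{V}_{\rm nc}$ write $\Xi_n:=\Xi\cap\mathcal{V}^{n\times n}$ and $\operatorname{supp}\Xi:=\{n\in\mathbb{N}\colon\Xi_n\neq\emptyset\}$, where $\mathbb{N}=\{1,2,\dots\}$. $\mathbb{N}d=\{d,2d,3d,\dots\}$. The direct sum is $X\oplus Y:=\begin{bmatrix}X&0\\0&Y\end{bmatrix}$, and $\bigoplus_{\alpha=1}^kX$ is the direct sum of $k$ copies of $X$ (taken pointwise for matrix-valued functions). A subset $\Xi\subseteq\mathcal{V}_{\rm nc}$ is a nc set if $X\in\Xi_n$, $Y\in\Xi_m$ imply $X\oplus Y\in\Xi_{n+m}$. A vector space $\mathcal{V}$ over $\mathbb{F}$ ($\mathbb{F}=\mathbb{C}$ or $\mathbb{R}$) is an operator space if Banach space norms $\|\cdot\|_n$ on $\mathcal{V}^{n\times n}$, $n=1,2,\ldots$, are given such that $\|X\oplus Y\|_{n+m}=\max\{\|X\|_n,\|Y\|_m\}$ for all $X\in\mathcal{V}^{n\times n}$, $Y\in\mathcal{V}^{m\times m}$, and $\|SXT\|_n\le\|S\|\,\|X\|_n\|T\|$ for all $X\in\mathcal{V}^{n\times n}$, $S,T\in\mathbb{F}^{n\times n}$, where $\|\cdot\|$ is the $(2,2)$ operator norm on $\mathbb{F}^{n\times n}$. A map $h$ from a nc set $\Xi$ to $\mathcal{V}_{\rm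 nc}$ with $h(\Xi_n)\subseteq\mathcal{V}^{n\times n}$ for all $n$ respects direct sums if $h(X\oplus Y)=h(X)\oplus h(Y)$ for all $X,Y\in\Xi$; it respects similarities if $h(SXS^{-1})=Sh(X)S^{-1}$ whenever $X\in\Xi_n$ and $S\in\mathbb{F}^{n\times n}$ is invertible with $SXS^{-1}\in\Xi_n$; it is a nc function if it respects both. Conventions for part 3: $\widetilde\Xi(t)_n$ is the part of $\widetilde\Xi(t)$ in $\mathcal{V}^{n\times n}$, regarded inside $\widetilde\Xi_n$ as $\{t\}\times\widetilde\Xi(t)_n$; $\widetilde\Xi_n$ has the topology induced from $\mathcal{I}\times\mathcal{V}^{n\times n}$. A bundle endomorphism of $\Psi_n$ maps each fiber $\widetilde\Xi(t)_n$ to itself; in the ODE, $\widetilde g_n(t,X)$ denotes the $\mathcal{V}^{n\times n}$-component of the value at $(t,X)$, and "extends $g$" means that this component equals $g(t,X)$ for $X\in\Xi_n$, $n\in\operatorname{supp}\Xi$. A cross-section $\mathcal{I}\to\widetilde\Xi_n$ is identified with the function $X\colon\mathcal{I}\to\mathcal{V}^{n\times n}$ with $X(t)\in\widetilde\Xi(t)_n$ for all $t$, and it is continuously differentiable if this function is. In part 3, $X_0$ and $X_*$ are those of parts 1 and 2. *)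

theory Defs
  imports "HOL-Analysis.Analysis" "Jordan_Normal_Form.Matrix"
begin

text \<open>
  The disjoint union of all V^{n x n} is rendered as the set of nonempty square matrices in
  \<^typ>\<open>'v mat\<close>: a matrix carries its own dimensions, so the different levels are disjoint.
  The vector space V is the whole type \<^typ>\<open>'v\<close> with an explicit scalar multiplication.
\<close>

definition nc_space :: "'v mat set" where
  "nc_space = {X. \<exists>n\<ge>1. X \<in> carrier_mat n n}"

definition level :: "'v mat set \<Rightarrow> nat \<Rightarrow> 'v mat set" where
  "level \<Xi> n = \<Xi> \<inter> carrier_mat n n"

definition nc_supp :: "'v mat set \<Rightarrow> nat set" where
  "nc_supp \<Xi> = {n. n \<ge> 1 \<and> level \<Xi> n \<noteq> {}}"

definition dsum :: "'v::zero mat \<Rightarrow> 'v mat \<Rightarrow> 'v mat" where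
  "dsum X Y = four_block_mat X (0\<^sub>m (dim_row X) (dim_col Y)) (0\<^sub>m (dim_row Y) (dim_col X)) Y"

definition copies :: "nat \<Rightarrow> 'v::zero mat \<Rightarrow> 'v mat" where
  "copies k X = diag_block_mat (replicate k X)"

definition nc_set :: "'v::zero mat set \<Rightarrow> bool" where
  "nc_set \<Xi> \<longleftrightarrow> \<Xi> \<subseteq> nc_space \<and> (\<forall>X\<in>\<Xi>. \<forall>Y\<in>\<Xi>. dsum X Y \<in> \<Xi>)"

text \<open>Products of scalar matrices with matrices over V, on either side.\<close>

definition lmult :: "('f \<Rightarrow> 'v \<Rightarrow> 'v) \<Rightarrow> 'f mat \<Rightarrow> 'v::comm_monoid_add mat \<Rightarrow> 'v mat" where
  "lmult smul S X = mat (dim_row S) (dim_col X)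
     (\<lambda>(i, j). \<Sum>k<dim_row X. smul (index_mat S (i, k)) (index_mat X (k, j)))"

definition rmult :: "('f \<Rightarrow> 'v \<Rightarrow> 'v) \<Rightarrow> 'v::comm_monoid_add mat \<Rightarrow> 'f mat \<Rightarrow> 'v mat" where
  "rmult smul X T = mat (dim_row X) (dim_col T)
     (\<lambda>(i, j). \<Sum>k<dim_col X. smul (index_mat T (k, j)) (index_mat X (i, k)))"

definition l2_norm :: "'f::real_normed_field vec \<Rightarrow> real" where
  "l2_norm x = L2_set (\<lambda>i. norm (vec_index x i)) {..<dim_vec x}"

definition op_norm :: "'f::real_normed_field mat \<Rightarrow> real" where
  "op_norm S = (SUP x\<in>{x \<in> carrier_vec (dim_col S). l2_norm x \<le> 1}. l2_norm (S *\<^sub>v x))"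

text \<open>
  The value 0 off the carrier is there only because the locale \<^locale>\<open>Metric_space\<close> demands
  nonnegativity and symmetry on the whole type.
\<close>

definition mat_dist :: "(nat \<Rightarrow> 'v::minus mat \<Rightarrow> real) \<Rightarrow> nat \<Rightarrow> 'v mat \<Rightarrow> 'v mat \<Rightarrow> real" where
  "mat_dist nrm n X Y =
     (if X \<in> carrier_mat n n \<and> Y \<in> carrier_mat n n then nrm n (X - Y) else 0)"

definition mat_top :: "(nat \<Rightarrow> 'v::minus mat \<Rightarrow> real) \<Rightarrow> nat \<Rightarrow> 'v mat topology" where
  "mat_top nrm n = Metric_space.mtopology (carrier_mat n n) (mat_dist nrm n)"

text \<open>
  By the theorems of Gelfand--Mazur and Ostrowski, the instances of \<^class>\<open>real_normed_field\<close>
  are, up to isometric isomorphism, exactly the real and the complex numbers.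
\<close>

locale operator_space = Vector_Spaces.vector_space smul
  for smul :: "'f::real_normed_field \<Rightarrow> 'v::ab_group_add \<Rightarrow> 'v" +
  fixes nrm :: "nat \<Rightarrow> 'v mat \<Rightarrow> real"
  assumes nrm_nonneg: "\<lbrakk>n \<ge> 1; X \<in> carrier_mat n n\<rbrakk> \<Longrightarrow> 0 \<le> nrm n X"
    and nrm_eq_0: "\<lbrakk>n \<ge> 1; X \<in> carrier_mat n n\<rbrakk> \<Longrightarrow> nrm n X = 0 \<longleftrightarrow> X = 0\<^sub>m n n"
    and nrm_scale: "\<lbrakk>n \<ge> 1; X \<in> carrier_mat n n\<rbrakk> \<Longrightarrow> nrm n (map_mat (smul c) X) = norm c * nrm n X"
    and nrm_triangle: "\<lbrakk>n \<ge> 1; X \<in> carrier_mat n n; Y \<in> carrier_mat n n\<rbrakk>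
           \<Longrightarrow> nrm n (X + Y) \<le> nrm n X + nrm n Y"
    and nrm_complete: "n \<ge> 1 \<Longrightarrow> Metric_space.mcomplete (carrier_mat n n) (mat_dist nrm n)"
    and nrm_dsum: "\<lbrakk>n \<ge> 1; m \<ge> 1; X \<in> carrier_mat n n; Y \<in> carrier_mat m m\<rbrakk>
           \<Longrightarrow> nrm (n + m) (dsum X Y) = max (nrm n X) (nrm m Y)"
    and nrm_mult: "\<lbrakk>n \<ge> 1; X \<in> carrier_mat n n; S \<in> carrier_mat n n; T \<in> carrier_mat n n\<rbrakk>
           \<Longrightarrow> nrm n (rmult smul (lmult smul S X) T) \<le> op_norm S * nrm n X * op_norm T"

definition closed_mat_subspace ::
  "('f \<Rightarrow> 'v \<Rightarrow> 'v) \<Rightarrow> (nat \<Rightarrow> 'v::ab_group_add mat \<Rightarrow> real) \<Rightarrow> nat \<Rightarrow> 'v mat set \<Rightarrow> bool" where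
  "closed_mat_subspace smul nrm n L \<longleftrightarrow>
     L \<subseteq> carrier_mat n n \<and> 0\<^sub>m n n \<in> L \<and>
     (\<forall>X\<in>L. \<forall>Y\<in>L. X + Y \<in> L) \<and> (\<forall>c. \<forall>X\<in>L. map_mat (smul c) X \<in> L) \<and>
     closedin (mat_top nrm n) L"

definition respects_dsums :: "'v::zero mat set \<Rightarrow> ('v mat \<Rightarrow> 'v mat) \<Rightarrow> bool" where
  "respects_dsums \<Xi> h \<longleftrightarrow> (\<forall>X\<in>\<Xi>. \<forall>Y\<in>\<Xi>. h (dsum X Y) = dsum (h X) (h Y))"

definition respects_similarities ::
  "('f::semiring_1 \<Rightarrow> 'v \<Rightarrow> 'v) \<Rightarrow> 'v::comm_monoid_add mat set \<Rightarrow> ('v mat \<Rightarrow> 'v mat) \<Rightarrow> bool" where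
  "respects_similarities smul \<Xi> h \<longleftrightarrow>
     (\<forall>n\<ge>1. \<forall>X\<in>level \<Xi> n. \<forall>S\<in>carrier_mat n n. \<forall>S'\<in>carrier_mat n n.
        inverts_mat S S' \<and> inverts_mat S' S \<and> rmult smul (lmult smul S X) S' \<in> level \<Xi> n \<longrightarrow>
        h (rmult smul (lmult smul S X) S') = rmult smul (lmult smul S (h X)) S')"

text \<open>Derivative of a curve in V^{n x n}; one-sided at an end point of the interval.\<close>

definition has_mat_deriv ::
  "('f::real_normed_field \<Rightarrow> 'v \<Rightarrow> 'v) \<Rightarrow> (nat \<Rightarrow> 'v::ab_group_add mat \<Rightarrow> real) \<Rightarrow> nat \<Rightarrow>
   real set \<Rightarrow> (real \<Rightarrow> 'v mat) \<Rightarrow> 'v mat \<Rightarrow> real \<Rightarrow> bool" where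
  "has_mat_deriv smul nrm n I Y D t \<longleftrightarrow>
     limitin (mat_top nrm n) (\<lambda>s. map_mat (smul (of_real (1 / (s - t)))) (Y s - Y t)) D (at t within I)"

definition C1_curve ::
  "('f::real_normed_field \<Rightarrow> 'v \<Rightarrow> 'v) \<Rightarrow> (nat \<Rightarrow> 'v::ab_group_add mat \<Rightarrow> real) \<Rightarrow> nat \<Rightarrow>
   real set \<Rightarrow> (real \<Rightarrow> 'v mat) \<Rightarrow> bool" where
  "C1_curve smul nrm n I Y \<longleftrightarrow>
     (\<forall>t\<in>I. Y t \<in> carrier_mat n n) \<and>
     (\<exists>Y'. (\<forall>t\<in>I. has_mat_deriv smul nrm n I Y (Y' t) t) \<and>
           continuous_map (top_of_set I) (mat_top nrm n) Y')"

text \<open>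
  Solutions on all of the interval of dY/dt = f(t, Y), Y(t0) = A, subject to the possibly
  time-dependent constraint that Y(t) lies in D(t), a subset of V^{n x n}.
\<close>

definition ivp_solution ::
  "('f::real_normed_field \<Rightarrow> 'v \<Rightarrow> 'v) \<Rightarrow> (nat \<Rightarrow> 'v::ab_group_add mat \<Rightarrow> real) \<Rightarrow> nat \<Rightarrow>
   real set \<Rightarrow> (real \<Rightarrow> 'v mat set) \<Rightarrow> (real \<Rightarrow> 'v mat \<Rightarrow> 'v mat) \<Rightarrow> real \<Rightarrow> 'v mat \<Rightarrow>
   (real \<Rightarrow> 'v mat) \<Rightarrow> bool" where
  "ivp_solution smul nrm n I D f t0 A Y \<longleftrightarrow>
     (\<forall>t\<in>I. Y t \<in> D t) \<and>
     (\<forall>t\<in>I. has_mat_deriv smul nrm n I Y (f t (Y t)) t) \<and>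
     Y t0 = A"

definition fiber_bundle ::
  "'e topology \<Rightarrow> 'b topology \<Rightarrow> ('e \<Rightarrow> 'b) \<Rightarrow> 'c topology \<Rightarrow> bool" where
  "fiber_bundle E B p F \<longleftrightarrow>
     continuous_map E B p \<and> p ` topspace E = topspace B \<and>
     (\<forall>b\<in>topspace B. \<exists>U. openin B U \<and> b \<in> U \<and>
        (\<exists>\<phi>. homeomorphic_map (subtopology E {e \<in> topspace E. p e \<in> U})
                 (prod_topology (subtopology B U) F) \<phi> \<and>
             (\<forall>e\<in>topspace E. p e \<in> U \<longrightarrow> fst (\<phi> e) = p e)))"

definition bundle_endomorphism ::
  "'e topology \<Rightarrow> ('e \<Rightarrow> 'b) \<Rightarrow> ('e \<Rightarrow> 'e) \<Rightarrow> bool" where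
  "bundle_endomorphism E p h \<longleftrightarrow> continuous_map E E h \<and> (\<forall>e\<in>topspace E. p (h e) = p e)"

definition total_top ::
  "(nat \<Rightarrow> 'v::minus mat \<Rightarrow> real) \<Rightarrow> real set \<Rightarrow> (real \<Rightarrow> 'v mat set) \<Rightarrow> nat \<Rightarrow>
   (real \<times> 'v mat) topology" where
  "total_top nrm I \<Xi>t n =
     subtopology (prod_topology (top_of_set I) (mat_top nrm n)) (SIGMA t:I. level (\<Xi>t t) n)"

context operator_space
begin

lemma Metric_space_mat_dist:
  assumes n: "n \<ge> 1"
  shows "Metric_space (carrier_mat n n) (mat_dist nrm n)"
proof
  fix X Y :: "'v mat"
  show "0 \<le> mat_dist nrm n X Y"
    using n by (auto simp: mat_dist_def intro!: nrm_nonneg minus_carrier_mat)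
  show "mat_dist nrm n X Y = mat_dist nrm n Y X"
  proof (cases "X \<in> carrier_mat n n \<and> Y \<in> carrier_mat n n")
    case True
    have "Y - X = map_mat (smul (-1)) (X - Y)"
      using True by (intro eq_matI) auto
    then have "nrm n (Y - X) = nrm n (X - Y)"
      using nrm_scale[OF n, of "X - Y" "-1"] True by (simp add: minus_carrier_mat)
    then show ?thesis using True by (simp add: mat_dist_def)
  qed (auto simp: mat_dist_def)
next
  fix X Y :: "'v mat"
  assume XY: "X \<in> carrier_mat n n" "Y \<in> carrier_mat n n"
  have "X - Y = 0\<^sub>m n n \<longleftrightarrow> X = Y"
  proof
    assume h: "X - Y = 0\<^sub>m n n"
    show "X = Y"
    proof (rule eq_matI)
      fix i j assume ij: "i < dim_row Y" "j < dim_col Y"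
      then have "index_mat (X - Y) (i, j) = 0" using XY h by simp
      then show "index_mat X (i, j) = index_mat Y (i, j)" using XY ij by simp
    qed (use XY in auto)
  qed (use XY in auto)
  then show "mat_dist nrm n X Y = 0 \<longleftrightarrow> X = Y"
    using XY nrm_eq_0[OF n, of "X - Y"] by (simp add: mat_dist_def minus_carrier_mat)
next
  fix X Y Z :: "'v mat"
  assume XYZ: "X \<in> carrier_mat n n" "Y \<in> carrier_mat n n" "Z \<in> carrier_mat n n"
  have "X - Z = (X - Y) + (Y - Z)"
    using XYZ by (intro eq_matI) auto
  then show "mat_dist nrm n X Z \<le> mat_dist nrm n X Y + mat_dist nrm n Y Z"
    using XYZ nrm_triangle[OF n, of "X - Y" "Y - Z"] by (simp add: mat_dist_def minus_carrier_mat)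
qed

end

end

theory Submission
  imports Defs "HOL-Library.Function_Algebras" "HOL-Probability.Discrete_Topology"
begin

text \<open>
  Each level of \<open>\<Xi>\<close> is a Banach space, so the initial value problems have unique global solutions by
  Picard iteration. The levels carry their norm as a parameter rather than through a type class; norming
  functionals embed them isometrically into a space of bounded functions, where calculus is available.
  Direct sums of solutions are solutions, so by uniqueness the solutions of all sizes form a family
  closed under direct sums, and such a family consists of copies of one block of size \<open>d\<close>, the gcd of
  the sizes.

  For the last part fix a size \<open>K d\<close> in the support. The extended set consists of those \<open>X\<close> for which
  the sum of \<open>K\<close> copies of \<open>X\<close>, after some permutation of its \<open>d\<close> by \<open>d\<close> blocks, lies in \<open>\<Xi>\<close>; it does not
  depend on \<open>t\<close>. Respecting similarities forces \<open>g\<close> to map such a permuted sum to the same permuted sum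
  of copies of some \<open>Z\<close>, and \<open>X \<mapsto> Z\<close> is the extension. Each level is a finite union of closed subspaces,
  on each of which the extension is continuous. Since the distinguished curve lies in all of them, the
  extension is Lipschitz relative to that curve, which is enough for uniqueness.
\<close>

section \<open>Norming functionals\<close>

text \<open>The size \<open>d\<close> itself need not occur in \<open>\<Xi>\<close>, so there is no
  equation to solve for the block directly. It is read off from the solutions at supported sizes,
  and its derivative has to be recovered from that of its copies; this is why isometries between
  levels are used in both directions.

  In the extension, simply requiring \<open>copies K X\<close> to lie in \<open>\<Xi>\<close> would
  not give a nc set. The direct sum of \<open>copies K X\<close> and \<open>copies K Y\<close>
  equals \<open>copies K\<close> of the direct sum of X and Y only up to a permutation of blocks,
  and \<open>\<Xi>\<close> need not be invariant under permutations. Letting the permutation depend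
  on X repairs this, at the price that a level becomes a union of subspaces. Two points may then
  have no piece in common, and nothing relates the values of \<open>g\<close> used for them; a
  global Lipschitz bound is therefore out of reach.\<close>

definition sublinear :: "(real \<Rightarrow> 'a \<Rightarrow> 'a) \<Rightarrow> ('a::ab_group_add \<Rightarrow> real) \<Rightarrow> bool" where
  "sublinear sc q \<longleftrightarrow>
     (\<forall>x y. q (x + y) \<le> q x + q y) \<and> (\<forall>r\<ge>0. \<forall>x. q (sc r x) = r * q x)"

text \<open>One inequality is enough for positive homogeneity: applied to \<open>1/r\<close> and
  \<open>sc r x\<close> it gives the reverse one.\<close>

lemma sublinearI:
  fixes sc :: "real \<Rightarrow> 'a::ab_group_add \<Rightarrow> 'a"
  assumes "Vector_Spaces.vector_space sc"
    and add: "\<And>x y. q (x + y) \<le> q x + q y" and zero: "q 0 = 0"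
    and pos: "\<And>r x. r > 0 \<Longrightarrow> q (sc r x) \<le> r * q x"
  shows "sublinear sc q"
  unfolding sublinear_def
proof (intro conjI allI impI)
  interpret Vector_Spaces.vector_space sc by fact
  fix r :: real and x assume "r \<ge> 0"
  show "q (sc r x) = r * q x"
  proof (cases "r = 0")
    case False
    with \<open>r \<ge> 0\<close> have r: "r > 0" by simp
    have "q x = q (sc (1/r) (sc r x))" using r by simp
    also have "\<dots> \<le> (1/r) * q (sc r x)" using r by (intro pos) simp
    finally have "r * q x \<le> q (sc r x)" using r by (simp add: field_simps)
    then show ?thesis using pos[OF r, of x] by simp
  qed (simp add: zero)
qed (rule add)

lemma sublinear_zero:
  assumes "Vector_Spaces.vector_space sc" "sublinear sc q"
  shows "q 0 = 0"
proof -
  interpret Vector_Spaces.vector_space sc by fact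
  have "q (sc 0 0) = 0 * q 0" using assms(2) unfolding sublinear_def by blast
  then show ?thesis by simp
qed

lemma sublinear_minus_ge:
  assumes "Vector_Spaces.vector_space sc" "sublinear sc q"
  shows "- q (- x) \<le> q x"
proof -
  have "q (x + - x) \<le> q x + q (- x)" using assms(2) unfolding sublinear_def by blast
  then show ?thesis using sublinear_zero[OF assms] by simp
qed

text \<open>By this descent, a minimal sublinear functional is odd and therefore linear.\<close>

lemma sublinear_descent:
  fixes sc :: "real \<Rightarrow> 'a::ab_group_add \<Rightarrow> 'a"
  assumes vs: "Vector_Spaces.vector_space sc" and q: "sublinear sc q"
  obtains u where "sublinear sc u" "\<And>x. u x \<le> q x" "u (- y) \<le> - q y"
proof -
  interpret Vector_Spaces.vector_space sc by fact
  have qa: "q (a + b) \<le> q a + q b" for a b using q unfolding sublinear_def by blast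
  have qs: "r \<ge> 0 \<Longrightarrow> q (sc r a) = r * q a" for r a using q unfolding sublinear_def by blast
  \<comment> \<open>Lowering of q along the ray through y. Taking r = 0 shows that the infimum stays
    below q, and r = 1 at the point -y produces the bound \<open>- q y\<close>.\<close>
  define F where "F x r = q (x + sc r y) - r * q y" for x r
  define u where "u x = (INF r\<in>{0..}. F x r)" for x
  have lower: "- q (- x) \<le> F x r" if "r \<ge> 0" for x r
  proof -
    have "r * q y = q ((x + sc r y) + - x)" using qs[OF that] by simp
    also have "\<dots> \<le> q (x + sc r y) + q (- x)" by (rule qa)
    finally show ?thesis by (simp add: F_def)
  qed
  have bdd: "bdd_below (F x ` {0..})" for x
    using lower[of _ x] by (intro bdd_belowI2) auto
  have u_le: "u x \<le> F x r" if "r \<ge> 0" for x r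
    unfolding u_def using that by (intro cINF_lower bdd) auto
  have u_ge: "c \<le> u x" if "\<And>r. r \<ge> 0 \<Longrightarrow> c \<le> F x r" for x c
    unfolding u_def using that by (intro cINF_greatest) auto
  have "sublinear sc u"
  proof (rule sublinearI[OF vs])
    show "u (a + b) \<le> u a + u b" for a b
    proof -
      have *: "u (a + b) \<le> F a r + F b s" if "r \<ge> 0" "s \<ge> 0" for r s
      proof -
        have "u (a + b) \<le> F (a + b) (r + s)" using that by (intro u_le) simp
        also have "\<dots> \<le> F a r + F b s"
          using qa[of "a + sc r y" "b + sc s y"]
          by (simp add: F_def scale_left_distrib algebra_simps)
        finally show ?thesis .
      qed
      have "u (a + b) - F b s \<le> u a" if "s \<ge> 0" for s
        using *[OF _ that] by (intro u_ge) (simp add: algebra_simps)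
      then have "u (a + b) - u a \<le> F b s" if "s \<ge> 0" for s
        using that by (simp add: algebra_simps)
      then have "u (a + b) - u a \<le> u b" by (rule u_ge)
      then show ?thesis by simp
    qed
    show "u 0 = 0"
      using u_le[of 0 0] lower[of _ 0] u_ge[of 0 0] sublinear_zero[OF vs q]
      by (force simp: F_def)
    show "u (sc c x) \<le> c * u x" if c: "c > 0" for c x
    proof -
      have "u (sc c x) / c \<le> F x r" if "r \<ge> 0" for r
      proof -
        have "u (sc c x) \<le> F (sc c x) (c * r)" using c that by (intro u_le) simp
        also have "\<dots> = q (sc c (x + sc r y)) - c * r * q y"
          by (simp add: F_def scale_right_distrib)
        also have "\<dots> = c * F x r" using c by (subst qs) (auto simp: F_def algebra_simps)
        finally show ?thesis using c by (simp add: field_simps)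
      qed
      then have "u (sc c x) / c \<le> u x" by (rule u_ge)
      then show ?thesis using c by (simp add: field_simps)
    qed
  qed
  moreover have "u x \<le> q x" for x using u_le[of 0 x] by (simp add: F_def)
  moreover have "u (- y) \<le> - q y"
    using u_le[of 1 "- y"] sublinear_zero[OF vs q] by (simp add: F_def)
  ultimately show thesis by (rule that)
qed

text \<open>The pointwise infimum works. It is finite because every member is at least
  \<open>- p (- x)\<close> at x, and it is subadditive because any two members of a chain have one
  of them below both.\<close>

lemma sublinear_chain_lower_bound:
  fixes sc :: "real \<Rightarrow> 'a::ab_group_add \<Rightarrow> 'a"
  assumes vs: "Vector_Spaces.vector_space sc"
    and C: "C \<noteq> {}" "\<And>q. q \<in> C \<Longrightarrow> sublinear sc q" "\<And>q x. q \<in> C \<Longrightarrow> q x \<le> p x"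
    and chain: "\<And>q r. q \<in> C \<Longrightarrow> r \<in> C \<Longrightarrow> q \<le> r \<or> r \<le> q"
  obtains u where "sublinear sc u" "\<And>q. q \<in> C \<Longrightarrow> u \<le> q"
proof -
  interpret Vector_Spaces.vector_space sc by fact
  define u where "u x = (INF q\<in>C. q x)" for x
  have lower: "- p (- x) \<le> q x" if "q \<in> C" for q x
    using sublinear_minus_ge[OF vs C(2)[OF that], of x] C(3)[OF that, of "- x"] by linarith
  have u_le: "u x \<le> q x" if "q \<in> C" for x q
    unfolding u_def using that lower by (intro cINF_lower bdd_belowI2) auto
  have u_ge: "c \<le> u x" if "\<And>q. q \<in> C \<Longrightarrow> c \<le> q x" for x c
    unfolding u_def using that C(1) by (intro cINF_greatest) auto
  have "sublinear sc u"
  proof (rule sublinearI[OF vs])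
    show "u (a + b) \<le> u a + u b" for a b
    proof -
      have *: "u (a + b) \<le> q a + r b" if "q \<in> C" "r \<in> C" for q r
      proof -
        have "\<exists>s\<in>C. s \<le> q \<and> s \<le> r" using chain[OF that] that by auto
        then obtain s where s: "s \<in> C" "s a \<le> q a" "s b \<le> r b" by (auto simp: le_fun_def)
        have "s (a + b) \<le> s a + s b" using C(2)[OF s(1)] unfolding sublinear_def by blast
        then show ?thesis using s u_le[OF s(1), of "a + b"] by linarith
      qed
      have "u (a + b) - r b \<le> u a" if "r \<in> C" for r
        using *[OF _ that] by (intro u_ge) (simp add: algebra_simps)
      then have "u (a + b) - u a \<le> r b" if "r \<in> C" for r
        using that by (simp add: algebra_simps)
      then have "u (a + b) - u a \<le> u b" by (rule u_ge)
      then show ?thesis by simp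
    qed
    have "q 0 = 0" if "q \<in> C" for q using sublinear_zero[OF vs C(2)[OF that]] .
    then show "u 0 = 0"
      using C(1) u_le[of _ 0] u_ge[of 0 0] by (metis antisym all_not_in_conv order_refl)
    show "u (sc c x) \<le> c * u x" if c: "c > 0" for c x
    proof -
      have "u (sc c x) / c \<le> q x" if "q \<in> C" for q
      proof -
        have "q (sc c x) = c * q x" using C(2)[OF that] c unfolding sublinear_def by simp
        then show ?thesis using u_le[OF that, of "sc c x"] c by (simp add: field_simps)
      qed
      then have "u (sc c x) / c \<le> u x" by (rule u_ge)
      then show ?thesis using c by (simp add: field_simps)
    qed
  qed
  then show thesis using u_le by (intro that) (auto simp: le_fun_def)
qed

text \<open>Zorn's lemma is applied with the order reversed. Minimality among sublinear functionals
  takes the place of extending a linear functional from subspace to subspace.\<close>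

lemma hahn_banach_sublinear:
  fixes sc :: "real \<Rightarrow> 'a::ab_group_add \<Rightarrow> 'a"
  assumes vs: "Vector_Spaces.vector_space sc" and p: "sublinear sc p"
  obtains \<phi> where "\<And>x y. \<phi> (x + y) = \<phi> x + \<phi> y" "\<And>r x. \<phi> (sc r x) = r * \<phi> x" "\<And>x. \<phi> x \<le> p x"
proof -
  interpret Vector_Spaces.vector_space sc by fact
  define A where "A = {q. sublinear sc q \<and> q \<le> p}"
  have "\<exists>m\<in>A. \<forall>a\<in>A. a \<le> m \<longrightarrow> a = m"
  proof (rule predicate_Zorn)
    show "partial_order_on A (relation_of (\<lambda>q r. r \<le> q) A)"
      by (rule partial_order_on_relation_ofI) auto
    fix C assume "C \<in> Chains (relation_of (\<lambda>q r. r \<le> q) A)"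
    then have C: "C \<subseteq> A" "\<And>q r. q \<in> C \<Longrightarrow> r \<in> C \<Longrightarrow> q \<le> r \<or> r \<le> q"
      by (auto simp: Chains_def relation_of_def)
    show "\<exists>u\<in>A. \<forall>a\<in>C. u \<le> a"
    proof (cases "C = {}")
      case True
      then show ?thesis using p by (auto simp: A_def)
    next
      case False
      obtain u where u: "sublinear sc u" "\<And>q. q \<in> C \<Longrightarrow> u \<le> q"
      proof (rule sublinear_chain_lower_bound[OF vs False _ _ C(2)])
        show "q \<in> C \<Longrightarrow> sublinear sc q" for q using C(1) by (auto simp: A_def)
        show "q \<in> C \<Longrightarrow> q x \<le> p x" for q x using C(1) by (auto simp: A_def le_fun_def)
      qed blast+
      obtain q where "q \<in> C" using False by blast
      then have "u \<le> p" using u(2)[of q] C(1) by (auto simp: A_def intro: order_trans)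
      then show ?thesis using u by (auto simp: A_def)
    qed
  qed
  then obtain \<phi> where \<phi>: "sublinear sc \<phi>" "\<phi> \<le> p"
    and min: "\<And>q. sublinear sc q \<Longrightarrow> q \<le> \<phi> \<Longrightarrow> q = \<phi>"
    unfolding A_def using order_trans by blast
  have sub: "\<phi> (x + y) \<le> \<phi> x + \<phi> y" for x y using \<phi>(1) unfolding sublinear_def by blast
  have hom: "r \<ge> 0 \<Longrightarrow> \<phi> (sc r x) = r * \<phi> x" for r x using \<phi>(1) unfolding sublinear_def by blast
  have odd: "\<phi> (- y) = - \<phi> y" for y
  proof -
    obtain u where "sublinear sc u" "\<And>x. u x \<le> \<phi> x" "u (- y) \<le> - \<phi> y"
      by (rule sublinear_descent[OF vs \<phi>(1), of y]) blast
    then have "\<phi> (- y) \<le> - \<phi> y" using min[of u] by (auto simp: le_fun_def)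
    then show ?thesis using sublinear_minus_ge[OF vs \<phi>(1), of y] by simp
  qed
  \<comment> \<open>Superadditivity is subadditivity for \<open>x + y\<close> and
    \<open>- y\<close>, rewritten by oddness.\<close>
  have "\<phi> (x + y) = \<phi> x + \<phi> y" for x y
    using sub[of x y] sub[of "x + y" "- y"] odd[of y] by simp
  moreover have "\<phi> (sc r x) = r * \<phi> x" for r x
  proof (cases "r \<ge> 0")
    case False
    then have "\<phi> (sc (- r) x) = - r * \<phi> x" by (intro hom) simp
    then show ?thesis using odd[of "sc r x"] by simp
  qed (rule hom)
  moreover have "\<phi> x \<le> p x" for x using \<phi>(2) by (simp add: le_fun_def)
  ultimately show thesis by (rule that)
qed

text \<open>A linear functional below p may be small at y. Descending along y before the minimal
  functional is taken caps its value at -y by \<open>- p y\<close>, so oddness forces the full value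
  \<open>p y\<close> at y.\<close>

lemma norming_functional:
  fixes sc :: "real \<Rightarrow> 'a::ab_group_add \<Rightarrow> 'a"
  assumes vs: "Vector_Spaces.vector_space sc"
    and tri: "\<And>x y. p (x + y) \<le> p x + p y" and hom: "\<And>r x. p (sc r x) = \<bar>r\<bar> * p x"
  obtains \<phi> where "\<And>x y. \<phi> (x + y) = \<phi> x + \<phi> y" "\<And>r x. \<phi> (sc r x) = r * \<phi> x"
    "\<And>x. \<bar>\<phi> x\<bar> \<le> p x" "\<phi> y = p y"
proof -
  interpret Vector_Spaces.vector_space sc by fact
  have p: "sublinear sc p" using tri hom by (simp add: sublinear_def)
  obtain u where u: "sublinear sc u" "\<And>x. u x \<le> p x" "u (- y) \<le> - p y"
    by (rule sublinear_descent[OF vs p, of y]) blast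
  obtain \<phi> where \<phi>: "\<And>x y. \<phi> (x + y) = \<phi> x + \<phi> y" "\<And>r x. \<phi> (sc r x) = r * \<phi> x" "\<And>x. \<phi> x \<le> u x"
    by (rule hahn_banach_sublinear[OF vs u(1)]) blast
  have odd: "\<phi> (- x) = - \<phi> x" for x using \<phi>(2)[of "-1" x] by simp
  have le: "\<phi> x \<le> p x" for x using \<phi>(3)[of x] u(2)[of x] by linarith
  have "\<bar>\<phi> x\<bar> \<le> p x" for x
    using le[of x] le[of "- x"] odd[of x] hom[of "-1" x] by simp
  moreover have "\<phi> y = p y"
    using le[of y] \<phi>(3)[of "- y"] u(3) odd[of y] by linarith
  ultimately show thesis using \<phi> that by blast
qed

section \<open>Differential equations in a closed subspace of a Banach space\<close>

text \<open>The interval may be unbounded or lack end points, while integrals and uniform limits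
  live on compact segments. A segment that has the same one- or two-sided neighbourhoods of t as I
  does not change derivatives at t.\<close>

lemma interval_local_segment:
  fixes I :: "real set"
  assumes I: "is_interval I" and "t0 \<in> I" "t \<in> I"
  obtains a b where "{a..b} \<subseteq> I" "t0 \<in> {a..b}" "t \<in> {a..b}" "at t within I = at t within {a..b}"
proof -
  have sub: "{a..b} \<subseteq> I" if "a \<in> I" "b \<in> I" for a b
    using I that by (meson atLeastAtMost_iff mem_is_interval_1_I subsetI)
  \<comment> \<open>If I continues beyond t and t0, the segment does so too and b is itself the
    barrier u. Otherwise the larger of t and t0 is the right end of I, and any u beyond t will
    do.\<close>
  obtain b u where b: "b \<in> I" "max t t0 \<le> b" "t < u" "\<And>s. s \<in> I \<Longrightarrow> s < u \<Longrightarrow> s \<le> b"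
  proof (cases "\<exists>b\<in>I. max t t0 < b")
    case True
    then obtain b where "b \<in> I" "max t t0 < b" by blast
    then show ?thesis using that[of b b] by auto
  next
    case False
    then show ?thesis using that[of "max t t0" "t + 1"] assms(2,3)
      by (metis less_add_one linorder_not_less max_def order_refl)
  qed
  obtain a l where a: "a \<in> I" "a \<le> min t t0" "l < t" "\<And>s. s \<in> I \<Longrightarrow> l < s \<Longrightarrow> a \<le> s"
  proof (cases "\<exists>a\<in>I. a < min t t0")
    case True
    then obtain a where "a \<in> I" "a < min t t0" by blast
    then show ?thesis using that[of a a] by auto
  next
    case False
    then have "\<And>s. s \<in> I \<Longrightarrow> min t t0 \<le> s" by force
    moreover have "min t t0 \<in> I" using assms(2,3) by (auto simp: min_def)
    ultimately show ?thesis using that[of "min t t0" "t - 1"] by simp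
  qed
  have "at t within I = at t within {a..b}"
  proof (rule at_within_nhd)
    show "t \<in> {l<..<u}" "open {l<..<u}" using a b by auto
    show "I \<inter> {l<..<u} - {t} = {a..b} \<inter> {l<..<u} - {t}" using a b sub[OF a(1) b(1)] by auto
  qed
  then show thesis using that[of a b] a b sub[OF a(1) b(1)] by auto
qed

text \<open>The induction step of both the uniqueness proof and the Picard estimate: each use raises
  the power by one and contributes the factor \<open>1 / Suc k\<close> from which the factorial is
  built.\<close>

lemma norm_le_of_deriv_le_power:
  fixes z :: "real \<Rightarrow> 'b::real_normed_vector"
  assumes I: "is_interval I" "t0 \<in> I" "t \<in> I" and z0: "z t0 = 0"
    and der: "\<And>s. s \<in> I \<Longrightarrow> (z has_vector_derivative z' s) (at s within I)"
    and bnd: "\<And>s. s \<in> closed_segment t0 t \<Longrightarrow> norm (z' s) \<le> B * \<bar>s - t0\<bar> ^ k"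
  shows "norm (z t) \<le> B * \<bar>t - t0\<bar> ^ Suc k / Suc k"
proof -
  have sub: "closed_segment t0 t \<subseteq> I"
    using I is_interval_convex closed_segment_subset by blast
  have cont: "continuous_on I z"
    using der by (auto simp: continuous_on_eq_continuous_within intro: has_vector_derivative_continuous)
  have der': "(z has_vector_derivative z' s) (at s)" if "a < s" "s < b" "{a..b} \<subseteq> I" for a b s
  proof -
    have "(z has_vector_derivative z' s) (at s within {a<..<b})"
      using that by (intro has_vector_derivative_within_subset[OF der]) auto
    then show ?thesis using that by (simp add: at_within_open[of s "{a<..<b}"])
  qed
  consider "t0 < t" | "t < t0" | "t = t0" by linarith
  then show ?thesis
  proof cases
    case 1
    define \<phi> where "\<phi> s = B * (s - t0) ^ Suc k / Suc k" for s
    have seg: "{t0..t} \<subseteq> I" "closed_segment t0 t = {t0..t}"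
      using sub 1 by (auto simp: closed_segment_eq_real_ivl)
    have "norm (z t - z t0) \<le> \<phi> t - \<phi> t0"
    proof (rule differentiable_bound_general[OF 1 _ _ der'])
      show "continuous_on {t0..t} z" using cont seg continuous_on_subset by blast
      show "continuous_on {t0..t} \<phi>" unfolding \<phi>_def by (intro continuous_intros) auto
      fix s assume s: "t0 < s" "s < t"
      show "(\<phi> has_vector_derivative B * (s - t0) ^ k) (at s)"
        unfolding \<phi>_def has_real_derivative_iff_has_vector_derivative[symmetric]
        by (auto intro!: derivative_eq_intros simp del: power_Suc of_nat_Suc simp: field_simps)
      show "norm (z' s) \<le> B * (s - t0) ^ k" using bnd[of s] s seg by auto
    qed (use seg in auto)
    then show ?thesis using 1 z0 by (simp add: \<phi>_def)
  next
    case 2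
    \<comment> \<open>To the left of t0 the sign is reversed, so that the comparison function has
      the nonnegative derivative bound and the mean value inequality runs from t up to t0.\<close>
    define \<phi> where "\<phi> s = - (B * (t0 - s) ^ Suc k / Suc k)" for s
    have seg: "{t..t0} \<subseteq> I" "closed_segment t0 t = {t..t0}"
      using sub 2 by (auto simp: closed_segment_eq_real_ivl)
    have "norm (z t0 - z t) \<le> \<phi> t0 - \<phi> t"
    proof (rule differentiable_bound_general[OF 2 _ _ der'])
      show "continuous_on {t..t0} z" using cont seg continuous_on_subset by blast
      show "continuous_on {t..t0} \<phi>" unfolding \<phi>_def by (intro continuous_intros) auto
      fix s assume s: "t < s" "s < t0"
      show "(\<phi> has_vector_derivative B * (t0 - s) ^ k) (at s)"
        unfolding \<phi>_def has_real_derivative_iff_has_vector_derivative[symmetric]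
        by (auto intro!: derivative_eq_intros simp del: power_Suc of_nat_Suc simp: field_simps)
      show "norm (z' s) \<le> B * (t0 - s) ^ k" using bnd[of s] s seg by auto
    qed (use seg in auto)
    then show ?thesis using 2 z0 by (simp add: \<phi>_def)
  qed (simp add: z0)
qed

text \<open>Starting from a bound A on the compact segment, the inequality is fed into itself k
  times. The resulting bound is A times a term of the exponential series at
  \<open>C * \<bar>t - t0\<bar>\<close>, and such terms tend to zero.\<close>

lemma gronwall_zero:
  fixes z :: "real \<Rightarrow> 'b::real_normed_vector"
  assumes I: "is_interval I" "t0 \<in> I" "t \<in> I" and z0: "z t0 = 0"
    and der: "\<And>s. s \<in> I \<Longrightarrow> (z has_vector_derivative z' s) (at s within I)"
    and bnd: "\<And>s. s \<in> I \<Longrightarrow> norm (z' s) \<le> C * norm (z s)" and C: "C \<ge> 0"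
  shows "z t = 0"
proof -
  let ?S = "closed_segment t0 t"
  have sub: "?S \<subseteq> I" using I is_interval_convex closed_segment_subset by blast
  have cont: "continuous_on I z"
    using der by (auto simp: continuous_on_eq_continuous_within intro: has_vector_derivative_continuous)
  then have "bounded (z ` ?S)"
    by (intro compact_imp_bounded compact_continuous_image)
       (use sub continuous_on_subset in \<open>auto simp: compact_segment\<close>)
  then obtain A where A: "\<And>s. s \<in> ?S \<Longrightarrow> norm (z s) \<le> A" by (auto simp: bounded_iff)
  have *: "\<forall>s\<in>?S. norm (z s) \<le> A * C ^ k / fact k * \<bar>s - t0\<bar> ^ k" for k
  proof (induction k)
    case (Suc k)
    show ?case
    proof
      fix s assume s: "s \<in> ?S"
      have "norm (z s) \<le> C * (A * C ^ k / fact k) * \<bar>s - t0\<bar> ^ Suc k / Suc k"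
      proof (rule norm_le_of_deriv_le_power[where z' = z' and I = I])
        fix r assume "r \<in> closed_segment t0 s"
        then have r: "r \<in> ?S" using s subset_closed_segment[of t0 s t0 t] by auto
        have "norm (z' r) \<le> C * norm (z r)" using r sub by (intro bnd) auto
        also have "\<dots> \<le> C * (A * C ^ k / fact k * \<bar>r - t0\<bar> ^ k)"
          using Suc r C by (intro mult_left_mono) auto
        finally show "norm (z' r) \<le> C * (A * C ^ k / fact k) * \<bar>r - t0\<bar> ^ k" by (simp add: mult.assoc)
      qed (use s sub I z0 der in auto)
      then show "norm (z s) \<le> A * C ^ Suc k / fact (Suc k) * \<bar>s - t0\<bar> ^ Suc k"
        by (simp add: field_simps)
    qed
  qed (use A in auto)
  have "(\<lambda>k. A * (inverse (fact k) *\<^sub>R (C * \<bar>t - t0\<bar>) ^ k)) \<longlonglongrightarrow> A * 0"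
    by (intro tendsto_mult tendsto_const summable_LIMSEQ_zero summable_exp_generic)
  then have "norm (z t) \<le> A * 0"
  proof (rule tendsto_lowerbound)
    show "\<forall>\<^sub>F k in sequentially. norm (z t) \<le> A * (inverse (fact k) *\<^sub>R (C * \<bar>t - t0\<bar>) ^ k)"
      by (intro always_eventually allI) (use * in \<open>force simp: power_mult_distrib divide_inverse ac_simps\<close>)
  qed simp
  then show ?thesis by simp
qed

text \<open>Riemann sums are linear combinations of values of c, hence lie in M, and they
  approximate the integral.\<close>

lemma integral_in_closed_subspace:
  fixes c :: "real \<Rightarrow> 'b::banach"
  assumes M: "subspace M" "closed M" and c: "c integrable_on {a..b}" "\<And>s. s \<in> {a..b} \<Longrightarrow> c s \<in> M"
  shows "integral {a..b} c \<in> M"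
proof -
  have "\<exists>y\<in>M. dist y (integral {a..b} c) < e" if e: "e > 0" for e
  proof -
    have "(c has_integral integral {a..b} c) {a..b}" using c(1) by (rule integrable_integral)
    from has_integral_real[THEN iffD1, rule_format, OF this e]
    obtain \<gamma> where \<gamma>: "gauge \<gamma>" "\<forall>\<D>. \<D> tagged_division_of {a..b} \<and> \<gamma> fine \<D> \<longrightarrow>
        norm ((\<Sum>(x,k)\<in>\<D>. measure lborel k *\<^sub>R c x) - integral {a..b} c) < e"
      by (elim exE conjE) (rule that)
    obtain \<D> where D: "\<D> tagged_division_of {a..b}" "\<gamma> fine \<D>"
      using fine_division_exists_real[OF \<gamma>(1)] .
    have "(\<Sum>(x,k)\<in>\<D>. measure lborel k *\<^sub>R c x) \<in> M"
    proof (rule subspace_sum[OF M(1)])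
      fix p assume "p \<in> \<D>"
      moreover obtain x k where "p = (x, k)" by force
      ultimately have "p = (x, k)" "x \<in> {a..b}" using tag_in_interval[OF D(1)] by auto
      then show "(case p of (x, k) \<Rightarrow> measure lborel k *\<^sub>R c x) \<in> M"
        using c(2) M(1) by (simp add: subspace_mul)
    qed
    then show ?thesis using \<gamma>(2)[rule_format, OF conjI, OF D] unfolding dist_norm by blast
  qed
  then show ?thesis using M(2) closed_approachable by blast
qed

lemma primitive_in_closed_subspace:
  fixes c :: "real \<Rightarrow> 'b::banach"
  assumes I: "is_interval I" "t0 \<in> I" and M: "subspace M" "closed M"
    and c: "continuous_on I c" "\<And>s. s \<in> I \<Longrightarrow> c s \<in> M"
  obtains P where "P t0 = 0" "\<And>t. t \<in> I \<Longrightarrow> P t \<in> M"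
    "\<And>t. t \<in> I \<Longrightarrow> (P has_vector_derivative c t) (at t within I)"
proof -
  \<comment> \<open>This is the oriented integral: whichever term has its bounds in the wrong order
    is an integral over the empty set and vanishes.\<close>
  define P where "P t = integral {t0..t} c - integral {t..t0} c" for t
  have sub: "{a..b} \<subseteq> I" if "a \<in> I" "b \<in> I" for a b
    using I(1) that by (meson atLeastAtMost_iff mem_is_interval_1_I subsetI)
  have "P t0 = 0" by (simp add: P_def)
  have "P t \<in> M \<and> (P has_vector_derivative c t) (at t within I)" if t: "t \<in> I" for t
  proof -
    have int: "c integrable_on {a..b}" if "{a..b} \<subseteq> I" for a b
      using that c(1) continuous_on_subset integrable_continuous_real by blast
    have "integral {t0..t} c \<in> M" "integral {t..t0} c \<in> M"
      using I t c(2) by (auto intro!: integral_in_closed_subspace[OF M] int sub dest: sub[THEN subsetD, rotated 2])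
    then have PM: "P t \<in> M" unfolding P_def by (rule subspace_diff[OF M(1)])
    obtain a b where ab: "{a..b} \<subseteq> I" "t0 \<in> {a..b}" "t \<in> {a..b}" "at t within I = at t within {a..b}"
      by (rule interval_local_segment[OF I t])
    have P_eq: "P s = integral {a..s} c - integral {a..t0} c" if "s \<in> {a..b}" for s
    proof (cases "t0 \<le> s")
      case True
      have "integral {a..t0} c + integral {t0..s} c = integral {a..s} c"
        using True that ab by (intro Henstock_Kurzweil_Integration.integral_combine int) auto
      moreover have "integral {s..t0} c = 0" using True by (cases "s = t0") auto
      ultimately show ?thesis by (simp add: P_def algebra_simps)
    next
      case False
      have "integral {a..s} c + integral {s..t0} c = integral {a..t0} c"
        using False that ab by (intro Henstock_Kurzweil_Integration.integral_combine int) auto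
      then show ?thesis using False by (simp add: P_def algebra_simps)
    qed
    have "((\<lambda>s. integral {a..s} c - integral {a..t0} c) has_vector_derivative c t - 0) (at t within {a..b})"
      using ab c(1) continuous_on_subset
      by (intro has_vector_derivative_diff integral_has_vector_derivative has_vector_derivative_const) blast+
    then have "(P has_vector_derivative c t) (at t within {a..b})"
      using ab(3) by (auto intro: has_vector_derivative_transform[rotated 2] simp: P_eq)
    then show ?thesis using PM by (simp add: ab(4))
  qed
  then show thesis using that \<open>P t0 = 0\<close> by blast
qed

text \<open>The factorial decay of the differences of iterates gives convergence on every compact
  segment around t0, so the solution is global without gluing local ones. As f is controlled only on
  M, staying in M is part of the invariant of the iteration.\<close>

lemma picard_lindeloef_closed_subspace:
  fixes f :: "real \<Rightarrow> 'b::banach \<Rightarrow> 'b"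
  assumes I: "is_interval I" "t0 \<in> I" and M: "subspace M" "closed M"
    and f: "continuous_on (I \<times> M) (\<lambda>(t, x). f t x)" "\<And>t x. t \<in> I \<Longrightarrow> x \<in> M \<Longrightarrow> f t x \<in> M"
    and lip: "\<And>t x y. t \<in> I \<Longrightarrow> x \<in> M \<Longrightarrow> y \<in> M \<Longrightarrow> norm (f t x - f t y) \<le> C * norm (x - y)"
    and C: "C \<ge> 0" and x0: "x0 \<in> M"
  obtains x where "x t0 = x0" "\<And>t. t \<in> I \<Longrightarrow> x t \<in> M"
    "\<And>t. t \<in> I \<Longrightarrow> (x has_vector_derivative f t (x t)) (at t within I)"
proof -
  have cont_f: "continuous_on I (\<lambda>s. f s (y s))" if "continuous_on I y" "\<And>s. s \<in> I \<Longrightarrow> y s \<in> M" for y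
  proof -
    have "continuous_on I ((\<lambda>(t, x). f t x) \<circ> (\<lambda>s. (s, y s)))"
      using that by (intro continuous_on_compose continuous_on_subset[OF f(1)] continuous_intros) auto
    then show ?thesis by (simp add: o_def)
  qed
  \<comment> \<open>The conjunct for \<open>k = 0\<close> pins down the first iterate as constant;
    otherwise dependent choice would leave it unknown, and the first difference could not be
    bounded.\<close>
  have "\<exists>x. \<forall>k. (\<forall>t\<in>I. x k t \<in> M) \<and> continuous_on I (x k) \<and> x k t0 = x0 \<and>
      (k = 0 \<longrightarrow> x k = (\<lambda>_. x0)) \<and>
      (\<forall>t\<in>I. (x (Suc k) has_vector_derivative f t (x k t)) (at t within I))"
  proof (rule dependent_nat_choice[where
      P = "\<lambda>k y. (\<forall>t\<in>I. y t \<in> M) \<and> continuous_on I y \<and> y t0 = x0 \<and> (k = 0 \<longrightarrow> y = (\<lambda>_. x0))" and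
      Q = "\<lambda>k y y'. \<forall>t\<in>I. (y' has_vector_derivative f t (y t)) (at t within I)", simplified conj_assoc])
    show "\<exists>y. (\<forall>t\<in>I. y t \<in> M) \<and> continuous_on I y \<and> y t0 = x0 \<and> ((0::nat) = 0 \<longrightarrow> y = (\<lambda>_. x0))"
      using x0 by (intro exI[of _ "\<lambda>_. x0"]) auto
  next
    fix y and k :: nat
    assume y: "(\<forall>t\<in>I. y t \<in> M) \<and> continuous_on I y \<and> y t0 = x0 \<and> (k = 0 \<longrightarrow> y = (\<lambda>_. x0))"
    obtain P where P: "P t0 = 0" "\<And>t. t \<in> I \<Longrightarrow> P t \<in> M"
      "\<And>t. t \<in> I \<Longrightarrow> (P has_vector_derivative f t (y t)) (at t within I)"
      by (rule primitive_in_closed_subspace[OF I M cont_f[of y]]) (use y f(2) in auto)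
    let ?y = "\<lambda>t. x0 + P t"
    have der: "(?y has_vector_derivative f t (y t)) (at t within I)" if "t \<in> I" for t
      using P(3)[OF that] by (auto intro!: derivative_eq_intros)
    then have "continuous_on I ?y"
      by (auto simp: continuous_on_eq_continuous_within intro: has_vector_derivative_continuous)
    then show "\<exists>y'. (\<forall>t\<in>I. y' t \<in> M) \<and> continuous_on I y' \<and> y' t0 = x0 \<and>
        (Suc k = 0 \<longrightarrow> y' = (\<lambda>_. x0)) \<and>
        (\<forall>t\<in>I. (y' has_vector_derivative f t (y t)) (at t within I))"
      using der P x0 M(1) by (intro exI[of _ ?y]) (auto intro: subspace_add)
  qed
  then obtain x where xM: "\<And>k t. t \<in> I \<Longrightarrow> x k t \<in> M" and x_t0: "\<And>k. x k t0 = x0"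
    and x_0: "x 0 = (\<lambda>_. x0)"
    and x_der: "\<And>k t. t \<in> I \<Longrightarrow> (x (Suc k) has_vector_derivative f t (x k t)) (at t within I)"
    by metis
  define \<xi> where "\<xi> t = lim (\<lambda>k. x k t)" for t
  have unif: "uniform_limit {a..b} x \<xi> sequentially" if ab: "{a..b} \<subseteq> I" "t0 \<in> {a..b}" for a b
  proof -
    have "continuous_on {a..b} (\<lambda>s. f s x0)"
      using cont_f[of "\<lambda>_. x0"] x0 ab continuous_on_subset by auto
    then have "bounded ((\<lambda>s. f s x0) ` {a..b})"
      by (intro compact_imp_bounded compact_continuous_image) auto
    then obtain A where A: "\<And>s. s \<in> {a..b} \<Longrightarrow> norm (f s x0) \<le> A"
      unfolding bounded_iff by (metis imageI)
    have A0: "A \<ge> 0" using A[OF ab(2)] norm_ge_zero order_trans by blast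
    have seg: "closed_segment t0 s \<subseteq> {a..b}" if "s \<in> {a..b}" for s
      using that ab(2) by (auto simp: closed_segment_eq_real_ivl)
    let ?D = "\<lambda>k s. x (Suc k) s - x k s"
    have D: "\<forall>s\<in>{a..b}. norm (?D k s) \<le> A * C ^ k / fact (Suc k) * \<bar>s - t0\<bar> ^ Suc k" for k
    proof (induction k)
      case 0
      show ?case
      proof
        fix s assume s: "s \<in> {a..b}"
        have "norm (?D 0 s) \<le> A * \<bar>s - t0\<bar> ^ Suc 0 / Suc 0"
        proof (rule norm_le_of_deriv_le_power[OF I, where z' = "\<lambda>s. f s x0"])
          show "r \<in> closed_segment t0 s \<Longrightarrow> norm (f r x0) \<le> A * \<bar>r - t0\<bar> ^ 0" for r
            using A seg[OF s] by auto
          show "r \<in> I \<Longrightarrow> (?D 0 has_vector_derivative f r x0) (at r within I)" for r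
            using x_der[of r 0] by (auto simp: x_0 intro!: derivative_eq_intros)
        qed (use s ab x_t0 in auto)
        then show "norm (?D 0 s) \<le> A * C ^ 0 / fact (Suc 0) * \<bar>s - t0\<bar> ^ Suc 0" by simp
      qed
    next
      case (Suc k)
      show ?case
      proof
        fix s assume s: "s \<in> {a..b}"
        have "norm (?D (Suc k) s) \<le> C * (A * C ^ k / fact (Suc k)) * \<bar>s - t0\<bar> ^ Suc (Suc k) / Suc (Suc k)"
        proof (rule norm_le_of_deriv_le_power[OF I, where z' = "\<lambda>s. f s (x (Suc k) s) - f s (x k s)"])
          fix r assume "r \<in> closed_segment t0 s"
          then have r: "r \<in> {a..b}" using seg[OF s] by auto
          have "norm (f r (x (Suc k) r) - f r (x k r)) \<le> C * norm (?D k r)"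
            using r ab xM by (intro lip) auto
          also have "\<dots> \<le> C * (A * C ^ k / fact (Suc k) * \<bar>r - t0\<bar> ^ Suc k)"
            using Suc r C by (intro mult_left_mono) auto
          finally show "norm (f r (x (Suc k) r) - f r (x k r))
              \<le> C * (A * C ^ k / fact (Suc k)) * \<bar>r - t0\<bar> ^ Suc k" by (simp only: mult.assoc)
        next
          show "r \<in> I \<Longrightarrow> (?D (Suc k) has_vector_derivative f r (x (Suc k) r) - f r (x k r)) (at r within I)" for r
            by (intro has_vector_derivative_diff x_der)
        qed (use s ab x_t0 in auto)
        then show "norm (?D (Suc k) s) \<le> A * C ^ Suc k / fact (Suc (Suc k)) * \<bar>s - t0\<bar> ^ Suc (Suc k)"
          by (simp add: field_simps)
      qed
    qed
    \<comment> \<open>Replacing \<open>fact (Suc k)\<close> by \<open>fact k\<close> turns the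
      majorant into a multiple of the exponential series at \<open>C * (b - a)\<close>.\<close>
    define m where "m k = A * (b - a) * (inverse (fact k) *\<^sub>R (C * (b - a)) ^ k)" for k
    have "uniform_limit {a..b} (\<lambda>n s. \<Sum>i<n. ?D i s) (\<lambda>s. suminf (\<lambda>i. ?D i s)) sequentially"
    proof (rule Weierstrass_m_test)
      show "summable m" unfolding m_def by (intro summable_mult summable_exp_generic)
      fix k s assume s: "s \<in> {a..b}"
      have "norm (?D k s) \<le> A * C ^ k / fact (Suc k) * \<bar>s - t0\<bar> ^ Suc k" using D s by blast
      also have "\<dots> \<le> A * C ^ k / fact k * (b - a) ^ Suc k"
        using A0 C s ab(2) by (intro mult_mono power_mono divide_left_mono fact_mono mult_nonneg_nonneg) auto
      also have "\<dots> = m k" by (simp only: m_def power_mult_distrib) (simp add: divide_inverse)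
      finally show "norm (?D k s) \<le> m k" .
    qed
    then have "uniform_limit {a..b} (\<lambda>n s. x0 + (\<Sum>i<n. ?D i s)) (\<lambda>s. x0 + suminf (\<lambda>i. ?D i s)) sequentially"
      by (intro uniform_limit_intros)
    moreover have "x0 + (\<Sum>i<n. ?D i s) = x n s" for n s
      by (subst sum_lessThan_telescope) (simp add: x_0)
    ultimately have u: "uniform_limit {a..b} x (\<lambda>s. x0 + suminf (\<lambda>i. ?D i s)) sequentially" by simp
    have "\<xi> s = x0 + suminf (\<lambda>i. ?D i s)" if "s \<in> {a..b}" for s
      using tendsto_uniform_limitI[OF u that] unfolding \<xi>_def by (rule limI)
    then show ?thesis using u by (subst uniform_limit_cong'[of _ _ x _ "\<lambda>s. x0 + suminf (\<lambda>i. ?D i s)"]) auto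
  qed
  show thesis
  proof
    show "\<xi> t0 = x0" using x_t0 by (simp add: \<xi>_def)
    fix t assume t: "t \<in> I"
    obtain a b where ab: "{a..b} \<subseteq> I" "t0 \<in> {a..b}" "t \<in> {a..b}" "at t within I = at t within {a..b}"
      by (rule interval_local_segment[OF I t])
    have lim: "(\<lambda>k. x k s) \<longlonglongrightarrow> \<xi> s" if "s \<in> {a..b}" for s
      using tendsto_uniform_limitI[OF unif[OF ab(1,2)] that] .
    have \<xi>M: "\<xi> s \<in> M" if "s \<in> {a..b}" for s
      using that ab xM by (intro closed_sequentially[OF M(2) _ lim[OF that]]) auto
    then show "\<xi> t \<in> M" using ab by blast
    \<comment> \<open>Termwise differentiation needs the derivatives to converge uniformly; the
      Lipschitz condition passes this on from the iterates to \<open>f s (x n s)\<close>.\<close>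
    have "\<exists>g. \<forall>s\<in>{a..b}. (\<lambda>n. x (Suc n) s) \<longlonglongrightarrow> g s \<and>
        (g has_derivative (\<lambda>h. h *\<^sub>R f s (\<xi> s))) (at s within {a..b})"
    proof (rule has_derivative_sequence[where f' = "\<lambda>n s h. h *\<^sub>R f s (x n s)"])
      show "(x (Suc n) has_derivative (\<lambda>h. h *\<^sub>R f s (x n s))) (at s within {a..b})"
        if "s \<in> {a..b}" for n s
        using that ab x_der[of s n] has_vector_derivative_within_subset
        unfolding has_vector_derivative_def[symmetric] by blast
      fix e :: real assume e: "e > 0"
      \<comment> \<open>The denominator is \<open>C + 1\<close> because C may be zero.\<close>
      have "\<forall>\<^sub>F n in sequentially. \<forall>s\<in>{a..b}. dist (x n s) (\<xi> s) < e / (C + 1)"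
        using e C by (intro uniform_limitD[OF unif[OF ab(1,2)]]) simp
      then show "\<forall>\<^sub>F n in sequentially. \<forall>s\<in>{a..b}. \<forall>h::real.
          norm (h *\<^sub>R f s (x n s) - h *\<^sub>R f s (\<xi> s)) \<le> e * norm h"
      proof eventually_elim
        case (elim n)
        show ?case
        proof (intro ballI allI)
          fix s h :: real assume s: "s \<in> {a..b}"
          have "norm (f s (x n s) - f s (\<xi> s)) \<le> C * norm (x n s - \<xi> s)"
            using s ab \<xi>M xM by (intro lip) auto
          also have "\<dots> \<le> C * (e / (C + 1))"
            using elim s C by (intro mult_left_mono) (auto simp: dist_norm less_imp_le)
          also have "\<dots> \<le> e" using e C by (simp add: field_simps)
          finally have "norm h * norm (f s (x n s) - f s (\<xi> s)) \<le> norm h * e"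
            by (rule mult_left_mono) simp
          then show "norm (h *\<^sub>R f s (x n s) - h *\<^sub>R f s (\<xi> s)) \<le> e * norm h"
            by (simp add: scaleR_diff_right[symmetric] mult.commute)
        qed
      qed
    qed (use ab x_t0 in auto)
    then obtain g where g: "\<And>s. s \<in> {a..b} \<Longrightarrow> (\<lambda>n. x (Suc n) s) \<longlonglongrightarrow> g s"
      "\<And>s. s \<in> {a..b} \<Longrightarrow> (g has_vector_derivative f s (\<xi> s)) (at s within {a..b})"
      unfolding has_vector_derivative_def by blast
    have "g s = \<xi> s" if "s \<in> {a..b}" for s
      using g(1)[OF that] LIMSEQ_Suc[OF lim[OF that]] LIMSEQ_unique by blast
    then have "(\<xi> has_vector_derivative f t (\<xi> t)) (at t within {a..b})"
      using g(2)[OF ab(3)] ab(3) by (auto intro: has_vector_derivative_transform[rotated 2])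
    then show "(\<xi> has_vector_derivative f t (\<xi> t)) (at t within I)" by (simp add: ab(4))
  qed
qed

section \<open>Calculus in the matrix levels of an operator space\<close>

text \<open>Derivatives of matrix curves are defined by difference quotients, whereas calculus in
  normed spaces is phrased with linear approximations.\<close>

lemma has_vector_derivative_iff_quotient:
  "(f has_vector_derivative D) (at t within S) \<longleftrightarrow>
     ((\<lambda>s. (1 / (s - t)) *\<^sub>R (f s - f t)) \<longlongrightarrow> D) (at t within S)"
proof -
  have "norm ((1 / norm (s - t)) *\<^sub>R (f s - (f t + (s - t) *\<^sub>R D))) =
      norm ((1 / (s - t)) *\<^sub>R (f s - f t) - D)" if "s \<noteq> t" for s
  proof -
    have "(1 / (s - t)) *\<^sub>R (f s - f t) - D = (1 / (s - t)) *\<^sub>R (f s - (f t + (s - t) *\<^sub>R D))"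
      using that by (simp add: scaleR_diff_right scaleR_add_right)
    then show ?thesis by simp
  qed
  then have "((\<lambda>s. norm ((1 / norm (s - t)) *\<^sub>R (f s - (f t + (s - t) *\<^sub>R D)))) \<longlongrightarrow> 0) (at t within S) \<longleftrightarrow>
      ((\<lambda>s. norm ((1 / (s - t)) *\<^sub>R (f s - f t) - D)) \<longlongrightarrow> 0) (at t within S)"
    by (intro tendsto_cong) (auto simp: eventually_at_filter)
  then show ?thesis
    unfolding has_vector_derivative_def has_derivative_within tendsto_norm_zero_iff Lim_null[of _ D]
    by (simp add: bounded_linear_scaleR_left)
qed

instance bcontfun :: (metric_space, banach) banach ..

context operator_space
begin

text \<open>Time is real, so real linearity is what differentiation sees, even over complex scalars.
  All conditions are confined to one carrier, since addition forms a group only among matrices of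
  one size.\<close>

definition norm_embedding :: "nat \<Rightarrow> ('v mat \<Rightarrow> 'b::real_normed_vector) \<Rightarrow> bool" where
  "norm_embedding n T \<longleftrightarrow>
     (\<forall>X\<in>carrier_mat n n. \<forall>Y\<in>carrier_mat n n. T (X + Y) = T X + T Y) \<and>
     (\<forall>c. \<forall>X\<in>carrier_mat n n. T (map_mat (smul (of_real c)) X) = c *\<^sub>R T X) \<and>
     (\<forall>X\<in>carrier_mat n n. norm (T X) = nrm n X)"

text \<open>X is sent to the function whose value at M is \<open>\<phi> M\<close> applied to X,
  where \<open>\<phi> M\<close> norms M. Functionals need a total vector space, so matrices are
  replaced by functions on all index pairs, on which the norm becomes the seminorm p that ignores
  indices outside the matrix.\<close>

lemma norm_embedding_exists:
  assumes n: "n \<ge> 1"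
  obtains T :: "'v mat \<Rightarrow> ('v mat discrete \<Rightarrow>\<^sub>C real)" where "norm_embedding n T"
proof -
  define sc :: "real \<Rightarrow> (nat \<times> nat \<Rightarrow> 'v) \<Rightarrow> nat \<times> nat \<Rightarrow> 'v"
    where "sc r f = (\<lambda>i. smul (of_real r) (f i))" for r f
  define p where "p f = nrm n (mat n n f)" for f
  define h :: "'v mat \<Rightarrow> nat \<times> nat \<Rightarrow> 'v"
    where "h X = (\<lambda>(i, j). if i < n \<and> j < n then X $$ (i, j) else 0)" for X
  have vs: "Vector_Spaces.vector_space sc"
    by unfold_locales (auto simp: sc_def fun_eq_iff scale_right_distrib scale_left_distrib)
  have tri: "p (f + g) \<le> p f + p g" for f g
  proof -
    have "mat n n (f + g) = mat n n f + mat n n g" by (rule eq_matI) auto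
    then show ?thesis using nrm_triangle[OF n] by (simp add: p_def)
  qed
  have hom: "p (sc r f) = \<bar>r\<bar> * p f" for r f
  proof -
    have "mat n n (sc r f) = map_mat (smul (of_real r)) (mat n n f)" by (rule eq_matI) (auto simp: sc_def)
    then show ?thesis using nrm_scale[OF n, of "mat n n f" "of_real r"] by (simp add: p_def)
  qed
  have ph: "p (h X) = nrm n X" if "X \<in> carrier_mat n n" for X
  proof -
    have "mat n n (h X) = X" using that by (intro eq_matI) (auto simp: h_def)
    then show ?thesis by (simp add: p_def)
  qed
  have "\<exists>\<phi>. (\<forall>x y. \<phi> (x + y) = \<phi> x + \<phi> y) \<and> (\<forall>r x. \<phi> (sc r x) = r * \<phi> x) \<and>
      (\<forall>x. \<bar>\<phi> x\<bar> \<le> p x) \<and> \<phi> (h M) = p (h M)" for M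
    by (rule norming_functional[where p = p and y = "h M", OF vs tri hom]) blast
  then obtain \<phi> where \<phi>: "\<And>M x y. \<phi> M (x + y) = \<phi> M x + \<phi> M y"
    "\<And>M r x. \<phi> M (sc r x) = r * \<phi> M x" "\<And>M x. \<bar>\<phi> M x\<bar> \<le> p x" "\<And>M. \<phi> M (h M) = p (h M)"
    by metis
  \<comment> \<open>On a discrete space every bounded function is continuous, so the target is the
    space of all bounded functions with the supremum norm.\<close>
  define T where "T X = Bcontfun (\<lambda>m. \<phi> (of_discrete m) (h X))" for X
  have T: "apply_bcontfun (T X) m = \<phi> (of_discrete m) (h X)" for X m
  proof -
    have "continuous_on UNIV (\<lambda>m. \<phi> (of_discrete m) (h X))"
      by (simp add: continuous_on_open_vimage open_discrete)
    moreover have "bounded (range (\<lambda>m. \<phi> (of_discrete m) (h X)))"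
      using \<phi>(3) by (intro boundedI[of _ "p (h X)"]) auto
    ultimately show ?thesis unfolding T_def by (subst Bcontfun_inverse) (auto simp: bcontfun_def)
  qed
  have "T (X + Y) = T X + T Y" if "X \<in> carrier_mat n n" "Y \<in> carrier_mat n n" for X Y
  proof -
    have "h (X + Y) = h X + h Y" using that by (auto simp: h_def fun_eq_iff)
    then show ?thesis by (intro bcontfun_eqI) (simp add: T \<phi>(1) plus_bcontfun.rep_eq)
  qed
  moreover have "T (map_mat (smul (of_real c)) X) = c *\<^sub>R T X" if "X \<in> carrier_mat n n" for c X
  proof -
    have "h (map_mat (smul (of_real c)) X) = sc c (h X)" using that by (auto simp: h_def sc_def fun_eq_iff)
    then show ?thesis by (intro bcontfun_eqI) (simp add: T \<phi>(2) scaleR_bcontfun.rep_eq)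
  qed
  moreover have "norm (T X) = nrm n X" if X: "X \<in> carrier_mat n n" for X
  proof (rule antisym)
    show "norm (T X) \<le> nrm n X" using \<phi>(3)[of _ "h X"] ph[OF X] by (intro norm_bound) (simp add: T)
    \<comment> \<open>The supremum is attained at the index X itself.\<close>
    have "nrm n X = norm (apply_bcontfun (T X) (discrete X))"
      using \<phi>(4)[of X] ph[OF X] nrm_nonneg[OF n X] by (simp add: T discrete_inverse)
    also have "\<dots> \<le> norm (T X)" by (rule norm_bounded)
    finally show "nrm n X \<le> norm (T X)" .
  qed
  ultimately have "norm_embedding n T" by (simp add: norm_embedding_def)
  then show thesis by (rule that)
qed

lemma norm_embedding_carrier_minus:
  assumes "norm_embedding n T" and X: "X \<in> carrier_mat n n" and Y: "Y \<in> carrier_mat n n"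
  shows "T (X - Y) = T X - T Y"
proof -
  have "T X = T ((X - Y) + Y)"
    using X Y by (intro arg_cong[where f = T] eq_matI) auto
  also have "\<dots> = T (X - Y) + T Y" using assms by (simp add: norm_embedding_def minus_carrier_mat)
  finally show ?thesis by simp
qed

lemma mat_dist_embedding:
  assumes "norm_embedding n T" and "X \<in> carrier_mat n n" "Y \<in> carrier_mat n n"
  shows "mat_dist nrm n X Y = dist (T X) (T Y)"
proof -
  have "norm (T (X - Y)) = nrm n (X - Y)"
    using assms by (simp add: norm_embedding_def minus_carrier_mat)
  then show ?thesis using assms by (simp add: norm_embedding_carrier_minus mat_dist_def dist_norm)
qed

lemma norm_embedding_inj:
  assumes n: "n \<ge> 1" and "norm_embedding n T"
  shows "inj_on T (carrier_mat n n)"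
proof (rule inj_onI)
  interpret Metric_space "carrier_mat n n" "mat_dist nrm n" by (rule Metric_space_mat_dist[OF n])
  fix X Y assume XY: "X \<in> carrier_mat n n" "Y \<in> carrier_mat n n" "T X = T Y"
  then have "mat_dist nrm n X Y = 0" by (simp add: mat_dist_embedding[OF assms(2)])
  then show "X = Y" using XY by simp
qed

lemma topspace_mat_top: "n \<ge> 1 \<Longrightarrow> topspace (mat_top nrm n) = carrier_mat n n"
  unfolding mat_top_def by (rule Metric_space.topspace_mtopology[OF Metric_space_mat_dist])

lemma limitin_mat_top_embedding:
  assumes n: "n \<ge> 1" and T: "norm_embedding n T"
  shows "limitin (mat_top nrm n) f l F \<longleftrightarrow>
     l \<in> carrier_mat n n \<and> (\<forall>\<^sub>F x in F. f x \<in> carrier_mat n n) \<and> ((\<lambda>x. T (f x)) \<longlongrightarrow> T l) F"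
proof -
  interpret Metric_space "carrier_mat n n" "mat_dist nrm n" by (rule Metric_space_mat_dist[OF n])
  have "((\<lambda>x. mat_dist nrm n (f x) l) \<longlongrightarrow> 0) F \<longleftrightarrow> ((\<lambda>x. T (f x)) \<longlongrightarrow> T l) F"
    if "l \<in> carrier_mat n n" "\<forall>\<^sub>F x in F. f x \<in> carrier_mat n n"
  proof -
    have "((\<lambda>x. mat_dist nrm n (f x) l) \<longlongrightarrow> 0) F \<longleftrightarrow> ((\<lambda>x. dist (T (f x)) (T l)) \<longlongrightarrow> 0) F"
      using that by (intro tendsto_cong) (auto elim!: eventually_mono simp: mat_dist_embedding[OF T])
    then show ?thesis by (subst tendsto_dist_iff)
  qed
  then show ?thesis unfolding mat_top_def limitin_metric_dist_null by blast
qed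

lemma continuous_map_mat_top_embedding:
  fixes T :: "'v mat \<Rightarrow> 'b::real_normed_vector"
  assumes n: "n \<ge> 1" and T: "norm_embedding n T"
  shows "continuous_map Z (mat_top nrm n) f \<longleftrightarrow>
     f \<in> topspace Z \<rightarrow> carrier_mat n n \<and> continuous_map Z euclidean (\<lambda>z. T (f z))"
    (is "?L \<longleftrightarrow> ?R")
proof
  interpret Metric_space "carrier_mat n n" "mat_dist nrm n" by (rule Metric_space_mat_dist[OF n])
  have "continuous_map (mat_top nrm n) euclidean T"
    unfolding continuous_map_def
  proof (intro conjI allI impI)
    fix U :: "'b set" assume "openin euclidean U"
    then have U: "open U" by simp
    show "openin (mat_top nrm n) {X \<in> topspace (mat_top nrm n). T X \<in> U}"
      unfolding topspace_mat_top[OF n] unfolding mat_top_def openin_mtopology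
    proof (intro conjI allI impI)
      fix X assume X: "X \<in> {X \<in> carrier_mat n n. T X \<in> U}"
      then obtain r where r: "r > 0" "ball (T X) r \<subseteq> U" using U open_contains_ball by blast
      have "mball X r \<subseteq> {X \<in> carrier_mat n n. T X \<in> U}"
        using r by (auto simp: mat_dist_embedding[OF T] subset_iff)
      then show "\<exists>r>0. mball X r \<subseteq> {X \<in> carrier_mat n n. T X \<in> U}" using r by blast
    qed auto
  qed auto
  moreover assume ?L
  ultimately have "continuous_map Z euclidean (T \<circ> f)" by (rule continuous_map_compose[rotated])
  moreover have "f \<in> topspace Z \<rightarrow> carrier_mat n n"
    using \<open>?L\<close> topspace_mat_top[OF n] unfolding continuous_map_def by auto
  ultimately show ?R by (simp add: o_def)
next
  interpret Metric_space "carrier_mat n n" "mat_dist nrm n" by (rule Metric_space_mat_dist[OF n])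
  assume R: ?R
  show ?L unfolding mat_top_def continuous_map_to_metric
  proof (intro ballI allI impI)
    fix x and e :: real assume x: "x \<in> topspace Z" and e: "e > 0"
    let ?U = "{y \<in> topspace Z. T (f y) \<in> ball (T (f x)) e}"
    have "openin Z ?U" using R by (intro openin_continuous_map_preimage[where Y = euclidean]) auto
    moreover have "f y \<in> mball (f x) e" if "y \<in> ?U" for y
      using R that x by (auto simp: in_mball mat_dist_embedding[OF T] Pi_iff)
    ultimately show "\<exists>U. openin Z U \<and> x \<in> U \<and> (\<forall>y\<in>U. f y \<in> mball (f x) e)"
      using x e by (intro exI[of _ ?U]) auto
  qed
qed

text \<open>A convergent sequence of images pulls back to a Cauchy sequence of matrices, because T
  preserves distances. Completeness of the level provides its limit, and closedness keeps the limit
  in L.\<close>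

lemma closed_embedding_image:
  assumes n: "n \<ge> 1" and T: "norm_embedding n T" and L: "closedin (mat_top nrm n) L"
  shows "closed (T ` L)"
  unfolding closed_sequential_limits
proof (intro allI impI, elim conjE)
  interpret Metric_space "carrier_mat n n" "mat_dist nrm n" by (rule Metric_space_mat_dist[OF n])
  fix y l assume y: "\<forall>k. y k \<in> T ` L" "y \<longlonglongrightarrow> l"
  define X where "X k = inv_into L T (y k)" for k
  have X: "X k \<in> L" "y k = T (X k)" for k
    using y(1) by (simp_all add: X_def inv_into_into f_inv_into_f)
  have L_sub: "L \<subseteq> carrier_mat n n" using closedin_subset[OF L] topspace_mat_top[OF n] by simp
  then have Xc: "X k \<in> carrier_mat n n" for k using X by blast
  have "MCauchy X"
    unfolding MCauchy_def
  proof (intro conjI allI impI)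
    fix e :: real assume "e > 0"
    then obtain N where "\<And>k k'. N \<le> k \<Longrightarrow> N \<le> k' \<Longrightarrow> dist (y k) (y k') < e"
      using LIMSEQ_imp_Cauchy[OF y(2)] unfolding Cauchy_def by blast
    then show "\<exists>N. \<forall>k k'. N \<le> k \<longrightarrow> N \<le> k' \<longrightarrow> mat_dist nrm n (X k) (X k') < e"
      unfolding mat_dist_embedding[OF T Xc Xc] X(2)[symmetric] by blast
  qed (use Xc in auto)
  then obtain x where x: "limitin (mat_top nrm n) X x sequentially"
    using nrm_complete[OF n] unfolding mcomplete_def mat_top_def by blast
  then have "x \<in> L" using X(1) by (intro limitin_closedin[OF x L]) auto
  moreover have "y \<longlonglongrightarrow> T x"
    using x unfolding limitin_mat_top_embedding[OF n T] by (simp add: X(2)[symmetric])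
  then have "l = T x" using y(2) LIMSEQ_unique by blast
  ultimately show "l \<in> T ` L" by blast
qed

lemma subspace_embedding_image:
  assumes n: "n \<ge> 1" and T: "norm_embedding n T" and L: "closed_mat_subspace smul nrm n L"
  shows "real_vector.subspace (T ` L)"
proof -
  have L': "X \<in> L \<Longrightarrow> X \<in> carrier_mat n n" for X using L by (auto simp: closed_mat_subspace_def)
  show ?thesis unfolding real_vector.subspace_def
  proof (intro conjI ballI allI)
    have "norm (T (0\<^sub>m n n)) = 0" using T nrm_eq_0[OF n, of "0\<^sub>m n n"] by (simp add: norm_embedding_def)
    then show "0 \<in> T ` L" using L by (force simp: closed_mat_subspace_def)
  next
    fix x y assume "x \<in> T ` L" "y \<in> T ` L"
    then obtain X Y where "X \<in> L" "Y \<in> L" "x = T X" "y = T Y" by blast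
    then show "x + y \<in> T ` L" using T L L' unfolding norm_embedding_def closed_mat_subspace_def
      by (metis imageI)
  next
    fix c x assume "x \<in> T ` L"
    then obtain X where "X \<in> L" "x = T X" by blast
    then show "c *\<^sub>R x \<in> T ` L" using T L L' unfolding norm_embedding_def closed_mat_subspace_def
      by (metis imageI)
  qed
qed

text \<open>By real linearity T commutes with difference quotients, and it preserves and reflects
  their limits.\<close>

lemma has_mat_deriv_embedding:
  assumes n: "n \<ge> 1" and T: "norm_embedding n T"
    and Y: "\<And>s. s \<in> I \<Longrightarrow> Y s \<in> carrier_mat n n" and t: "t \<in> I"
  shows "has_mat_deriv smul nrm n I Y D t \<longleftrightarrow>
     D \<in> carrier_mat n n \<and> ((\<lambda>s. T (Y s)) has_vector_derivative T D) (at t within I)"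
proof -
  let ?q = "\<lambda>s. map_mat (smul (of_real (1 / (s - t)))) (Y s - Y t)"
  have q: "?q s \<in> carrier_mat n n" for s
    using minus_carrier_mat[OF Y[OF t]] by simp
  have Tq: "T (?q s) = (1 / (s - t)) *\<^sub>R (T (Y s) - T (Y t))" if "s \<in> I" for s
  proof -
    have "T (?q s) = (1 / (s - t)) *\<^sub>R T (Y s - Y t)"
      using T minus_carrier_mat[OF Y[OF t]] unfolding norm_embedding_def by blast
    then show ?thesis using norm_embedding_carrier_minus[OF T Y[OF that] Y[OF t]] by simp
  qed
  have "((\<lambda>s. T (?q s)) \<longlongrightarrow> T D) (at t within I) \<longleftrightarrow>
      ((\<lambda>s. (1 / (s - t)) *\<^sub>R (T (Y s) - T (Y t))) \<longlongrightarrow> T D) (at t within I)"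
    using Tq by (intro tendsto_cong) (auto simp: eventually_at_filter)
  then show ?thesis
    unfolding has_mat_deriv_def limitin_mat_top_embedding[OF n T] has_vector_derivative_iff_quotient
    using q by simp
qed

text \<open>The velocities are compared along the two curves only, not on a whole set. This weaker
  form covers the extended map, for which one of the curves is always the distinguished one.\<close>

lemma mat_ode_unique:
  assumes n: "n \<ge> 1" and I: "is_interval I" "t0 \<in> I" "t \<in> I"
    and Y: "\<And>s. s \<in> I \<Longrightarrow> Y s \<in> carrier_mat n n" "\<And>s. s \<in> I \<Longrightarrow> has_mat_deriv smul nrm n I Y (Y' s) s"
    and Z: "\<And>s. s \<in> I \<Longrightarrow> Z s \<in> carrier_mat n n" "\<And>s. s \<in> I \<Longrightarrow> has_mat_deriv smul nrm n I Z (Z' s) s"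
    and le: "\<And>s. s \<in> I \<Longrightarrow> nrm n (Y' s - Z' s) \<le> C * nrm n (Y s - Z s)" and C: "C \<ge> 0"
    and eq: "Y t0 = Z t0"
  shows "Y t = Z t"
proof -
  obtain T :: "'v mat \<Rightarrow> ('v mat discrete \<Rightarrow>\<^sub>C real)" where T: "norm_embedding n T"
    by (rule norm_embedding_exists[OF n])
  note Yd = has_mat_deriv_embedding[OF n T Y(1), THEN iffD1, OF _ _ Y(2)]
  note Zd = has_mat_deriv_embedding[OF n T Z(1), THEN iffD1, OF _ _ Z(2)]
  have norm_eq: "norm (T A - T B) = nrm n (A - B)" if "A \<in> carrier_mat n n" "B \<in> carrier_mat n n" for A B
    using that T norm_embedding_carrier_minus[OF T that] unfolding norm_embedding_def
    by (metis minus_carrier_mat)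
  have "T (Y t) - T (Z t) = 0"
  proof (rule gronwall_zero[OF I, where z = "\<lambda>s. T (Y s) - T (Z s)" and z' = "\<lambda>s. T (Y' s) - T (Z' s)"])
    fix s assume s: "s \<in> I"
    show "((\<lambda>s. T (Y s) - T (Z s)) has_vector_derivative T (Y' s) - T (Z' s)) (at s within I)"
      using Yd Zd s by (intro has_vector_derivative_diff) auto
    show "norm (T (Y' s) - T (Z' s)) \<le> C * norm (T (Y s) - T (Z s))"
      using Yd[of s] Zd[of s] s le[OF s] Y(1)[OF s] Z(1)[OF s] by (simp add: norm_eq)
  qed (use eq C in auto)
  then show ?thesis using norm_embedding_inj[OF n T] Y(1)[OF I(3)] Z(1)[OF I(3)]
    by (auto dest: inj_onD)
qed

text \<open>\<open>T\<close> sends L onto a closed subspace of a Banach space. The equation is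
  conjugated to that subspace by T and its inverse S, solved there and carried back.\<close>

lemma mat_ode_exists:
  assumes n: "n \<ge> 1" and I: "is_interval I" "t0 \<in> I"
    and L: "closed_mat_subspace smul nrm n L" and A: "A \<in> L"
    and f: "\<And>t X. t \<in> I \<Longrightarrow> X \<in> L \<Longrightarrow> f t X \<in> L"
    and cont: "continuous_map (prod_topology (top_of_set I) (subtopology (mat_top nrm n) L))
       (subtopology (mat_top nrm n) L) (\<lambda>(t, X). f t X)"
    and lip: "\<And>t X Y. t \<in> I \<Longrightarrow> X \<in> L \<Longrightarrow> Y \<in> L \<Longrightarrow> nrm n (f t X - f t Y) \<le> C * nrm n (X - Y)"
    and C: "C \<ge> 0"
  obtains Y where "ivp_solution smul nrm n I (\<lambda>_. L) f t0 A Y"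
proof -
  obtain T :: "'v mat \<Rightarrow> ('v mat discrete \<Rightarrow>\<^sub>C real)" where T: "norm_embedding n T"
    by (rule norm_embedding_exists[OF n])
  have L_carrier: "L \<subseteq> carrier_mat n n" and L_closed: "closedin (mat_top nrm n) L"
    using L by (auto simp: closed_mat_subspace_def)
  have inj: "inj_on T L" using norm_embedding_inj[OF n T] L_carrier inj_on_subset by blast
  define S where "S = inv_into L T"
  have ST: "S (T X) = X" if "X \<in> L" for X using inj that by (simp add: S_def)
  have TS: "T (S y) = y" "S y \<in> L" if "y \<in> T ` L" for y
    using that by (auto simp: S_def f_inv_into_f inv_into_into)
  have norm_eq: "norm (T A - T B) = nrm n (A - B)" if "A \<in> L" "B \<in> L" for A B
    using that L_carrier T norm_embedding_carrier_minus[OF T, of A B] unfolding norm_embedding_def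
    by (metis minus_carrier_mat subsetD)
  have S_cont: "continuous_map (top_of_set (T ` L)) (subtopology (mat_top nrm n) L) S"
    unfolding continuous_map_in_subtopology continuous_map_mat_top_embedding[OF n T]
    using TS L_carrier by (auto simp: continuous_map_iff_continuous intro: continuous_on_eq[OF continuous_on_id])
  have "continuous_map (prod_topology (top_of_set I) (top_of_set (T ` L)))
      (prod_topology (top_of_set I) (subtopology (mat_top nrm n) L)) (\<lambda>(t, y). (t, S y))"
    unfolding continuous_map_prod_top using S_cont by auto
  then have "continuous_map (prod_topology (top_of_set I) (top_of_set (T ` L)))
      (subtopology (mat_top nrm n) L) ((\<lambda>(t, X). f t X) \<circ> (\<lambda>(t, y). (t, S y)))"
    using cont by (rule continuous_map_compose)
  then have "continuous_map (top_of_set (I \<times> T ` L)) euclidean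
      (\<lambda>z. T (((\<lambda>(t, X). f t X) \<circ> (\<lambda>(t, y). (t, S y))) z))"
    unfolding continuous_map_in_subtopology continuous_map_mat_top_embedding[OF n T]
      prod_topology_subtopology_eu by blast
  then have "continuous_on (I \<times> T ` L) (\<lambda>(t, y). T (f t (S y)))"
    by (simp add: continuous_map_iff_continuous case_prod_beta' o_def)
  then obtain x where x: "x t0 = T A" "\<And>t. t \<in> I \<Longrightarrow> x t \<in> T ` L"
    "\<And>t. t \<in> I \<Longrightarrow> (x has_vector_derivative T (f t (S (x t)))) (at t within I)"
  proof (rule picard_lindeloef_closed_subspace[OF I subspace_embedding_image[OF n T L]
      closed_embedding_image[OF n T L_closed]])
    show "t \<in> I \<Longrightarrow> y \<in> T ` L \<Longrightarrow> T (f t (S y)) \<in> T ` L" for t y using f TS by blast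
    show "norm (T (f t (S y)) - T (f t (S z))) \<le> C * norm (y - z)"
      if "t \<in> I" "y \<in> T ` L" "z \<in> T ` L" for t y z
    proof -
      have "nrm n (S y - S z) = norm (y - z)"
        using norm_eq[OF TS(2)[OF that(2)] TS(2)[OF that(3)]] TS(1) that by simp
      then show ?thesis
        using lip[OF that(1) TS(2)[OF that(2)] TS(2)[OF that(3)]] f that(1) TS(2) that(2,3)
        by (simp add: norm_eq)
    qed
  qed (use A C in auto)
  have "ivp_solution smul nrm n I (\<lambda>_. L) f t0 A (\<lambda>t. S (x t))"
    unfolding ivp_solution_def
  proof (intro conjI ballI)
    fix t assume t: "t \<in> I"
    show "S (x t) \<in> L" using t x TS by blast
    show "has_mat_deriv smul nrm n I (\<lambda>t. S (x t)) (f t (S (x t))) t"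
    proof (subst has_mat_deriv_embedding[OF n T _ t])
      have "((\<lambda>s. T (S (x s))) has_vector_derivative T (f t (S (x t)))) (at t within I)"
        using TS x t by (intro has_vector_derivative_transform[OF t _ x(3)[OF t]]) auto
      then show "f t (S (x t)) \<in> carrier_mat n n \<and>
          ((\<lambda>s. T (S (x s))) has_vector_derivative T (f t (S (x t)))) (at t within I)"
        using f t x TS L_carrier by blast
    qed (use x TS L_carrier in blast)
  qed (use x(1) ST A in simp)
  then show thesis by (rule that)
qed

end

section \<open>Direct sums and copies\<close>

lemma dsum_carrier:
  "X \<in> carrier_mat n n \<Longrightarrow> Y \<in> carrier_mat m m \<Longrightarrow> dsum X Y \<in> carrier_mat (n + m) (n + m)"
  by (simp add: dsum_def)

lemma dsum_index:
  assumes "X \<in> carrier_mat n n" "Y \<in> carrier_mat m m" "i < n + m" "j < n + m"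
  shows "dsum X Y $$ (i, j) =
    (if i < n then (if j < n then X $$ (i, j) else 0) else (if j < n then 0 else Y $$ (i - n, j - n)))"
  using assms by (auto simp: dsum_def)

lemma copies_Suc: "copies (Suc k) X = dsum X (copies k X)"
  by (simp add: copies_def dsum_def Let_def)

lemma copies_carrier: "X \<in> carrier_mat d d \<Longrightarrow> copies k X \<in> carrier_mat (k * d) (k * d)"
proof (induction k)
  case (Suc k)
  then show ?case using dsum_carrier[of X d "copies k X" "k * d"] by (simp add: copies_Suc)
qed (simp add: copies_def)

lemma copies_index:
  assumes X: "X \<in> carrier_mat d d" and "i < k * d" "j < k * d"
  shows "copies k X $$ (i, j) = (if i div d = j div d then X $$ (i mod d, j mod d) else 0)"
  using assms(2,3)
proof (induction k arbitrary: i j)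
  case (Suc k)
  then have d: "d > 0" by (cases d) auto
  have "copies (Suc k) X $$ (i, j) = (if i < d then (if j < d then X $$ (i, j) else 0)
      else (if j < d then 0 else copies k X $$ (i - d, j - d)))"
    unfolding copies_Suc using Suc.prems by (intro dsum_index[OF X copies_carrier[OF X]]) auto
  also have "\<dots> = (if i div d = j div d then X $$ (i mod d, j mod d) else 0)"
  proof (cases "i < d \<or> j < d")
    case True
    then show ?thesis using d by (auto simp: div_eq_0_iff eq_commute[of 0])
  next
    case False
    then have "copies k X $$ (i - d, j - d) =
        (if (i - d) div d = (j - d) div d then X $$ ((i - d) mod d, (j - d) mod d) else 0)"
      using Suc.prems by (intro Suc.IH) auto
    then show ?thesis using False d by (simp add: le_div_geq le_mod_geq)
  qed
  finally show ?case .
qed simp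

text \<open>The gcd need not belong to S, but it is the least positive difference c of two members:
  remainders modulo c of members are again differences, so by minimality c divides every
  member.\<close>

lemma semigroup_Gcd_difference:
  fixes S :: "nat set"
  assumes add: "\<And>n m. n \<in> S \<Longrightarrow> m \<in> S \<Longrightarrow> n + m \<in> S" and e: "e \<in> S" "e > 0"
  obtains a where "a \<in> S" "a + Gcd S \<in> S"
proof -
  have mult: "k * n \<in> S" if "n \<in> S" "k \<ge> 1" for k n
    using that(2) by (induction k rule: nat_induct_at_least) (use that add in \<open>auto simp: add.commute\<close>)
  define P where "P z \<longleftrightarrow> z > 0 \<and> (\<exists>a\<in>S. a + z \<in> S)" for z
  define c where "c = (LEAST z. P z)"
  have "P e" using e add by (auto simp: P_def)
  then have c: "P c" unfolding c_def by (rule LeastI)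
  have least: "\<not> P z" if "z < c" for z using that unfolding c_def by (rule not_less_Least)
  obtain a where a: "a \<in> S" "a + c \<in> S" using c by (auto simp: P_def)
  have "c dvd n" if n: "n \<in> S" for n
  proof (rule ccontr)
    assume "\<not> c dvd n"
    then have r: "n mod c > 0" "n mod c < c" using c by (auto simp: P_def dvd_eq_mod_eq_0)
    have "P (n mod c)"
    proof (cases "n div c = 0")
      case True
      then have "n mod c = n" using c by (auto simp: div_eq_0_iff P_def)
      then show ?thesis using r add[OF n n] n by (auto simp: P_def)
    next
      case False
      let ?q = "n div c"
      \<comment> \<open>Both numbers are members of S, and their difference is exactly
        \<open>n mod c\<close>.\<close>
      have "?q * (a + c) \<in> S" "?q * a + n \<in> S" using False a n by (auto intro!: mult add)
      moreover have "?q * (a + c) + n mod c = ?q * a + n"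
        using div_mult_mod_eq[of n c] by (simp add: algebra_simps)
      ultimately show ?thesis using r by (auto simp: P_def intro!: bexI[of _ "?q * (a + c)"])
    qed
    then show False using least r by blast
  qed
  then have "c dvd Gcd S" by (intro Gcd_greatest) auto
  moreover have "Gcd S dvd c" using a by (metis Gcd_dvd dvd_add_right_iff)
  ultimately have "Gcd S = c" by (simp add: dvd_antisym)
  then show thesis using a that by blast
qed

text \<open>
  The members of the family are the corners of one infinite matrix \<open>B\<close>, which is invariant under the
  diagonal shift by every element of \<open>S\<close>, hence by \<open>Gcd S\<close>.
\<close>

lemma direct_sum_family_copies:
  fixes A :: "nat \<Rightarrow> 'v::zero mat"
  assumes add: "\<And>n m. n \<in> S \<Longrightarrow> m \<in> S \<Longrightarrow> n + m \<in> S" and S: "S \<noteq> {}" "0 \<notin> S"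
    and A: "\<And>n. n \<in> S \<Longrightarrow> A n \<in> carrier_mat n n"
    and A_add: "\<And>n m. n \<in> S \<Longrightarrow> m \<in> S \<Longrightarrow> A (n + m) = dsum (A n) (A m)"
  obtains X where "X \<in> carrier_mat (Gcd S) (Gcd S)" "\<And>n. n \<in> S \<Longrightarrow> A n = copies (n div Gcd S) X"
proof -
  define d where "d = Gcd S"
  obtain e where e: "e \<in> S" "e > 0" using S by (metis all_not_in_conv gr0I)
  have mult: "k * n \<in> S" if "n \<in> S" "k \<ge> 1" for k n
    using that(2) by (induction k rule: nat_induct_at_least) (use that add in \<open>auto simp: add.commute\<close>)
  have d: "d > 0" using e Gcd_dvd[OF e(1)] by (metis d_def dvd_0_left gr0I less_irrefl)
  define M where "M i = (i + 1) * e" for i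
  have M: "M i \<in> S" "i < M i" for i
  proof -
    show "M i \<in> S" unfolding M_def by (rule mult[OF e(1)]) simp
    have "(i + 1) * 1 \<le> (i + 1) * e" using e(2) by (intro mult_le_mono2) simp
    then show "i < M i" by (simp add: M_def)
  qed
  \<comment> \<open>\<open>M (i + j)\<close> is merely a size in S that exceeds both
    indices.\<close>
  define B where "B i j = A (M (i + j)) $$ (i, j)" for i j
  have M2: "i < M (i + j)" "j < M (i + j)" for i j using M(2)[of "i + j"] by auto
  \<comment> \<open>\<open>A (n + M (i + j))\<close> can be split in either order, so both
    \<open>A n\<close> and \<open>A (M (i + j))\<close> are its upper left corner.\<close>
  have B: "A n $$ (i, j) = B i j" if n: "n \<in> S" "i < n" "j < n" for n i j
  proof -
    have "A (n + M (i + j)) $$ (i, j) = A n $$ (i, j)"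
      unfolding A_add[OF n(1) M(1)]
      using n M2[where i = i and j = j] by (subst dsum_index[OF A[OF n(1)] A[OF M(1)]]) auto
    moreover have "A (M (i + j) + n) $$ (i, j) = A (M (i + j)) $$ (i, j)"
      unfolding A_add[OF M(1) n(1)]
      using n M2[where i = i and j = j] by (subst dsum_index[OF A[OF M(1)] A[OF n(1)]]) auto
    ultimately show ?thesis by (simp add: B_def add.commute)
  qed
  have shift: "B (i + n) (j + n) = B i j" if n: "n \<in> S" for n i j
  proof -
    have "B (i + n) (j + n) = A (n + M (i + j)) $$ (i + n, j + n)"
      using n M(1) M2[where i = i and j = j] add by (intro B[symmetric]) (auto simp: add.commute)
    also have "\<dots> = B i j"
      unfolding A_add[OF n M(1)] B_def
      using M2[where i = i and j = j] by (subst dsum_index[OF A[OF n] A[OF M(1)]]) (auto simp: add.commute)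
    finally show ?thesis .
  qed
  have off: "B i j = 0 \<and> B j i = 0" if n: "n \<in> S" and ij: "i < n" "n \<le> j" for n i j
  proof -
    have "A (n + M j) $$ (i, j) = B i j" "A (n + M j) $$ (j, i) = B j i"
      using n M[of j] ij add by (auto intro!: B)
    moreover have "A (n + M j) $$ (i, j) = 0" "A (n + M j) $$ (j, i) = 0"
      unfolding A_add[OF n M(1)]
      using M(2)[of j] ij by (subst dsum_index[OF A[OF n] A[OF M(1)]]; auto)+
    ultimately show ?thesis by simp
  qed
  \<comment> \<open>Invariance under the shifts by a and by \<open>a + d\<close> yields invariance
    under their difference d, although d itself may lie outside S.\<close>
  obtain a where a: "a \<in> S" "a + d \<in> S"
    using semigroup_Gcd_difference[OF add e] unfolding d_def by blast
  have "B (i + d) (j + d) = B i j" for i j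
    using shift[OF a(1), of "i + d" "j + d"] shift[OF a(2), of i j] by (simp add: algebra_simps)
  then have shift_d: "B (i + k * d) (j + k * d) = B i j" for i j k
  proof (induction k)
    case (Suc k)
    have "B (i + Suc k * d) (j + Suc k * d) = B (i + k * d + d) (j + k * d + d)" by (simp add: ac_simps)
    then show ?case using Suc \<open>\<And>i j. B (i + d) (j + d) = B i j\<close> by simp
  qed simp
  have B_diag: "B i j = B (i mod d) (j mod d)" if "i div d = j div d" for i j
    using shift_d[of "i mod d" "j div d" "j mod d"] mod_div_mult_eq[of i d] mod_div_mult_eq[of j d] that
    by metis
  have off_d: "B i j = 0 \<and> B j i = 0" if "i div d < j div d" for i j
  proof -
    \<comment> \<open>The block boundary \<open>l * d\<close> separates i from j, but it need not be
      a member of S. Shifting both indices by a multiple of d moves it to \<open>l * e\<close>,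
      which is one, and \<open>off\<close> applies there.\<close>
    define l where "l = j div d"
    have l: "i < l * d" "l * d \<le> j"
      using that d by (auto simp: l_def div_less_iff_less_mult)
    have l1: "l \<ge> 1" using that by (simp add: l_def)
    obtain q where q: "e = q * d" using Gcd_dvd[OF e(1)] by (metis d_def dvd_def mult.commute)
    then have "q \<ge> 1" using e(2) by (cases q) auto
    then have n: "l * e = (l * q - l) * d + l * d"
      by (simp add: q mult.assoc flip: add_mult_distrib)
    have "B (i + (l * q - l) * d) (j + (l * q - l) * d) = 0 \<and>
        B (j + (l * q - l) * d) (i + (l * q - l) * d) = 0"
      using l l1 by (intro off[of "l * e"] mult e) (simp_all add: n)
    then show ?thesis by (simp add: shift_d)
  qed
  define X where "X = mat d d (\<lambda>(i, j). B i j)"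
  have X: "X \<in> carrier_mat d d" by (simp add: X_def)
  moreover have "A n = copies (n div d) X" if n: "n \<in> S" for n
  proof (rule eq_matI)
    have nd: "n div d * d = n" using Gcd_dvd[OF n] by (simp add: d_def)
    have car: "copies (n div d) X \<in> carrier_mat n n" using copies_carrier[OF X, of "n div d"] nd by simp
    then show "dim_row (A n) = dim_row (copies (n div d) X)" "dim_col (A n) = dim_col (copies (n div d) X)"
      using A[OF n] by auto
    fix i j assume "i < dim_row (copies (n div d) X)" "j < dim_col (copies (n div d) X)"
    then have ij: "i < n" "j < n" using car by auto
    have "copies (n div d) X $$ (i, j) = (if i div d = j div d then B (i mod d) (j mod d) else 0)"
      using ij nd d by (subst copies_index[OF X]) (auto simp: X_def)
    also have "\<dots> = B i j"
      using B_diag[of i j] off_d[of i j] off_d[of j i] by (cases "i div d" "j div d" rule: linorder_cases) auto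
    finally show "A n $$ (i, j) = copies (n div d) X $$ (i, j)" using B[OF n ij] by simp
  qed
  ultimately show thesis using that unfolding d_def by blast
qed

section \<open>Linear isometries between matrix levels\<close>

context operator_space
begin

text \<open>Additivity is recorded for differences, the form in which it enters both the metric and
  the difference quotients. The maps in view are \<open>copies k\<close> and
  \<open>amp n K \<rho>\<close>.\<close>

definition mat_isometry :: "nat \<Rightarrow> nat \<Rightarrow> ('v mat \<Rightarrow> 'v mat) \<Rightarrow> bool" where
  "mat_isometry m n \<psi> \<longleftrightarrow>
     (\<forall>X\<in>carrier_mat m m. \<psi> X \<in> carrier_mat n n \<and> nrm n (\<psi> X) = nrm m X) \<and>
     (\<forall>X\<in>carrier_mat m m. \<forall>Y\<in>carrier_mat m m. \<psi> (X - Y) = \<psi> X - \<psi> Y) \<and>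
     (\<forall>c. \<forall>X\<in>carrier_mat m m. \<psi> (map_mat (smul c) X) = map_mat (smul c) (\<psi> X))"

lemma mat_dist_isometry:
  assumes "mat_isometry m n \<psi>" "X \<in> carrier_mat m m" "Y \<in> carrier_mat m m"
  shows "mat_dist nrm n (\<psi> X) (\<psi> Y) = mat_dist nrm m X Y"
  using assms unfolding mat_isometry_def mat_dist_def by (metis minus_carrier_mat)

text \<open>The equivalence is used both ways: backwards to differentiate the block when only its
  copies are known to be differentiable, forwards to differentiate copies at all multiples of
  \<open>d\<close>.\<close>

lemma has_mat_deriv_isometry:
  assumes "m \<ge> 1" "n \<ge> 1" and \<psi>: "mat_isometry m n \<psi>"
    and Y: "\<And>s. s \<in> I \<Longrightarrow> Y s \<in> carrier_mat m m" and D: "D \<in> carrier_mat m m" and t: "t \<in> I"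
  shows "has_mat_deriv smul nrm n I (\<lambda>s. \<psi> (Y s)) (\<psi> D) t \<longleftrightarrow> has_mat_deriv smul nrm m I Y D t"
proof -
  interpret M: Metric_space "carrier_mat m m" "mat_dist nrm m" by (rule Metric_space_mat_dist) fact
  interpret N: Metric_space "carrier_mat n n" "mat_dist nrm n" by (rule Metric_space_mat_dist) fact
  let ?q = "\<lambda>Y s. map_mat (smul (of_real (1 / (s - t)))) (Y s - Y t)"
  have \<psi>c: "\<psi> X \<in> carrier_mat n n" if "X \<in> carrier_mat m m" for X using \<psi> that by (simp add: mat_isometry_def)
  have q: "?q Y s \<in> carrier_mat m m" "?q (\<lambda>s. \<psi> (Y s)) s \<in> carrier_mat n n" for s
    using minus_carrier_mat[OF Y[OF t]] minus_carrier_mat[OF \<psi>c[OF Y[OF t]]] by simp_all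
  have \<psi>q: "?q (\<lambda>s. \<psi> (Y s)) s = \<psi> (?q Y s)" if "s \<in> I" for s
    using \<psi> Y[OF t] Y[OF that] unfolding mat_isometry_def by (metis minus_carrier_mat)
  have "mat_dist nrm n (?q (\<lambda>s. \<psi> (Y s)) s) (\<psi> D) = mat_dist nrm m (?q Y s) D" if "s \<in> I" for s
    unfolding \<psi>q[OF that] by (rule mat_dist_isometry[OF \<psi> q(1) D])
  then have "((\<lambda>s. mat_dist nrm n (?q (\<lambda>s. \<psi> (Y s)) s) (\<psi> D)) \<longlongrightarrow> 0) (at t within I) \<longleftrightarrow>
      ((\<lambda>s. mat_dist nrm m (?q Y s) D) \<longlongrightarrow> 0) (at t within I)"
    by (intro tendsto_cong) (auto simp: eventually_at_filter)
  then show ?thesis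
    unfolding has_mat_deriv_def mat_top_def M.limitin_metric_dist_null N.limitin_metric_dist_null
    using q D \<psi>c[OF D] by simp
qed

lemma continuous_map_isometry:
  assumes "m \<ge> 1" "n \<ge> 1" and \<psi>: "mat_isometry m n \<psi>" and f: "f \<in> topspace Z \<rightarrow> carrier_mat m m"
  shows "continuous_map Z (mat_top nrm n) (\<lambda>z. \<psi> (f z)) \<longleftrightarrow> continuous_map Z (mat_top nrm m) f"
proof -
  interpret M: Metric_space "carrier_mat m m" "mat_dist nrm m" by (rule Metric_space_mat_dist) fact
  interpret N: Metric_space "carrier_mat n n" "mat_dist nrm n" by (rule Metric_space_mat_dist) fact
  have \<psi>c: "\<psi> X \<in> carrier_mat n n" if "X \<in> carrier_mat m m" for X using \<psi> that by (simp add: mat_isometry_def)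
  have "\<psi> (f y) \<in> N.mball (\<psi> (f x)) e \<longleftrightarrow> f y \<in> M.mball (f x) e"
    if "x \<in> topspace Z" "y \<in> topspace Z" for x y e
    using f that by (auto simp: \<psi>c mat_dist_isometry[OF \<psi>] Pi_iff)
  then have "(\<exists>U. openin Z U \<and> x \<in> U \<and> (\<forall>y\<in>U. \<psi> (f y) \<in> N.mball (\<psi> (f x)) e)) \<longleftrightarrow>
      (\<exists>U. openin Z U \<and> x \<in> U \<and> (\<forall>y\<in>U. f y \<in> M.mball (f x) e))" if "x \<in> topspace Z" for x e
    using that openin_subset[of Z] by (metis subsetD)
  then show ?thesis
    unfolding mat_top_def M.continuous_map_to_metric N.continuous_map_to_metric by simp
qed

lemma mat_isometry_inject:
  assumes "m \<ge> 1" "n \<ge> 1" and \<psi>: "mat_isometry m n \<psi>"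
    and X: "X \<in> carrier_mat m m" and Y: "Y \<in> carrier_mat m m" and eq: "\<psi> X = \<psi> Y"
  shows "X = Y"
proof -
  interpret M: Metric_space "carrier_mat m m" "mat_dist nrm m" by (rule Metric_space_mat_dist) fact
  interpret N: Metric_space "carrier_mat n n" "mat_dist nrm n" by (rule Metric_space_mat_dist) fact
  have "\<psi> X \<in> carrier_mat n n" using \<psi> X by (simp add: mat_isometry_def)
  then have "mat_dist nrm m X Y = 0" using mat_dist_isometry[OF \<psi> X Y] eq by simp
  then show ?thesis using X Y by simp
qed

text \<open>The norm of a direct sum is a maximum, so the distance of the quotients to their limit
  is the maximum of two distances tending to zero.\<close>

lemma has_mat_deriv_dsum:
  assumes "m \<ge> 1" "n \<ge> 1"
    and Y: "\<And>s. s \<in> I \<Longrightarrow> Y s \<in> carrier_mat m m" and Z: "\<And>s. s \<in> I \<Longrightarrow> Z s \<in> carrier_mat n n" and t: "t \<in> I"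
    and dY: "has_mat_deriv smul nrm m I Y D t" and dZ: "has_mat_deriv smul nrm n I Z E t"
  shows "has_mat_deriv smul nrm (m + n) I (\<lambda>s. dsum (Y s) (Z s)) (dsum D E) t"
proof -
  interpret M: Metric_space "carrier_mat m m" "mat_dist nrm m" by (rule Metric_space_mat_dist) fact
  interpret N: Metric_space "carrier_mat n n" "mat_dist nrm n" by (rule Metric_space_mat_dist) fact
  interpret MN: Metric_space "carrier_mat (m + n) (m + n)" "mat_dist nrm (m + n)"
    by (rule Metric_space_mat_dist) (use assms(1) in simp)
  let ?q = "\<lambda>Y s. map_mat (smul (of_real (1 / (s - t)))) (Y s - Y t)"
  have D: "D \<in> carrier_mat m m" "((\<lambda>s. mat_dist nrm m (?q Y s) D) \<longlongrightarrow> 0) (at t within I)"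
    using dY unfolding has_mat_deriv_def mat_top_def M.limitin_metric_dist_null by auto
  have E: "E \<in> carrier_mat n n" "((\<lambda>s. mat_dist nrm n (?q Z s) E) \<longlongrightarrow> 0) (at t within I)"
    using dZ unfolding has_mat_deriv_def mat_top_def N.limitin_metric_dist_null by auto
  have minus: "dsum A B - dsum A' B' = dsum (A - A') (B - B')"
    if "A \<in> carrier_mat m m" "A' \<in> carrier_mat m m" "B \<in> carrier_mat n n" "B' \<in> carrier_mat n n" for A A' B B' :: "'v mat"
    using that by (intro eq_matI) (auto simp: dsum_def)
  have q: "?q Y s \<in> carrier_mat m m" "?q Z s \<in> carrier_mat n n" for s
    using minus_carrier_mat[OF Y[OF t]] minus_carrier_mat[OF Z[OF t]] by simp_all
  have qq: "?q (\<lambda>s. dsum (Y s) (Z s)) s = dsum (?q Y s) (?q Z s)" if "s \<in> I" for s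
    unfolding minus[OF Y[OF that] Y[OF t] Z[OF that] Z[OF t]]
    using Y[OF t] Z[OF t] by (intro eq_matI) (auto simp: dsum_def)
  have dist: "mat_dist nrm (m + n) (?q (\<lambda>s. dsum (Y s) (Z s)) s) (dsum D E) =
      max (mat_dist nrm m (?q Y s) D) (mat_dist nrm n (?q Z s) E)" if "s \<in> I" for s
  proof -
    have "nrm (m + n) (dsum (?q Y s) (?q Z s) - dsum D E) = max (nrm m (?q Y s - D)) (nrm n (?q Z s - E))"
      unfolding minus[OF q(1) D(1) q(2) E(1)]
      using D E assms(1,2) by (intro nrm_dsum) (auto intro: minus_carrier_mat)
    then show ?thesis unfolding qq[OF that]
      using q D E dsum_carrier[OF q] dsum_carrier[OF D(1) E(1)] by (simp add: mat_dist_def)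
  qed
  have "((\<lambda>s. max (mat_dist nrm m (?q Y s) D) (mat_dist nrm n (?q Z s) E)) \<longlongrightarrow> max 0 0) (at t within I)"
    using D(2) E(2) by (rule tendsto_max)
  then have "((\<lambda>s. max (mat_dist nrm m (?q Y s) D) (mat_dist nrm n (?q Z s) E)) \<longlongrightarrow> 0) (at t within I)"
    by simp
  then have "((\<lambda>s. mat_dist nrm (m + n) (?q (\<lambda>s. dsum (Y s) (Z s)) s) (dsum D E)) \<longlongrightarrow> 0) (at t within I)"
    by (rule Lim_transform_eventually)
       (unfold eventually_at_filter, intro always_eventually allI impI dist[symmetric])
  moreover have "?q (\<lambda>s. dsum (Y s) (Z s)) s \<in> carrier_mat (m + n) (m + n)" for s
    using minus_carrier_mat[OF dsum_carrier[OF Y[OF t] Z[OF t]]] by simp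
  ultimately show ?thesis
    unfolding has_mat_deriv_def mat_top_def MN.limitin_metric_dist_null
    using dsum_carrier[OF D(1) E(1)] by simp
qed

lemma has_mat_deriv_transform:
  assumes "\<And>s. s \<in> I \<Longrightarrow> Y s = Z s" "t \<in> I" "has_mat_deriv smul nrm n I Y D t"
  shows "has_mat_deriv smul nrm n I Z D t"
  unfolding has_mat_deriv_def
proof (rule limitin_transform_eventually[OF _ assms(3)[unfolded has_mat_deriv_def]])
  show "\<forall>\<^sub>F s in at t within I. map_mat (smul (of_real (1 / (s - t)))) (Y s - Y t) =
      map_mat (smul (of_real (1 / (s - t)))) (Z s - Z t)"
    unfolding eventually_at_filter using assms(1,2) by (intro always_eventually) simp
qed

lemma continuous_map_of_has_mat_deriv:
  assumes n: "n \<ge> 1" and Y: "\<And>s. s \<in> I \<Longrightarrow> Y s \<in> carrier_mat n n"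
    and der: "\<And>s. s \<in> I \<Longrightarrow> has_mat_deriv smul nrm n I Y (Y' s) s"
  shows "continuous_map (top_of_set I) (mat_top nrm n) Y"
proof -
  obtain T :: "'v mat \<Rightarrow> ('v mat discrete \<Rightarrow>\<^sub>C real)" where T: "norm_embedding n T"
    by (rule norm_embedding_exists[OF n])
  have "continuous_on I (\<lambda>s. T (Y s))"
    using der has_mat_deriv_embedding[OF n T Y]
    by (auto simp: continuous_on_eq_continuous_within intro: has_vector_derivative_continuous)
  then show ?thesis
    unfolding continuous_map_mat_top_embedding[OF n T] using Y by (auto simp: continuous_map_iff_continuous)
qed

lemma nrm_copies:
  assumes "d \<ge> 1" "k \<ge> 1" and X: "X \<in> carrier_mat d d"
  shows "nrm (k * d) (copies k X) = nrm d X"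
  using assms(2)
proof (induction k rule: nat_induct_at_least)
  case base
  have "copies 1 X = X" by (simp add: copies_def del: diag_block_mat.simps)
  then show ?case by simp
next
  case (Suc k)
  have "nrm (d + k * d) (dsum X (copies k X)) = max (nrm d X) (nrm (k * d) (copies k X))"
    using assms Suc copies_carrier[OF X] by (intro nrm_dsum) auto
  then show ?case using Suc by (simp add: copies_Suc)
qed

lemma copies_isometry:
  assumes "d \<ge> 1" "k \<ge> 1"
  shows "mat_isometry d (k * d) (copies k)"
  unfolding mat_isometry_def
proof (intro conjI ballI allI)
  fix X :: "'v mat" assume X: "X \<in> carrier_mat d d"
  note cX = copies_carrier[OF X, of k]
  show "copies k X \<in> carrier_mat (k * d) (k * d)" by (rule cX)
  show "nrm (k * d) (copies k X) = nrm d X" by (rule nrm_copies[OF assms X])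
  have md: "i mod d < d" for i using assms by simp
  fix c
  have X': "map_mat (smul c) X \<in> carrier_mat d d" using X by simp
  show "copies k (map_mat (smul c) X) = map_mat (smul c) (copies k X)"
    using X cX copies_carrier[OF X', of k] md
    by (intro eq_matI) (auto simp: copies_index[OF X] copies_index[OF X'])
next
  fix X Y :: "'v mat" assume X: "X \<in> carrier_mat d d" and Y: "Y \<in> carrier_mat d d"
  have XY: "X - Y \<in> carrier_mat d d" using Y by (rule minus_carrier_mat)
  have md: "i mod d < d" for i using assms by simp
  show "copies k (X - Y) = copies k X - copies k Y"
    using X Y copies_carrier[OF X, of k] copies_carrier[OF Y, of k] copies_carrier[OF XY, of k] md
    by (intro eq_matI) (auto simp: copies_index[OF X] copies_index[OF Y] copies_index[OF XY])
qed

end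

section \<open>Permuted amplifications\<close>

definition perm_mat :: "nat \<Rightarrow> (nat \<Rightarrow> nat) \<Rightarrow> 'a mat \<Rightarrow> 'a mat" where
  "perm_mat n \<sigma> A = mat n n (\<lambda>(i, j). A $$ (\<sigma> i, \<sigma> j))"

text \<open>One family covers both kinds of similarity in use: permutations with all signs 1, and
  diagonal sign changes with \<open>\<sigma>\<close> the identity.\<close>

definition signed_perm :: "nat \<Rightarrow> (nat \<Rightarrow> nat) \<Rightarrow> (nat \<Rightarrow> 'f) \<Rightarrow> 'f::zero mat" where
  "signed_perm n \<sigma> \<epsilon> = mat n n (\<lambda>(i, j). if j = \<sigma> i then \<epsilon> i else 0)"

lemma signed_perm_inverts:
  fixes \<epsilon> :: "nat \<Rightarrow> 'f::comm_ring_1"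
  assumes \<sigma>: "bij_betw \<sigma> {..<n} {..<n}" and \<epsilon>: "\<And>i. \<epsilon> i * \<epsilon> i = 1"
  shows "inverts_mat (signed_perm n \<sigma> \<epsilon>) (transpose_mat (signed_perm n \<sigma> \<epsilon>))"
    "inverts_mat (transpose_mat (signed_perm n \<sigma> \<epsilon>)) (signed_perm n \<sigma> \<epsilon>)"
proof -
  let ?P = "signed_perm n \<sigma> \<epsilon>"
  have lt: "\<sigma> i < n" if "i < n" for i using bij_betwE[OF \<sigma>] that by auto
  have inj: "\<sigma> i = \<sigma> j \<longleftrightarrow> i = j" if "i < n" "j < n" for i j
    using \<sigma> that by (auto simp: bij_betw_def inj_on_def)
  have "?P * transpose_mat ?P = 1\<^sub>m n"
  proof (rule eq_matI)
    fix i j assume "i < dim_row (1\<^sub>m n :: 'f mat)" "j < dim_col (1\<^sub>m n :: 'f mat)"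
    then have ij: "i < n" "j < n" by auto
    have "(?P * transpose_mat ?P) $$ (i, j) =
        (\<Sum>k<n. (if k = \<sigma> i then \<epsilon> i else 0) * (if k = \<sigma> j then \<epsilon> j else 0))"
      using ij by (simp add: signed_perm_def scalar_prod_def lessThan_atLeast0)
    also have "\<dots> = (\<Sum>k<n. if k = \<sigma> i then (if \<sigma> i = \<sigma> j then \<epsilon> i * \<epsilon> j else 0) else 0)"
      by (intro sum.cong) auto
    also have "\<dots> = (if i = j then 1 else 0)" using ij lt inj \<epsilon> by (simp add: sum.delta)
    finally show "(?P * transpose_mat ?P) $$ (i, j) = (1\<^sub>m n :: 'f mat) $$ (i, j)" using ij by simp
  qed (simp_all add: signed_perm_def)
  then show "inverts_mat ?P (transpose_mat ?P)" by (simp add: inverts_mat_def signed_perm_def)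
  have "transpose_mat ?P * ?P = 1\<^sub>m n"
  proof (rule eq_matI)
    fix i j assume "i < dim_row (1\<^sub>m n :: 'f mat)" "j < dim_col (1\<^sub>m n :: 'f mat)"
    then have ij: "i < n" "j < n" by auto
    then obtain i' where i': "i' < n" "\<sigma> i' = i" using \<sigma> unfolding bij_betw_def by (metis imageE lessThan_iff)
    have "(transpose_mat ?P * ?P) $$ (i, j) =
        (\<Sum>k<n. (if i = \<sigma> k then \<epsilon> k else 0) * (if j = \<sigma> k then \<epsilon> k else 0))"
      using ij by (simp add: signed_perm_def scalar_prod_def lessThan_atLeast0)
    also have "\<dots> = (\<Sum>k<n. if k = i' then (if i = j then 1 else 0) else 0)"
      using i' inj \<epsilon> by (intro sum.cong) auto
    also have "\<dots> = (if i = j then 1 else 0)" using i' by (simp add: sum.delta)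
    finally show "(transpose_mat ?P * ?P) $$ (i, j) = (1\<^sub>m n :: 'f mat) $$ (i, j)" using ij by simp
  qed (simp_all add: signed_perm_def)
  then show "inverts_mat (transpose_mat ?P) ?P" by (simp add: inverts_mat_def signed_perm_def)
qed

text \<open>Coordinates are permuted and multiplied by scalars of norm 1, so the l2 norm of a vector
  does not change. The zero vector makes the supremum range over a nonempty set and bounds it
  below.\<close>

lemma op_norm_signed_perm:
  fixes \<epsilon> :: "nat \<Rightarrow> 'f::real_normed_field"
  assumes \<sigma>: "bij_betw \<sigma> {..<n} {..<n}" and \<epsilon>: "\<And>i. norm (\<epsilon> i) = 1"
  shows "0 \<le> op_norm (signed_perm n \<sigma> \<epsilon>)" "op_norm (signed_perm n \<sigma> \<epsilon>) \<le> 1"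
proof -
  let ?P = "signed_perm n \<sigma> \<epsilon>"
  let ?S = "{x \<in> carrier_vec (dim_col ?P). l2_norm x \<le> 1}"
  have zero: "0\<^sub>v n \<in> ?S" by (simp add: signed_perm_def l2_norm_def L2_set_def)
  have le: "l2_norm (?P *\<^sub>v x) \<le> 1" if "x \<in> ?S" for x
  proof -
    have x: "dim_vec x = n" "l2_norm x \<le> 1" using that by (auto simp: signed_perm_def)
    have lt: "\<sigma> i < n" if "i < n" for i using bij_betwE[OF \<sigma>] that by auto
    have "vec_index (?P *\<^sub>v x) i = \<epsilon> i * vec_index x (\<sigma> i)" if "i < n" for i
    proof -
      have "vec_index (?P *\<^sub>v x) i = (\<Sum>k<n. (if k = \<sigma> i then \<epsilon> i else 0) * vec_index x k)"
        using that x by (simp add: signed_perm_def scalar_prod_def lessThan_atLeast0)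
      also have "\<dots> = (\<Sum>k<n. if k = \<sigma> i then \<epsilon> i * vec_index x (\<sigma> i) else 0)" by (intro sum.cong) auto
      finally show ?thesis using lt[OF that] by (simp add: sum.delta)
    qed
    then have "l2_norm (?P *\<^sub>v x) = sqrt (\<Sum>i<n. (norm (vec_index x (\<sigma> i)))\<^sup>2)"
      using \<epsilon> by (simp add: l2_norm_def L2_set_def signed_perm_def norm_mult)
    also have "\<dots> = sqrt (\<Sum>i<n. (norm (vec_index x i))\<^sup>2)"
      using sum.reindex_bij_betw[OF \<sigma>, of "\<lambda>i. (norm (vec_index x i))\<^sup>2"] by simp
    also have "\<dots> = l2_norm x" by (simp add: l2_norm_def L2_set_def x)
    finally show ?thesis using x by simp
  qed
  show "op_norm ?P \<le> 1" unfolding op_norm_def using zero le by (intro cSUP_least) auto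
  have "l2_norm (?P *\<^sub>v 0\<^sub>v n) \<le> op_norm ?P"
    unfolding op_norm_def using le by (intro cSUP_upper[OF zero] bdd_aboveI2) auto
  moreover have "0 \<le> l2_norm (?P *\<^sub>v 0\<^sub>v n)" by (simp add: l2_norm_def L2_set_nonneg)
  ultimately show "0 \<le> op_norm ?P" by linarith
qed

lemma transpose_perm:
  fixes \<sigma> :: "nat \<Rightarrow> nat"
  assumes \<sigma>: "bij_betw \<sigma> {..<n} {..<n}"
  shows "transpose_mat (signed_perm n \<sigma> (\<lambda>_. 1)) = signed_perm n (inv_into {..<n} \<sigma>) (\<lambda>_. 1 :: 'f::zero_neq_one)"
proof -
  let ?\<tau> = "inv_into {..<n} \<sigma>"
  have "i = \<sigma> j \<longleftrightarrow> j = ?\<tau> i" if "i < n" "j < n" for i j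
    using that bij_betw_inv_into_left[OF \<sigma>] bij_betw_inv_into_right[OF \<sigma>] by auto
  then show ?thesis by (intro eq_matI) (auto simp: signed_perm_def)
qed

text \<open>
  The entries of \<open>X\<close>, spread over the \<open>K\<close> diagonal blocks of \<open>I\<^sub>K \<otimes> X\<close> and then permuted:
  \<open>\<rho> a = (i, p)\<close> says that position \<open>a\<close> carries index \<open>i\<close> of the \<open>p\<close>-th copy of \<open>X\<close>.
\<close>

definition amp :: "nat \<Rightarrow> nat \<Rightarrow> (nat \<Rightarrow> nat \<times> nat) \<Rightarrow> 'v::zero mat \<Rightarrow> 'v mat" where
  "amp n K \<rho> X = mat (n * K) (n * K)
     (\<lambda>(a, b). if snd (\<rho> a) = snd (\<rho> b) then X $$ (fst (\<rho> a), fst (\<rho> b)) else 0)"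

lemma amp_carrier [simp]: "amp n K \<rho> X \<in> carrier_mat (n * K) (n * K)"
  by (simp add: amp_def)

lemma amp_dims [simp]: "dim_row (amp n K \<rho> X) = n * K" "dim_col (amp n K \<rho> X) = n * K"
  by (simp_all add: amp_def)

lemma amp_index:
  "a < n * K \<Longrightarrow> b < n * K \<Longrightarrow>
   amp n K \<rho> X $$ (a, b) = (if snd (\<rho> a) = snd (\<rho> b) then X $$ (fst (\<rho> a), fst (\<rho> b)) else 0)"
  by (simp add: amp_def)

lemma amp_inject:
  assumes \<rho>: "bij_betw \<rho> {..<n * K} ({..<n} \<times> {..<K})" and K: "K \<ge> 1"
    and X: "X \<in> carrier_mat n n" and Y: "Y \<in> carrier_mat n n" and eq: "amp n K \<rho> X = amp n K \<rho> Y"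
  shows "X = Y"
proof (rule eq_matI)
  fix i j assume "i < dim_row Y" "j < dim_col Y"
  then have ij: "i < n" "j < n" using Y by auto
  have surj: "\<exists>a<n * K. \<rho> a = (i, 0)" if "i < n" for i
  proof -
    have "(i, 0) \<in> \<rho> ` {..<n * K}" using \<rho> that K by (auto simp: bij_betw_def)
    then show ?thesis by (metis imageE lessThan_iff)
  qed
  obtain a b where ab: "a < n * K" "b < n * K" "\<rho> a = (i, 0)" "\<rho> b = (j, 0)"
    using surj[OF ij(1)] surj[OF ij(2)] by blast
  have "amp n K \<rho> X $$ (a, b) = amp n K \<rho> Y $$ (a, b)" using eq by simp
  then show "X $$ (i, j) = Y $$ (i, j)" using ab by (simp add: amp_index)
qed (use X Y in auto)

lemma mult_add_less: "i < n \<Longrightarrow> p < K \<Longrightarrow> p * n + i < n * (K :: nat)"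
proof -
  assume "i < n" "p < K"
  then have "p * n + i < Suc p * n" "Suc p * n \<le> K * n" by (simp, intro mult_le_mono1, simp)
  then show ?thesis by (simp add: mult.commute)
qed

lemma bij_betw_mod_div:
  assumes "n \<ge> 1"
  shows "bij_betw (\<lambda>a. (a mod n, a div n)) {..<n * K} ({..<n} \<times> {..<K :: nat})"
proof (rule bij_betw_byWitness[where f' = "\<lambda>(i, p). p * n + i"])
  show "(\<lambda>a. (a mod n, a div n)) ` {..<n * K} \<subseteq> {..<n} \<times> {..<K}"
    using assms by (auto simp: less_mult_imp_div_less mult.commute)
  show "(\<lambda>(i, p). p * n + i) ` ({..<n} \<times> {..<K}) \<subseteq> {..<n * K}"
    by (auto intro: mult_add_less)
qed (use assms in \<open>auto simp: div_mult_mod_eq\<close>)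

lemma amp_mod_div:
  assumes "X \<in> carrier_mat n n"
  shows "amp n K (\<lambda>a. (a mod n, a div n)) X = copies K X"
  using carrier_matD[OF copies_carrier[OF assms, of K]]
  by (intro eq_matI) (simp_all add: amp_index copies_index[OF assms] mult.commute[of K n])

section \<open>Similarities acting on amplifications\<close>

context operator_space
begin

lemma signed_perm_conj:
  assumes \<sigma>: "bij_betw \<sigma> {..<n} {..<n}" and A: "A \<in> carrier_mat n n"
  shows "rmult smul (lmult smul (signed_perm n \<sigma> \<epsilon>) A) (transpose_mat (signed_perm n \<sigma> \<epsilon>)) =
    mat n n (\<lambda>(i, j). smul (\<epsilon> j) (smul (\<epsilon> i) (A $$ (\<sigma> i, \<sigma> j))))"
proof (rule eq_matI)
  have lt: "\<sigma> i < n" if "i < n" for i using bij_betwE[OF \<sigma>] that by auto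
  have l: "lmult smul (signed_perm n \<sigma> \<epsilon>) A $$ (i, j) = smul (\<epsilon> i) (A $$ (\<sigma> i, j))"
    if "i < n" "j < n" for i j
  proof -
    have "lmult smul (signed_perm n \<sigma> \<epsilon>) A $$ (i, j) =
        (\<Sum>k<n. smul (if k = \<sigma> i then \<epsilon> i else 0) (A $$ (k, j)))"
      using that A by (simp add: lmult_def signed_perm_def)
    also have "\<dots> = (\<Sum>k<n. if k = \<sigma> i then smul (\<epsilon> i) (A $$ (\<sigma> i, j)) else 0)"
      by (intro sum.cong) auto
    finally show ?thesis using lt[OF that(1)] by (simp add: sum.delta)
  qed
  have dims: "dim_row (lmult smul (signed_perm n \<sigma> \<epsilon>) A) = n" "dim_col (lmult smul (signed_perm n \<sigma> \<epsilon>) A) = n"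
    using A by (auto simp: lmult_def signed_perm_def)
  fix i j assume "i < dim_row (mat n n (\<lambda>(i, j). smul (\<epsilon> j) (smul (\<epsilon> i) (A $$ (\<sigma> i, \<sigma> j)))))"
    "j < dim_col (mat n n (\<lambda>(i, j). smul (\<epsilon> j) (smul (\<epsilon> i) (A $$ (\<sigma> i, \<sigma> j)))))"
  then have ij: "i < n" "j < n" by auto
  have "rmult smul (lmult smul (signed_perm n \<sigma> \<epsilon>) A) (transpose_mat (signed_perm n \<sigma> \<epsilon>)) $$ (i, j) =
      (\<Sum>k<n. smul (if k = \<sigma> j then \<epsilon> j else 0) (lmult smul (signed_perm n \<sigma> \<epsilon>) A $$ (i, k)))"
    using ij by (simp add: rmult_def dims) (simp add: signed_perm_def)
  also have "\<dots> = (\<Sum>k<n. if k = \<sigma> j then smul (\<epsilon> j) (smul (\<epsilon> i) (A $$ (\<sigma> i, \<sigma> j))) else 0)"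
    using ij by (intro sum.cong) (auto simp: l)
  also have "\<dots> = smul (\<epsilon> j) (smul (\<epsilon> i) (A $$ (\<sigma> i, \<sigma> j)))" using lt[OF ij(2)] by (simp add: sum.delta)
  finally show "rmult smul (lmult smul (signed_perm n \<sigma> \<epsilon>) A) (transpose_mat (signed_perm n \<sigma> \<epsilon>)) $$ (i, j) =
      mat n n (\<lambda>(i, j). smul (\<epsilon> j) (smul (\<epsilon> i) (A $$ (\<sigma> i, \<sigma> j)))) $$ (i, j)"
    using ij by simp
qed (use A in \<open>auto simp: rmult_def lmult_def signed_perm_def\<close>)

text \<open>Conjugation by matrices of operator norm at most 1 does not increase the norm; the
  inverse permutation gives the other inequality.\<close>

lemma nrm_perm_mat:
  assumes n: "n \<ge> 1" and \<sigma>: "bij_betw \<sigma> {..<n} {..<n}" and A: "A \<in> carrier_mat n n"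
  shows "nrm n (perm_mat n \<sigma> A) = nrm n A"
proof -
  have le: "nrm n (perm_mat n \<sigma> A) \<le> nrm n A"
    if \<sigma>: "bij_betw \<sigma> {..<n} {..<n}" and A: "A \<in> carrier_mat n n" for \<sigma> A
  proof -
    let ?P = "signed_perm n \<sigma> (\<lambda>_. 1 :: 'f)"
    have P: "?P \<in> carrier_mat n n" by (simp add: signed_perm_def)
    have "perm_mat n \<sigma> A = rmult smul (lmult smul ?P A) (transpose_mat ?P)"
      unfolding signed_perm_conj[OF \<sigma> A] by (simp add: perm_mat_def)
    then have "nrm n (perm_mat n \<sigma> A) \<le> op_norm ?P * nrm n A * op_norm (transpose_mat ?P)"
      using nrm_mult[OF n A P] P by simp
    moreover have "0 \<le> op_norm ?P" "op_norm ?P \<le> 1" by (rule op_norm_signed_perm[OF \<sigma>]; simp)+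
    moreover have "0 \<le> op_norm (transpose_mat ?P)" "op_norm (transpose_mat ?P) \<le> 1"
      unfolding transpose_perm[OF \<sigma>] by (rule op_norm_signed_perm[OF bij_betw_inv_into[OF \<sigma>]]; simp)+
    ultimately show ?thesis
      using nrm_nonneg[OF n A] mult_mono[of "op_norm ?P * nrm n A" "1 * nrm n A" "op_norm (transpose_mat ?P)" 1]
        mult_right_mono[of "op_norm ?P" 1 "nrm n A"] by simp
  qed
  let ?\<tau> = "inv_into {..<n} \<sigma>"
  have \<tau>: "bij_betw ?\<tau> {..<n} {..<n}" by (rule bij_betw_inv_into[OF \<sigma>])
  have "perm_mat n ?\<tau> (perm_mat n \<sigma> A) = A"
    using A bij_betwE[OF \<tau>] bij_betw_inv_into_right[OF \<sigma>] by (intro eq_matI) (auto simp: perm_mat_def)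
  then have "nrm n A \<le> nrm n (perm_mat n \<sigma> A)"
    using le[OF \<tau>, of "perm_mat n \<sigma> A"] by (simp add: perm_mat_def)
  then show ?thesis using le[OF \<sigma> A] by simp
qed

lemma amp_isometry:
  assumes n: "n \<ge> 1" and K: "K \<ge> 1" and \<rho>: "bij_betw \<rho> {..<n * K} ({..<n} \<times> {..<K})"
  shows "mat_isometry n (n * K) (amp n K \<rho>)"
  unfolding mat_isometry_def
proof (intro conjI ballI allI)
  have lt: "fst (\<rho> a) < n" "snd (\<rho> a) < K" if "a < n * K" for a
    using bij_betwE[OF \<rho>] that by (auto simp: mem_Times_iff)
  fix X :: "'v mat" assume X: "X \<in> carrier_mat n n"
  show "amp n K \<rho> X \<in> carrier_mat (n * K) (n * K)" by simp
  \<comment> \<open>\<open>p * n + i\<close> is the position of index i of the p-th copy in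
    \<open>copies K X\<close>, so the amplification is a permutation of
    \<open>copies K X\<close>.\<close>
  let ?\<sigma> = "(\<lambda>(i, p). p * n + i) \<circ> \<rho>"
  have dec: "bij_betw (\<lambda>(i, p). p * n + i) ({..<n} \<times> {..<K}) {..<n * K}"
  proof (rule bij_betw_byWitness[where f' = "\<lambda>a. (a mod n, a div n)"])
    show "(\<lambda>(i, p). p * n + i) ` ({..<n} \<times> {..<K}) \<subseteq> {..<n * K}"
      by (auto intro: mult_add_less)
    show "(\<lambda>a. (a mod n, a div n)) ` {..<n * K} \<subseteq> {..<n} \<times> {..<K}"
      using n by (auto simp: less_mult_imp_div_less mult.commute)
  qed (use n in \<open>auto simp: div_mult_mod_eq\<close>)
  have \<sigma>: "bij_betw ?\<sigma> {..<n * K} {..<n * K}" using bij_betw_trans[OF \<rho> dec] .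
  have \<sigma>_lt: "?\<sigma> a < K * n" if "a < n * K" for a using bij_betwE[OF \<sigma>] that by (simp add: mult.commute)
  have "amp n K \<rho> X = perm_mat (n * K) ?\<sigma> (copies K X)"
  proof (rule eq_matI)
    fix a b assume "a < dim_row (perm_mat (n * K) ?\<sigma> (copies K X))" "b < dim_col (perm_mat (n * K) ?\<sigma> (copies K X))"
    then have ab: "a < n * K" "b < n * K" by (auto simp: perm_mat_def)
    have "?\<sigma> c div n = snd (\<rho> c)" "?\<sigma> c mod n = fst (\<rho> c)" if "c < n * K" for c
      using lt(1)[OF that] n by (auto simp: case_prod_beta)
    then show "amp n K \<rho> X $$ (a, b) = perm_mat (n * K) ?\<sigma> (copies K X) $$ (a, b)"
      using ab copies_index[OF X \<sigma>_lt[OF ab(1)] \<sigma>_lt[OF ab(2)]] by (simp add: amp_index perm_mat_def)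
  qed (simp_all add: perm_mat_def amp_def)
  then show "nrm (n * K) (amp n K \<rho> X) = nrm n X"
    using nrm_perm_mat[OF _ \<sigma>, of "copies K X"] copies_carrier[OF X, of K] nrm_copies[OF n K X] n K
    by (simp add: mult.commute)
  show "amp n K \<rho> (map_mat (smul c) X) = map_mat (smul c) (amp n K \<rho> X)" for c
    using X lt by (intro eq_matI) (auto simp: amp_def)
  show "amp n K \<rho> (X - Y) = amp n K \<rho> X - amp n K \<rho> Y" if "Y \<in> carrier_mat n n" for Y
    using X that lt by (intro eq_matI) (auto simp: amp_def)
qed

text \<open>\<open>\<Xi>\<close> need not be invariant under similarities, so the conjugated matrix
  B is assumed to lie in it. It is conveniently given by its entries rather than as a
  product.\<close>

lemma respects_signed_perm:
  assumes h: "respects_similarities smul \<Xi> h" and n: "n \<ge> 1" and A: "A \<in> level \<Xi> n"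
    and hA: "h A \<in> carrier_mat n n" and \<sigma>: "bij_betw \<sigma> {..<n} {..<n}"
    and \<epsilon>: "\<And>i. \<epsilon> i * \<epsilon> i = 1"
    and B: "B = mat n n (\<lambda>(i, j). smul (\<epsilon> j) (smul (\<epsilon> i) (A $$ (\<sigma> i, \<sigma> j))))" "B \<in> \<Xi>"
  shows "h B = mat n n (\<lambda>(i, j). smul (\<epsilon> j) (smul (\<epsilon> i) (h A $$ (\<sigma> i, \<sigma> j))))"
proof -
  let ?P = "signed_perm n \<sigma> \<epsilon>"
  have P: "?P \<in> carrier_mat n n" "transpose_mat ?P \<in> carrier_mat n n" by (simp_all add: signed_perm_def)
  have Ac: "A \<in> carrier_mat n n" using A by (simp add: level_def)
  have BP: "B = rmult smul (lmult smul ?P A) (transpose_mat ?P)"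
    unfolding B(1) by (rule signed_perm_conj[OF \<sigma> Ac, symmetric])
  have "B \<in> carrier_mat n n" unfolding B(1) by simp
  then have "B \<in> level \<Xi> n" using B(2) by (simp add: level_def)
  then have BP_level: "rmult smul (lmult smul ?P A) (transpose_mat ?P) \<in> level \<Xi> n"
    unfolding BP .
  have "h (rmult smul (lmult smul ?P A) (transpose_mat ?P)) = rmult smul (lmult smul ?P (h A)) (transpose_mat ?P)"
    by (rule h[unfolded respects_similarities_def, rule_format, OF n A P])
       (intro conjI signed_perm_inverts[OF \<sigma> \<epsilon>] BP_level)
  then have "h B = rmult smul (lmult smul ?P (h A)) (transpose_mat ?P)"
    by (simp only: BP)
  then show ?thesis by (simp only: signed_perm_conj[OF \<sigma> hA])
qed

lemma respects_perm:
  assumes h: "respects_similarities smul \<Xi> h" and n: "n \<ge> 1" and A: "A \<in> level \<Xi> n"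
    and hA: "h A \<in> carrier_mat n n" and \<sigma>: "bij_betw \<sigma> {..<n} {..<n}" and B: "perm_mat n \<sigma> A \<in> \<Xi>"
  shows "h (perm_mat n \<sigma> A) = perm_mat n \<sigma> (h A)"
  using respects_signed_perm[OF h n A hA \<sigma>, of "\<lambda>_. 1" "perm_mat n \<sigma> A"] B by (simp add: perm_mat_def)

text \<open>
  \<open>amp n K \<rho> X\<close> is fixed by conjugation with sign changes of a single copy and with transpositions of
  two copies; the first force the image to vanish between different copies, the second make
  its diagonal blocks equal.
\<close>

lemma respects_similarities_amp:
  assumes h: "respects_similarities smul \<Xi> h" and n: "n \<ge> 1" and K: "K \<ge> 1"
    and \<rho>: "bij_betw \<rho> {..<n * K} ({..<n} \<times> {..<K})" and X: "X \<in> carrier_mat n n"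
    and A: "amp n K \<rho> X \<in> \<Xi>" and hA: "h (amp n K \<rho> X) \<in> carrier_mat (n * K) (n * K)"
  obtains Z where "Z \<in> carrier_mat n n" "h (amp n K \<rho> X) = amp n K \<rho> Z"
proof -
  let ?N = "n * K" and ?A = "amp n K \<rho> X"
  define M where "M = h ?A"
  have M: "M \<in> carrier_mat ?N ?N" using hA by (simp add: M_def)
  have N: "?N \<ge> 1" using n K by simp
  have A': "?A \<in> level \<Xi> ?N" using A by (simp add: level_def)
  have lt: "fst (\<rho> a) < n" "snd (\<rho> a) < K" if "a < ?N" for a
    using bij_betwE[OF \<rho>] that by (auto simp: mem_Times_iff)
  have off: "M $$ (a, b) = 0" if ab: "a < ?N" "b < ?N" "snd (\<rho> a) \<noteq> snd (\<rho> b)" for a b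
  proof -
    \<comment> \<open>The sign changes exactly on the copy containing position a. As b lies in
      another copy, the entry at (a, b) changes sign while M is fixed.\<close>
    define \<epsilon> :: "nat \<Rightarrow> 'f" where "\<epsilon> c = (if snd (\<rho> c) = snd (\<rho> a) then - 1 else 1)" for c
    have "M = mat ?N ?N (\<lambda>(i, j). smul (\<epsilon> j) (smul (\<epsilon> i) (M $$ (id i, id j))))"
      unfolding M_def
    proof (rule respects_signed_perm[OF h N A' hA bij_betw_id])
      show "?A = mat ?N ?N (\<lambda>(i, j). smul (\<epsilon> j) (smul (\<epsilon> i) (?A $$ (id i, id j))))"
        by (rule eq_matI) (auto simp: amp_def \<epsilon>_def)
    qed (auto simp: A \<epsilon>_def)
    then have "M $$ (a, b) = mat ?N ?N (\<lambda>(i, j). smul (\<epsilon> j) (smul (\<epsilon> i) (M $$ (id i, id j)))) $$ (a, b)"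
      by (rule arg_cong)
    then have "M $$ (a, b) = - M $$ (a, b)" using ab by (simp add: \<epsilon>_def)
    \<comment> \<open>A real normed field has characteristic zero, so 2 can be cancelled.\<close>
    then have "smul 2 (M $$ (a, b)) = 0"
      using scale_left_distrib[of 1 1 "M $$ (a, b)"] by (simp add: eq_neg_iff_add_eq_0)
    then show ?thesis by simp
  qed
  let ?\<rho>' = "inv_into {..<?N} \<rho>"
  have inv1: "?\<rho>' (\<rho> a) = a" if "a < ?N" for a using bij_betw_inv_into_left[OF \<rho>] that by simp
  have inv2: "\<rho> (?\<rho>' (i, p)) = (i, p)" "?\<rho>' (i, p) < ?N" if "i < n" "p < K" for i p
    using bij_betw_inv_into_right[OF \<rho>, of "(i, p)"] bij_betwE[OF bij_betw_inv_into[OF \<rho>]] that by auto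
  have diag: "M $$ (?\<rho>' (i, p), ?\<rho>' (j, p)) = M $$ (?\<rho>' (i, 0), ?\<rho>' (j, 0))"
    if ij: "i < n" "j < n" and p: "p < K" for i j p
  proof -
    \<comment> \<open>This exchanges the copies 0 and p, and is the identity for p = 0.\<close>
    define \<tau> :: "nat \<Rightarrow> nat" where "\<tau> q = (if q = p then 0 else if q = 0 then p else q)" for q
    have \<tau>\<tau>: "\<tau> (\<tau> q) = q" for q by (auto simp: \<tau>_def)
    have \<tau>lt: "\<tau> q < K" if "q < K" for q using that p K by (auto simp: \<tau>_def)
    define \<sigma> where "\<sigma> a = ?\<rho>' (fst (\<rho> a), \<tau> (snd (\<rho> a)))" for a
    have \<sigma>_lt: "\<sigma> a < ?N" and \<rho>\<sigma>: "\<rho> (\<sigma> a) = (fst (\<rho> a), \<tau> (snd (\<rho> a)))" if "a < ?N" for a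
      using inv2[OF lt(1)[OF that] \<tau>lt[OF lt(2)[OF that]]] by (auto simp: \<sigma>_def)
    have "\<sigma> (\<sigma> a) = a" if "a < ?N" for a
    proof -
      have "\<sigma> (\<sigma> a) = ?\<rho>' (\<rho> a)" by (simp add: \<sigma>_def[of "\<sigma> a"] \<rho>\<sigma>[OF that] \<tau>\<tau>)
      then show ?thesis by (simp add: inv1[OF that])
    qed
    then have \<sigma>: "bij_betw \<sigma> {..<?N} {..<?N}"
      using \<sigma>_lt by (intro bij_betw_byWitness[where f' = \<sigma>]) auto
    have "\<tau> q = \<tau> r \<longleftrightarrow> q = r" for q r using \<tau>\<tau> by metis
    then have fixed: "perm_mat ?N \<sigma> ?A = ?A"
      using \<sigma>_lt \<rho>\<sigma> by (intro eq_matI) (auto simp: perm_mat_def amp_index)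
    then have "M = perm_mat ?N \<sigma> M"
      using respects_perm[OF h N A' hA \<sigma>] A by (simp add: M_def)
    then have "M $$ (?\<rho>' (i, 0), ?\<rho>' (j, 0)) = perm_mat ?N \<sigma> M $$ (?\<rho>' (i, 0), ?\<rho>' (j, 0))" by (rule arg_cong)
    also have "\<dots> = M $$ (?\<rho>' (i, p), ?\<rho>' (j, p))"
      using ij K inv2[OF ij(1), of 0] inv2[OF ij(2), of 0] by (simp add: perm_mat_def \<sigma>_def \<tau>_def)
    finally show ?thesis by simp
  qed
  define Z where "Z = mat n n (\<lambda>(i, j). M $$ (?\<rho>' (i, 0), ?\<rho>' (j, 0)))"
  have "M = amp n K \<rho> Z"
  proof (rule eq_matI)
    fix a b assume "a < dim_row (amp n K \<rho> Z)" "b < dim_col (amp n K \<rho> Z)"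
    then have ab: "a < ?N" "b < ?N" by (auto simp: amp_def)
    show "M $$ (a, b) = amp n K \<rho> Z $$ (a, b)"
    proof (cases "snd (\<rho> a) = snd (\<rho> b)")
      case True
      have "M $$ (a, b) = M $$ (?\<rho>' (fst (\<rho> a), snd (\<rho> a)), ?\<rho>' (fst (\<rho> b), snd (\<rho> b)))"
        by (simp add: inv1 ab)
      also have "\<dots> = M $$ (?\<rho>' (fst (\<rho> a), 0), ?\<rho>' (fst (\<rho> b), 0))"
        unfolding True using lt[OF ab(1)] lt[OF ab(2)] by (intro diag)
      finally show ?thesis using True ab lt by (simp add: amp_index Z_def)
    next
      case False
      then show ?thesis using ab off by (simp add: amp_index)
    qed
  qed (use M in \<open>auto simp: amp_def\<close>)
  moreover have "Z \<in> carrier_mat n n" by (simp add: Z_def)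
  ultimately show thesis using that unfolding M_def by blast
qed

text \<open>The two amplifications of X differ by a permutation similarity built from
  \<open>\<rho>\<close> and \<open>\<rho>'\<close>, and the same permutation relates those of Z.
  Hence the extended map does not depend on the chosen arrangement.\<close>

lemma respects_similarities_amp_independent:
  assumes h: "respects_similarities smul \<Xi> h" and n: "n \<ge> 1" and K: "K \<ge> 1"
    and \<rho>: "bij_betw \<rho> {..<n * K} ({..<n} \<times> {..<K})" and \<rho>': "bij_betw \<rho>' {..<n * K} ({..<n} \<times> {..<K})"
    and X: "X \<in> carrier_mat n n" and A: "amp n K \<rho> X \<in> \<Xi>" "amp n K \<rho>' X \<in> \<Xi>"
    and Z: "h (amp n K \<rho> X) = amp n K \<rho> Z"
  shows "h (amp n K \<rho>' X) = amp n K \<rho>' Z"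
proof -
  let ?\<sigma> = "inv_into {..<n * K} \<rho> \<circ> \<rho>'"
  have \<sigma>: "bij_betw ?\<sigma> {..<n * K} {..<n * K}"
    using bij_betw_trans[OF \<rho>' bij_betw_inv_into[OF \<rho>]] .
  have \<sigma>_lt: "?\<sigma> a < n * K" and \<rho>\<sigma>: "\<rho> (?\<sigma> a) = \<rho>' a" if "a < n * K" for a
    using bij_betwE[OF \<sigma>] bij_betw_inv_into_right[OF \<rho>] bij_betwE[OF \<rho>'] that by auto
  have perm: "perm_mat (n * K) ?\<sigma> (amp n K \<rho> Y) = amp n K \<rho>' Y" for Y :: "'v mat"
    using \<sigma>_lt \<rho>\<sigma> by (intro eq_matI) (auto simp: perm_mat_def amp_index amp_def)
  have "h (perm_mat (n * K) ?\<sigma> (amp n K \<rho> X)) = perm_mat (n * K) ?\<sigma> (h (amp n K \<rho> X))"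
    using A n K by (intro respects_perm[OF h _ _ _ \<sigma>]) (auto simp: level_def Z perm)
  then show ?thesis by (simp add: perm Z)
qed

end

section \<open>The differential equation on a nc set\<close>

text \<open>The identity is a trivialization over the whole base; a nonempty fiber makes the
  projection surjective.\<close>

lemma fiber_bundle_trivial:
  assumes "topspace F \<noteq> {}"
  shows "fiber_bundle (prod_topology B F) B fst F"
  unfolding fiber_bundle_def
proof (intro conjI ballI)
  show "continuous_map (prod_topology B F) B fst" by (rule continuous_map_fst)
  show "fst ` topspace (prod_topology B F) = topspace B" using assms by simp
  fix b assume b: "b \<in> topspace B"
  have "{e \<in> topspace (prod_topology B F). fst e \<in> topspace B} = topspace (prod_topology B F)" by auto
  then have "homeomorphic_map
      (subtopology (prod_topology B F) {e \<in> topspace (prod_topology B F). fst e \<in> topspace B})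
      (prod_topology (subtopology B (topspace B)) F) id"
    by (simp only: subtopology_topspace homeomorphic_map_id)
  then show "\<exists>U. openin B U \<and> b \<in> U \<and> (\<exists>\<phi>. homeomorphic_map
      (subtopology (prod_topology B F) {e \<in> topspace (prod_topology B F). fst e \<in> U})
      (prod_topology (subtopology B U) F) \<phi> \<and>
      (\<forall>e\<in>topspace (prod_topology B F). fst e \<in> U \<longrightarrow> fst (\<phi> e) = fst e))"
    using b by (intro exI[of _ "topspace B"]) (auto intro!: exI[of _ id])
qed

section \<open>Solutions at supported sizes and their common block\<close>

locale nc_ode = operator_space smul nrm
  for smul :: "'f::real_normed_field \<Rightarrow> 'v::ab_group_add \<Rightarrow> 'v" and nrm :: "nat \<Rightarrow> 'v mat \<Rightarrow> real" +
  fixes I :: "real set" and t0 :: real and \<Xi> :: "'v mat set" and X0n :: "nat \<Rightarrow> 'v mat"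
    and g :: "real \<Rightarrow> 'v mat \<Rightarrow> 'v mat" and C :: real and d :: nat
  assumes I: "is_interval I" "t0 \<in> I"
    and \<Xi>: "nc_set \<Xi>" "\<Xi> \<noteq> {}"
    and \<Xi>_closed: "n \<in> nc_supp \<Xi> \<Longrightarrow> closed_mat_subspace smul nrm n (level \<Xi> n)"
    and X0n: "n \<in> nc_supp \<Xi> \<Longrightarrow> X0n n \<in> level \<Xi> n" "nc_set (X0n ` nc_supp \<Xi>)"
    and g_levels: "\<lbrakk>t \<in> I; n \<in> nc_supp \<Xi>; X \<in> level \<Xi> n\<rbrakk> \<Longrightarrow> g t X \<in> level \<Xi> n"
    and g_dsums: "t \<in> I \<Longrightarrow> respects_dsums \<Xi> (g t)"
    and g_cont: "n \<in> nc_supp \<Xi> \<Longrightarrow> continuous_map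
           (prod_topology (top_of_set I) (subtopology (mat_top nrm n) (level \<Xi> n)))
           (subtopology (mat_top nrm n) (level \<Xi> n)) (\<lambda>(t, X). g t X)"
    and C: "C > 0"
    and g_Lipschitz: "\<lbrakk>t \<in> I; n \<in> nc_supp \<Xi>; X \<in> level \<Xi> n; Y \<in> level \<Xi> n\<rbrakk>
           \<Longrightarrow> nrm n (g t X - g t Y) \<le> C * nrm n (X - Y)"
    and d: "d = Gcd (nc_supp \<Xi>)"
begin

lemma level_carrier: "X \<in> level \<Xi> n \<Longrightarrow> X \<in> carrier_mat n n"
  by (simp add: level_def)

lemma supp_pos: "n \<in> nc_supp \<Xi> \<Longrightarrow> n \<ge> 1"
  by (simp add: nc_supp_def)

lemma dsum_level: "X \<in> level \<Xi> n \<Longrightarrow> Y \<in> level \<Xi> m \<Longrightarrow> dsum X Y \<in> level \<Xi> (n + m)"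
  using \<Xi>(1) by (auto simp: nc_set_def level_def dsum_carrier)

lemma supp_add: "n \<in> nc_supp \<Xi> \<Longrightarrow> m \<in> nc_supp \<Xi> \<Longrightarrow> n + m \<in> nc_supp \<Xi>"
  using dsum_level by (fastforce simp: nc_supp_def)

lemma supp_mult: "k \<ge> 1 \<Longrightarrow> n \<in> nc_supp \<Xi> \<Longrightarrow> k * n \<in> nc_supp \<Xi>"
  by (induction k rule: nat_induct_at_least) (auto intro: supp_add)

lemma mem_supp: "X \<in> \<Xi> \<Longrightarrow> \<exists>n\<in>nc_supp \<Xi>. X \<in> level \<Xi> n"
  using \<Xi>(1) by (fastforce simp: nc_set_def nc_space_def nc_supp_def level_def)

lemma supp_nonempty: "nc_supp \<Xi> \<noteq> {}" "0 \<notin> nc_supp \<Xi>"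
  using mem_supp \<Xi>(2) by (auto simp: nc_supp_def)

lemma d_dvd: "n \<in> nc_supp \<Xi> \<Longrightarrow> n div d * d = n"
  using Gcd_dvd[of n "nc_supp \<Xi>"] by (simp add: d)

lemma d_pos: "d \<ge> 1"
  using supp_nonempty d_dvd by (metis One_nat_def Suc_leI all_not_in_conv gr0I mult_0_right)

lemma supp_div_pos: "n \<in> nc_supp \<Xi> \<Longrightarrow> n div d \<ge> 1"
  using d_dvd[of n] supp_pos[of n] by (cases "n div d") auto

lemma copies_level: "k \<ge> 1 \<Longrightarrow> X \<in> level \<Xi> n \<Longrightarrow> copies k X \<in> level \<Xi> (k * n)"
proof (induction k rule: nat_induct_at_least)
  case base
  have "copies 1 X = X" by (simp add: copies_def del: diag_block_mat.simps)
  then show ?case using base by simp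
next
  case (Suc k)
  then show ?case using dsum_level[of X n "copies k X" "k * n"] by (simp add: copies_Suc)
qed

lemma g_dsum:
  "\<lbrakk>t \<in> I; X \<in> level \<Xi> n; Y \<in> level \<Xi> m\<rbrakk> \<Longrightarrow> g t (dsum X Y) = dsum (g t X) (g t Y)"
  using g_dsums by (simp add: respects_dsums_def level_def)

lemma g_copies:
  assumes "t \<in> I" "X \<in> level \<Xi> n" "k \<ge> 1"
  shows "g t (copies k X) = copies k (g t X)"
  using assms(3)
proof (induction k rule: nat_induct_at_least)
  case base
  have "copies 1 X = X" for X :: "'v mat" by (simp add: copies_def del: diag_block_mat.simps)
  then show ?case by simp
next
  case (Suc k)
  then show ?case using g_dsum[OF assms(1,2) copies_level[OF Suc(1) assms(2)]] by (simp add: copies_Suc)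
qed

lemma family_copies:
  assumes "\<And>n. n \<in> nc_supp \<Xi> \<Longrightarrow> A n \<in> level \<Xi> n"
    and "\<And>n m. n \<in> nc_supp \<Xi> \<Longrightarrow> m \<in> nc_supp \<Xi> \<Longrightarrow> A (n + m) = dsum (A n) (A m)"
  obtains X where "X \<in> carrier_mat d d" "\<And>n. n \<in> nc_supp \<Xi> \<Longrightarrow> A n = copies (n div d) X"
  using direct_sum_family_copies[OF supp_add supp_nonempty level_carrier[OF assms(1)] assms(2)]
  unfolding d by blast

text \<open>Closure under direct sums says only that the sum is some \<open>X0n k\<close>; comparing
  sizes identifies k.\<close>

lemma X0n_add:
  assumes n: "n \<in> nc_supp \<Xi>" and m: "m \<in> nc_supp \<Xi>"
  shows "X0n (n + m) = dsum (X0n n) (X0n m)"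
proof -
  have "dsum (X0n n) (X0n m) \<in> X0n ` nc_supp \<Xi>" using X0n(2) n m by (auto simp: nc_set_def)
  then obtain k where k: "k \<in> nc_supp \<Xi>" "dsum (X0n n) (X0n m) = X0n k" by blast
  have "X0n k \<in> carrier_mat (n + m) (n + m)"
    using dsum_carrier[OF level_carrier[OF X0n(1)[OF n]] level_carrier[OF X0n(1)[OF m]]] k by simp
  then have "k = n + m" using level_carrier[OF X0n(1)[OF k(1)]] by auto
  then show ?thesis using k by simp
qed

lemma solution_unique:
  assumes n: "n \<in> nc_supp \<Xi>" and t: "t \<in> I"
    and Y: "ivp_solution smul nrm n I (\<lambda>_. level \<Xi> n) g t0 A Y"
    and Z: "ivp_solution smul nrm n I (\<lambda>_. level \<Xi> n) g t0 A Z"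
  shows "Y t = Z t"
  by (rule mat_ode_unique[OF supp_pos[OF n] I t, where Y' = "\<lambda>s. g s (Y s)" and Z' = "\<lambda>s. g s (Z s)" and C = C])
     (use Y Z C n in \<open>auto simp: ivp_solution_def level_carrier intro: g_Lipschitz\<close>)

lemma solution_exists:
  assumes n: "n \<in> nc_supp \<Xi>"
  obtains Y where "ivp_solution smul nrm n I (\<lambda>_. level \<Xi> n) g t0 (X0n n) Y"
  by (rule mat_ode_exists[OF supp_pos[OF n] I \<Xi>_closed[OF n] X0n(1)[OF n] g_levels[OF _ n] g_cont[OF n]
      g_Lipschitz[OF _ n]]) (use C in auto)

lemma solution_dsum:
  assumes n: "n \<in> nc_supp \<Xi>" and m: "m \<in> nc_supp \<Xi>"
    and Y: "ivp_solution smul nrm n I (\<lambda>_. level \<Xi> n) g t0 (X0n n) Y"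
    and Z: "ivp_solution smul nrm m I (\<lambda>_. level \<Xi> m) g t0 (X0n m) Z"
  shows "ivp_solution smul nrm (n + m) I (\<lambda>_. level \<Xi> (n + m)) g t0 (X0n (n + m)) (\<lambda>t. dsum (Y t) (Z t))"
  unfolding ivp_solution_def
proof (intro conjI ballI)
  have Yl: "Y t \<in> level \<Xi> n" and Zl: "Z t \<in> level \<Xi> m" if "t \<in> I" for t
    using Y Z that by (auto simp: ivp_solution_def)
  show "dsum (Y t0) (Z t0) = X0n (n + m)" using Y Z X0n_add[OF n m] by (simp add: ivp_solution_def)
  fix t assume t: "t \<in> I"
  show "dsum (Y t) (Z t) \<in> level \<Xi> (n + m)" using Yl Zl t by (intro dsum_level)
  show "has_mat_deriv smul nrm (n + m) I (\<lambda>t. dsum (Y t) (Z t)) (g t (dsum (Y t) (Z t))) t"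
    unfolding g_dsum[OF t Yl[OF t] Zl[OF t]]
    using Y Z t by (intro has_mat_deriv_dsum supp_pos[OF n] supp_pos[OF m] level_carrier[OF Yl] level_carrier[OF Zl])
      (auto simp: ivp_solution_def)
qed

text \<open>The velocities again form a family closed under direct sums, because \<open>g\<close> respects these.\<close>

lemma block_solution:
  obtains X0 Xs Ds where
    "X0 \<in> carrier_mat d d" "\<And>n. n \<in> nc_supp \<Xi> \<Longrightarrow> X0n n = copies (n div d) X0"
    "Xs t0 = X0"
    "\<And>t. t \<in> I \<Longrightarrow> Xs t \<in> carrier_mat d d" "\<And>t. t \<in> I \<Longrightarrow> Ds t \<in> carrier_mat d d"
    "\<And>t n. t \<in> I \<Longrightarrow> n \<in> nc_supp \<Xi> \<Longrightarrow> copies (n div d) (Xs t) \<in> level \<Xi> n"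
    "\<And>t n. t \<in> I \<Longrightarrow> n \<in> nc_supp \<Xi> \<Longrightarrow> g t (copies (n div d) (Xs t)) = copies (n div d) (Ds t)"
    "\<And>t. t \<in> I \<Longrightarrow> has_mat_deriv smul nrm d I Xs (Ds t) t"
    "continuous_map (top_of_set I) (mat_top nrm d) Ds"
proof -
  obtain X0 where X0: "X0 \<in> carrier_mat d d" "\<And>n. n \<in> nc_supp \<Xi> \<Longrightarrow> X0n n = copies (n div d) X0"
    using family_copies[of X0n, OF X0n(1) X0n_add] by blast
  have "\<exists>Y. \<forall>n\<in>nc_supp \<Xi>. ivp_solution smul nrm n I (\<lambda>_. level \<Xi> n) g t0 (X0n n) (Y n)"
    using solution_exists by (intro bchoice ballI) blast
  then obtain Y where Y: "\<And>n. n \<in> nc_supp \<Xi> \<Longrightarrow> ivp_solution smul nrm n I (\<lambda>_. level \<Xi> n) g t0 (X0n n) (Y n)"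
    by blast
  have Yl: "Y n t \<in> level \<Xi> n" if "n \<in> nc_supp \<Xi>" "t \<in> I" for n t
    using Y[OF that(1)] that(2) by (simp add: ivp_solution_def)
  have Y_add: "Y (n + m) t = dsum (Y n t) (Y m t)"
    if "n \<in> nc_supp \<Xi>" "m \<in> nc_supp \<Xi>" "t \<in> I" for n m t
    using solution_unique[OF supp_add[OF that(1,2)] that(3) Y[OF supp_add[OF that(1,2)]]
        solution_dsum[OF that(1,2) Y[OF that(1)] Y[OF that(2)]]] .
  \<comment> \<open>Positions and velocities are decomposed separately at each time. The velocity
    block D is not yet known to be the derivative of anything.\<close>
  have "\<exists>X D. X \<in> carrier_mat d d \<and> D \<in> carrier_mat d d \<and>
      (\<forall>n\<in>nc_supp \<Xi>. Y n t = copies (n div d) X \<and> g t (Y n t) = copies (n div d) D)" if t: "t \<in> I" for t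
  proof -
    obtain X where "X \<in> carrier_mat d d" "\<And>n. n \<in> nc_supp \<Xi> \<Longrightarrow> Y n t = copies (n div d) X"
      using family_copies[of "\<lambda>n. Y n t", OF Yl[OF _ t] Y_add[OF _ _ t]] by blast
    moreover obtain D where "D \<in> carrier_mat d d" "\<And>n. n \<in> nc_supp \<Xi> \<Longrightarrow> g t (Y n t) = copies (n div d) D"
    proof (rule family_copies[of "\<lambda>n. g t (Y n t)"])
      show "n \<in> nc_supp \<Xi> \<Longrightarrow> g t (Y n t) \<in> level \<Xi> n" for n by (rule g_levels[OF t _ Yl[OF _ t]])
      show "g t (Y (n + m) t) = dsum (g t (Y n t)) (g t (Y m t))"
        if "n \<in> nc_supp \<Xi>" "m \<in> nc_supp \<Xi>" for n m
        unfolding Y_add[OF that t] by (rule g_dsum[OF t Yl[OF that(1) t] Yl[OF that(2) t]])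
    qed blast
    ultimately show ?thesis by blast
  qed
  then obtain Xs Ds where Xs: "\<And>t. t \<in> I \<Longrightarrow> Xs t \<in> carrier_mat d d" and Ds: "\<And>t. t \<in> I \<Longrightarrow> Ds t \<in> carrier_mat d d"
    and YX: "\<And>t n. t \<in> I \<Longrightarrow> n \<in> nc_supp \<Xi> \<Longrightarrow> Y n t = copies (n div d) (Xs t)"
    and YD: "\<And>t n. t \<in> I \<Longrightarrow> n \<in> nc_supp \<Xi> \<Longrightarrow> g t (Y n t) = copies (n div d) (Ds t)"
    by metis
  \<comment> \<open>A single supported size suffices to determine the block: initial value,
    derivative and continuity of the derivative are pulled back along the isometry
    \<open>copies (N div d)\<close>.\<close>
  obtain N where N: "N \<in> nc_supp \<Xi>" using supp_nonempty by blast
  have iso: "mat_isometry d N (copies (N div d))"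
    using copies_isometry[OF d_pos supp_div_pos[OF N]] by (simp add: d_dvd[OF N])
  have dY: "has_mat_deriv smul nrm N I (Y N) (g t (Y N t)) t" if "t \<in> I" for t
    using Y[OF N] that by (simp add: ivp_solution_def)
  have init: "Xs t0 = X0"
  proof (rule mat_isometry_inject[OF d_pos supp_pos[OF N] iso Xs[OF I(2)] X0(1)])
    show "copies (N div d) (Xs t0) = copies (N div d) X0"
      using YX[OF I(2) N] X0(2)[OF N] Y[OF N] by (simp add: ivp_solution_def)
  qed
  have der: "has_mat_deriv smul nrm d I Xs (Ds t) t" if t: "t \<in> I" for t
  proof -
    have "has_mat_deriv smul nrm N I (\<lambda>s. copies (N div d) (Xs s)) (g t (Y N t)) t"
      by (rule has_mat_deriv_transform[OF _ t dY[OF t]]) (rule YX[OF _ N])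
    then show ?thesis
      unfolding YD[OF t N] using has_mat_deriv_isometry[where Y = Xs, OF d_pos supp_pos[OF N] iso Xs Ds[OF t] t] by simp
  qed
  have cont: "continuous_map (top_of_set I) (mat_top nrm d) Ds"
  proof -
    have "continuous_map (top_of_set I) (mat_top nrm N) (Y N)"
      by (rule continuous_map_of_has_mat_deriv[OF supp_pos[OF N] level_carrier[OF Yl[OF N]] dY])
    then have "continuous_map (top_of_set I) (subtopology (mat_top nrm N) (level \<Xi> N)) (Y N)"
      using Yl[OF N] by (auto simp: continuous_map_in_subtopology)
    then have "continuous_map (top_of_set I)
        (prod_topology (top_of_set I) (subtopology (mat_top nrm N) (level \<Xi> N))) (\<lambda>t. (t, Y N t))"
      by (intro continuous_map_pairedI) auto
    from continuous_map_compose[OF this g_cont[OF N]]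
    have "continuous_map (top_of_set I) (mat_top nrm N) (\<lambda>t. g t (Y N t))"
      by (simp add: o_def continuous_map_in_subtopology)
    then have "continuous_map (top_of_set I) (mat_top nrm N) (\<lambda>t. copies (N div d) (Ds t))"
      by (rule continuous_map_eq) (simp add: YD[OF _ N])
    then show ?thesis
      using Ds by (subst (asm) continuous_map_isometry[OF d_pos supp_pos[OF N] iso]) auto
  qed
  have lev: "copies (n div d) (Xs t) \<in> level \<Xi> n" if "t \<in> I" "n \<in> nc_supp \<Xi>" for t n
    using Yl[OF that(2,1)] YX[OF that] by simp
  have vel: "g t (copies (n div d) (Xs t)) = copies (n div d) (Ds t)" if "t \<in> I" "n \<in> nc_supp \<Xi>" for t n
    using YD[OF that] YX[OF that] by simp
  show thesis by (rule that[OF X0 init Xs Ds lev vel der cont])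
qed

end

text \<open>
  The size \<open>K * d\<close> is some member of the support. The condition on \<open>\<rho>\<close> says that it permutes whole
  \<open>d\<close> by \<open>d\<close> blocks; this places every \<open>copies k (Xs t)\<close> into each of the linear pieces that make up
  a level of the extended set.
\<close>

locale nc_ode_sim = nc_ode smul nrm I t0 \<Xi> X0n g C d
  for smul :: "'f::real_normed_field \<Rightarrow> 'v::ab_group_add \<Rightarrow> 'v" and nrm I t0 \<Xi> X0n g C d +
  fixes K :: nat
  assumes K: "K * d \<in> nc_supp \<Xi>"
    and sim: "t \<in> I \<Longrightarrow> respects_similarities smul \<Xi> (g t)"
begin

section \<open>The extended set and the extended map\<close>

definition block_map :: "nat \<Rightarrow> (nat \<Rightarrow> nat \<times> nat) \<Rightarrow> bool" where
  "block_map n \<rho> \<longleftrightarrow>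
     bij_betw \<rho> {..<n * K} ({..<n} \<times> {..<K}) \<and>
     (\<forall>a<n * K. fst (\<rho> a) mod d = a mod d) \<and>
     (\<forall>a<n * K. \<forall>b<n * K. a div d = b div d \<longleftrightarrow>
        snd (\<rho> a) = snd (\<rho> b) \<and> fst (\<rho> a) div d = fst (\<rho> b) div d)"

definition ext_set :: "'v mat set" where
  "ext_set = {X. \<exists>k\<ge>1. X \<in> carrier_mat (k * d) (k * d) \<and>
     (\<exists>\<rho>. block_map (k * d) \<rho> \<and> amp (k * d) K \<rho> X \<in> \<Xi>)}"

text \<open>The size is recovered from X as \<open>dim_row X\<close>. On the extended set the choice
  is determined, because any admissible arrangement leads to the same Z; elsewhere the value is
  arbitrary.\<close>

definition ext_map :: "real \<Rightarrow> 'v mat \<Rightarrow> 'v mat" where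
  "ext_map t X = (SOME Z. Z \<in> carrier_mat (dim_row X) (dim_row X) \<and>
     (\<exists>\<rho>. block_map (dim_row X) \<rho> \<and> amp (dim_row X) K \<rho> X \<in> \<Xi> \<and>
        g t (amp (dim_row X) K \<rho> X) = amp (dim_row X) K \<rho> Z))"

lemma K_pos: "K \<ge> 1"
  using supp_pos[OF K] by (cases K) auto

lemma supp_amp: "k \<ge> 1 \<Longrightarrow> k * d * K \<in> nc_supp \<Xi>"
  using supp_mult[OF _ K, of k] by (simp add: ac_simps)

lemma ext_setI:
  "\<lbrakk>k \<ge> 1; X \<in> carrier_mat (k * d) (k * d); block_map (k * d) \<rho>; amp (k * d) K \<rho> X \<in> \<Xi>\<rbrakk> \<Longrightarrow> X \<in> ext_set"
  unfolding ext_set_def by blast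

lemma level_ext_set:
  assumes "k \<ge> 1"
  shows "level ext_set (k * d) =
    {X \<in> carrier_mat (k * d) (k * d). \<exists>\<rho>. block_map (k * d) \<rho> \<and> amp (k * d) K \<rho> X \<in> \<Xi>}"
proof -
  have "l = k" if "X \<in> carrier_mat (l * d) (l * d)" "X \<in> carrier_mat (k * d) (k * d)" for l and X :: "'v mat"
  proof -
    have "l * d = k * d" using carrier_matD(1)[OF that(1)] carrier_matD(1)[OF that(2)] by metis
    then show ?thesis using d_pos mult_right_cancel[of d l k] by linarith
  qed
  then show ?thesis using assms unfolding level_def ext_set_def by blast
qed

lemma amp_level: "amp n K \<rho> X \<in> \<Xi> \<Longrightarrow> amp n K \<rho> X \<in> level \<Xi> (n * K)"
  by (simp add: level_def)

lemma level_ext_setE: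
  assumes "k \<ge> 1" "X \<in> level ext_set (k * d)"
  obtains \<rho> where "X \<in> carrier_mat (k * d) (k * d)" "block_map (k * d) \<rho>"
    "amp (k * d) K \<rho> X \<in> level \<Xi> (k * d * K)"
  using assms(2) amp_level unfolding level_ext_set[OF assms(1)] by blast

text \<open>In the standard arrangement, dividing the block number of a position by k gives the
  number of the copy as quotient and the block within that copy as remainder.\<close>

lemma block_map_mod_div: "k \<ge> 1 \<Longrightarrow> block_map (k * d) (\<lambda>a. (a mod (k * d), a div (k * d)))"
proof -
  assume k: "k \<ge> 1"
  have 1: "a div (k * d) = a div d div k" for a by (simp add: div_mult2_eq mult.commute[of k])
  have 2: "a mod (k * d) div d = a div d mod k" for a
    using d_pos by (simp add: mod_mult2_eq mult.commute[of k])
  have "a div d = b div d \<longleftrightarrow> a div d div k = b div d div k \<and> a div d mod k = b div d mod k" for a b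
    by (metis div_mult_mod_eq)
  then show ?thesis unfolding block_map_def
    using k d_pos bij_betw_mod_div[of "k * d" K] by (simp add: 1 2 mod_mod_cancel)
qed

lemma subset_ext_set: "\<Xi> \<subseteq> ext_set"
proof
  fix X assume X: "X \<in> \<Xi>"
  obtain n where n: "n \<in> nc_supp \<Xi>" "X \<in> level \<Xi> n" using mem_supp[OF X] by blast
  define k where "k = n div d"
  have k: "n = k * d" "k \<ge> 1" using d_dvd[OF n(1)] supp_div_pos[OF n(1)] by (auto simp: k_def)
  have Xc: "X \<in> carrier_mat (k * d) (k * d)" using level_carrier[OF n(2)] k by simp
  have "copies K X \<in> \<Xi>" using copies_level[OF K_pos n(2)] by (simp add: level_def)
  then show "X \<in> ext_set"
    by (intro ext_setI[OF k(2) Xc block_map_mod_div[OF k(2)]]) (simp add: amp_mod_div[OF Xc])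
qed

text \<open>Puts every multiple of \<open>d\<close> into the support and makes all fibers nonempty.
  Its amplification is again zero, which lies in \<open>\<Xi>\<close> because the level of size
  \<open>k * d * K\<close> is a subspace.\<close>

lemma zero_mem_level_ext_set:
  assumes k: "k \<ge> 1"
  shows "0\<^sub>m (k * d) (k * d) \<in> level ext_set (k * d)"
proof -
  let ?\<rho> = "\<lambda>a. (a mod (k * d), a div (k * d))"
  have "amp (k * d) K ?\<rho> (0\<^sub>m (k * d) (k * d)) = (0\<^sub>m (k * d * K) (k * d * K) :: 'v mat)"
    using k d_pos by (intro eq_matI) (auto simp: amp_def)
  then have "amp (k * d) K ?\<rho> (0\<^sub>m (k * d) (k * d)) \<in> \<Xi>"
    using \<Xi>_closed[OF supp_amp[OF k]] by (simp add: closed_mat_subspace_def level_def)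
  then show ?thesis using block_map_mod_div[OF k] unfolding level_ext_set[OF k] by auto
qed

lemma nc_supp_ext_set: "nc_supp ext_set = {d * k | k. k \<ge> 1}"
proof (intro subset_antisym subsetI)
  fix n assume "n \<in> nc_supp ext_set"
  then obtain X where X: "X \<in> ext_set" "X \<in> carrier_mat n n"
    unfolding nc_supp_def level_def by auto
  obtain k where k: "k \<ge> 1" "X \<in> carrier_mat (k * d) (k * d)" using X(1) unfolding ext_set_def by auto
  have "n = d * k" using carrier_matD(1)[OF X(2)] carrier_matD(1)[OF k(2)] by (metis mult.commute)
  then show "n \<in> {d * k | k. k \<ge> 1}" using k(1) by auto
next
  fix n assume "n \<in> {d * k | k. k \<ge> 1}"
  then obtain k where k: "n = k * d" "k \<ge> 1" by (auto simp: mult.commute)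
  then show "n \<in> nc_supp ext_set"
    using zero_mem_level_ext_set[OF k(2)] d_pos unfolding nc_supp_def by auto
qed

text \<open>The direct sum of the two amplifications lies in \<open>\<Xi>\<close> and is itself an
  amplification of \<open>dsum X Y\<close>: the p-th copy of the sum consists of the p-th copies of
  X and of Y, which sit apart in the two halves.\<close>

lemma dsum_mem_ext_set:
  assumes "X \<in> ext_set" "Y \<in> ext_set"
  shows "dsum X Y \<in> ext_set"
proof -
  obtain k \<rho> where k: "k \<ge> 1" "X \<in> carrier_mat (k * d) (k * d)" "block_map (k * d) \<rho>" "amp (k * d) K \<rho> X \<in> \<Xi>"
    using assms(1) unfolding ext_set_def by blast
  obtain l \<rho>' where l: "l \<ge> 1" "Y \<in> carrier_mat (l * d) (l * d)" "block_map (l * d) \<rho>'" "amp (l * d) K \<rho>' Y \<in> \<Xi>"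
    using assms(2) unfolding ext_set_def by blast
  let ?n = "k * d" and ?m = "l * d"
  \<comment> \<open>Positions of the second half carry indices of Y, which come after the
    \<open>?n\<close> indices of X; the number of the copy is kept.\<close>
  define \<tau> where "\<tau> a = (if a < ?n * K then \<rho> a else (?n + fst (\<rho>' (a - ?n * K)), snd (\<rho>' (a - ?n * K))))" for a
  have \<tau>1: "\<tau> a = \<rho> a" if "a < ?n * K" for a using that by (simp add: \<tau>_def)
  have \<tau>2: "\<tau> (?n * K + a) = (?n + fst (\<rho>' a), snd (\<rho>' a))" for a by (simp add: \<tau>_def)
  have \<rho>_bij: "bij_betw \<rho> {..<?n * K} ({..<?n} \<times> {..<K})" and \<rho>'_bij: "bij_betw \<rho>' {..<?m * K} ({..<?m} \<times> {..<K})"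
    using k l by (auto simp: block_map_def)
  have \<rho>_lt: "fst (\<rho> a) < ?n" "snd (\<rho> a) < K" if "a < ?n * K" for a
    using bij_betwE[OF \<rho>_bij] that by (auto simp: mem_Times_iff)
  have \<rho>'_lt: "fst (\<rho>' a) < ?m" "snd (\<rho>' a) < K" if "a < ?m * K" for a
    using bij_betwE[OF \<rho>'_bij] that by (auto simp: mem_Times_iff)
  have split: "(\<exists>a'<?n * K. a = a') \<or> (\<exists>a'<?m * K. a = ?n * K + a')" if "a < (k + l) * d * K" for a
  proof (cases "a < ?n * K")
    case False
    then have "a - ?n * K < ?m * K" "a = ?n * K + (a - ?n * K)" using that by (auto simp: algebra_simps)
    then show ?thesis by blast
  qed blast
  have \<tau>_bij: "bij_betw \<tau> {..<(k + l) * d * K} ({..<(k + l) * d} \<times> {..<K})"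
  proof -
    have inj: "inj_on \<tau> {..<(k + l) * d * K}"
    proof (rule inj_onI)
      fix a b assume ab: "a \<in> {..<(k + l) * d * K}" "b \<in> {..<(k + l) * d * K}" "\<tau> a = \<tau> b"
      have \<rho>_inj: "a = b" if "\<rho> a = \<rho> b" "a < ?n * K" "b < ?n * K" for a b
        using \<rho>_bij that by (auto simp: bij_betw_def inj_on_def)
      have \<rho>'_inj: "a = b" if "\<rho>' a = \<rho>' b" "a < ?m * K" "b < ?m * K" for a b
        using \<rho>'_bij that by (auto simp: bij_betw_def inj_on_def)
      consider (1) "a < ?n * K" "b < ?n * K"
        | (2) b' where "a < ?n * K" "b' < ?m * K" "b = ?n * K + b'"
        | (3) a' where "b < ?n * K" "a' < ?m * K" "a = ?n * K + a'"
        | (4) a' b' where "a' < ?m * K" "b' < ?m * K" "a = ?n * K + a'" "b = ?n * K + b'"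
        using split[of a] split[of b] ab by auto
      then show "a = b"
      proof cases
        case 1
        then show ?thesis using ab(3) \<rho>_inj by (simp add: \<tau>1)
      next
        case 2
        then show ?thesis
          using arg_cong[OF ab(3), where f = fst] \<rho>_lt(1)[OF 2(1)] by (simp add: \<tau>1 \<tau>2)
      next
        case 3
        then show ?thesis
          using arg_cong[OF ab(3), where f = fst] \<rho>_lt(1)[OF 3(1)] by (simp add: \<tau>1 \<tau>2)
      next
        case 4
        then show ?thesis using ab(3) \<rho>'_inj[of a' b'] by (simp add: \<tau>2 prod_eq_iff)
      qed
    qed
    \<comment> \<open>Surjectivity follows by counting, since the map is injective between finite
      sets of equal size.\<close>
    have "\<tau> a \<in> {..<(k + l) * d} \<times> {..<K}" if "a < (k + l) * d * K" for a
      using split[OF that] \<rho>_lt \<rho>'_lt by (fastforce simp: \<tau>1 \<tau>2 mem_Times_iff add_mult_distrib)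
    then have "\<tau> ` {..<(k + l) * d * K} \<subseteq> {..<(k + l) * d} \<times> {..<K}" by (intro image_subsetI) simp
    moreover have "card (\<tau> ` {..<(k + l) * d * K}) = card ({..<(k + l) * d} \<times> {..<K})"
      using card_image[OF inj] by simp
    ultimately have "\<tau> ` {..<(k + l) * d * K} = {..<(k + l) * d} \<times> {..<K}"
      by (intro card_subset_eq) auto
    then show ?thesis using inj by (simp add: bij_betw_def)
  qed
  have nK: "(?n * K + a) div d = k * K + a div d" "(?n * K + a) mod d = a mod d" for a
  proof -
    \<comment> \<open>The second half begins at a multiple of d, so passing to it keeps residues and
      adds \<open>k * K\<close> to block numbers.\<close>
    have "?n * K = k * K * d" by (simp add: ac_simps)
    show "(?n * K + a) div d = k * K + a div d" "(?n * K + a) mod d = a mod d"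
      unfolding \<open>?n * K = k * K * d\<close> using d_pos by simp_all
  qed
  have lt_nK: "a div d < k * K" if "a < ?n * K" for a
    using that d_pos by (simp add: div_less_iff_less_mult ac_simps)
  have fst_div: "fst (\<rho> a) div d < k" if "a < ?n * K" for a
    using \<rho>_lt(1)[OF that] d_pos by (simp add: div_less_iff_less_mult)
  have blk: "block_map ((k + l) * d) \<tau>"
    unfolding block_map_def
  proof (intro conjI allI impI)
    show "bij_betw \<tau> {..<(k + l) * d * K} ({..<(k + l) * d} \<times> {..<K})" by (rule \<tau>_bij)
    show "fst (\<tau> a) mod d = a mod d" if "a < (k + l) * d * K" for a
      using split[OF that] k(3) l(3) by (auto simp: \<tau>1 \<tau>2 block_map_def nK)
    fix a b assume a: "a < (k + l) * d * K" and b: "b < (k + l) * d * K"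
    consider (1) "a < ?n * K" "b < ?n * K"
      | (2) b' where "a < ?n * K" "b' < ?m * K" "b = ?n * K + b'"
      | (3) a' where "b < ?n * K" "a' < ?m * K" "a = ?n * K + a'"
      | (4) a' b' where "a' < ?m * K" "b' < ?m * K" "a = ?n * K + a'" "b = ?n * K + b'"
      using split[OF a] split[OF b] by auto
    then show "a div d = b div d \<longleftrightarrow> snd (\<tau> a) = snd (\<tau> b) \<and> fst (\<tau> a) div d = fst (\<tau> b) div d"
    proof cases
      case 1
      then show ?thesis using k(3) by (auto simp: \<tau>1 block_map_def)
    next
      case 2
      then show ?thesis using lt_nK[OF 2(1)] fst_div[OF 2(1)] d_pos by (simp add: \<tau>1 \<tau>2 nK)
    next
      case 3
      then show ?thesis using lt_nK[OF 3(1)] fst_div[OF 3(1)] d_pos by (simp add: \<tau>1 \<tau>2 nK)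
    next
      case 4
      then show ?thesis using l(3) d_pos by (simp add: \<tau>2 nK block_map_def)
    qed
  qed
  have XY: "dsum X Y \<in> carrier_mat ((k + l) * d) ((k + l) * d)"
    using dsum_carrier[OF k(2) l(2)] by (simp add: add_mult_distrib)
  have amp_dsum: "amp ((k + l) * d) K \<tau> (dsum X Y) = dsum (amp ?n K \<rho> X) (amp ?m K \<rho>' Y)"
  proof (rule eq_matI)
    have size: "(k + l) * d * K = ?n * K + ?m * K" by (simp add: algebra_simps)
    have car: "dsum (amp ?n K \<rho> X) (amp ?m K \<rho>' Y) \<in> carrier_mat (?n * K + ?m * K) (?n * K + ?m * K)"
      by (intro dsum_carrier) simp_all
    show "dim_row (amp ((k + l) * d) K \<tau> (dsum X Y)) = dim_row (dsum (amp ?n K \<rho> X) (amp ?m K \<rho>' Y))"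
      "dim_col (amp ((k + l) * d) K \<tau> (dsum X Y)) = dim_col (dsum (amp ?n K \<rho> X) (amp ?m K \<rho>' Y))"
      unfolding carrier_matD[OF car] by (simp_all add: size)
    fix a b assume "a < dim_row (dsum (amp ?n K \<rho> X) (amp ?m K \<rho>' Y))" "b < dim_col (dsum (amp ?n K \<rho> X) (amp ?m K \<rho>' Y))"
    then have ab: "a < ?n * K + ?m * K" "b < ?n * K + ?m * K" unfolding carrier_matD[OF car] by auto
    then have ab': "a < (k + l) * d * K" "b < (k + l) * d * K" by (simp_all only: size)
    have \<tau>_lt: "fst (\<tau> c) < ?n + ?m" if "c < (k + l) * d * K" for c
      using bij_betwE[OF \<tau>_bij] that by (auto simp: mem_Times_iff add_mult_distrib)
    have amp_ab: "amp ((k + l) * d) K \<tau> (dsum X Y) $$ (a, b) =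
        (if snd (\<tau> a) = snd (\<tau> b) then
          (if fst (\<tau> a) < ?n then (if fst (\<tau> b) < ?n then X $$ (fst (\<tau> a), fst (\<tau> b)) else 0)
           else (if fst (\<tau> b) < ?n then 0 else Y $$ (fst (\<tau> a) - ?n, fst (\<tau> b) - ?n))) else 0)"
      unfolding amp_index[OF ab'] dsum_index[OF k(2) l(2) \<tau>_lt[OF ab'(1)] \<tau>_lt[OF ab'(2)]] ..
    consider (1) "a < ?n * K" "b < ?n * K"
      | (2) b' where "a < ?n * K" "b' < ?m * K" "b = ?n * K + b'"
      | (3) a' where "b < ?n * K" "a' < ?m * K" "a = ?n * K + a'"
      | (4) a' b' where "a' < ?m * K" "b' < ?m * K" "a = ?n * K + a'" "b = ?n * K + b'"
      using split[OF ab'(1)] split[OF ab'(2)] by auto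
    then show "amp ((k + l) * d) K \<tau> (dsum X Y) $$ (a, b) = dsum (amp ?n K \<rho> X) (amp ?m K \<rho>' Y) $$ (a, b)"
      unfolding amp_ab dsum_index[OF amp_carrier amp_carrier ab]
      by cases (simp_all add: \<tau>1 \<tau>2 \<rho>_lt amp_index)
  qed
  have "dsum (amp ?n K \<rho> X) (amp ?m K \<rho>' Y) \<in> \<Xi>"
    using k(4) l(4) \<Xi>(1) by (simp add: nc_set_def)
  then have "amp ((k + l) * d) K \<tau> (dsum X Y) \<in> \<Xi>" unfolding amp_dsum .
  moreover have "k + l \<ge> 1" using k(1) by simp
  ultimately show ?thesis using XY blk by (intro ext_setI)
qed

lemma nc_set_ext_set: "nc_set ext_set"
proof -
  have "ext_set \<subseteq> nc_space"
  proof
    fix X assume "X \<in> ext_set"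
    then obtain k where "k \<ge> 1" "X \<in> carrier_mat (k * d) (k * d)" unfolding ext_set_def by blast
    moreover from this have "k * d \<ge> 1" using d_pos by simp
    ultimately show "X \<in> nc_space" unfolding nc_space_def by blast
  qed
  then show ?thesis using dsum_mem_ext_set by (simp add: nc_set_def)
qed

text \<open>The chosen value comes with some arrangement of its own; independence of the arrangement
  then transfers the identity to every admissible \<open>\<rho>\<close>.\<close>

lemma ext_map:
  assumes t: "t \<in> I" and k: "k \<ge> 1" and X: "X \<in> carrier_mat (k * d) (k * d)"
    and \<rho>: "block_map (k * d) \<rho>" "amp (k * d) K \<rho> X \<in> \<Xi>"
  shows "ext_map t X \<in> carrier_mat (k * d) (k * d)"
    and "g t (amp (k * d) K \<rho> X) = amp (k * d) K \<rho> (ext_map t X)"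
proof -
  let ?n = "k * d"
  have n: "?n \<ge> 1" using k d_pos by simp
  have row: "dim_row X = ?n" using X by simp
  let ?P = "\<lambda>Z. Z \<in> carrier_mat ?n ?n \<and>
     (\<exists>\<rho>. block_map ?n \<rho> \<and> amp ?n K \<rho> X \<in> \<Xi> \<and> g t (amp ?n K \<rho> X) = amp ?n K \<rho> Z)"
  have bij: "bij_betw \<rho> {..<?n * K} ({..<?n} \<times> {..<K})" if "block_map ?n \<rho>" for \<rho>
    using that by (simp add: block_map_def)
  have "g t (amp ?n K \<rho> X) \<in> carrier_mat (?n * K) (?n * K)"
    by (rule level_carrier[OF g_levels[OF t supp_amp[OF k] amp_level[OF \<rho>(2)]]])
  then obtain Z where "Z \<in> carrier_mat ?n ?n" "g t (amp ?n K \<rho> X) = amp ?n K \<rho> Z"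
    by (rule respects_similarities_amp[OF sim[OF t] n K_pos bij[OF \<rho>(1)] X \<rho>(2)])
  then have "?P Z" using \<rho> by blast
  then have P: "?P (ext_map t X)" unfolding ext_map_def row by (rule someI)
  then show "ext_map t X \<in> carrier_mat ?n ?n" by blast
  obtain \<rho>' where \<rho>': "block_map ?n \<rho>'" "amp ?n K \<rho>' X \<in> \<Xi>" "g t (amp ?n K \<rho>' X) = amp ?n K \<rho>' (ext_map t X)"
    using P by blast
  show "g t (amp ?n K \<rho> X) = amp ?n K \<rho> (ext_map t X)"
    by (rule respects_similarities_amp_independent[OF sim[OF t] n K_pos bij[OF \<rho>'(1)] bij[OF \<rho>(1)] X \<rho>'(2) \<rho>(2) \<rho>'(3)])
qed

text \<open>The arrangement that places X also places its image, because \<open>g\<close> preserves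
  the level of \<open>\<Xi>\<close>.\<close>

lemma ext_map_level:
  assumes t: "t \<in> I" and k: "k \<ge> 1" and X: "X \<in> level ext_set (k * d)"
  shows "ext_map t X \<in> level ext_set (k * d)"
proof -
  obtain \<rho> where \<rho>: "X \<in> carrier_mat (k * d) (k * d)" "block_map (k * d) \<rho>"
    "amp (k * d) K \<rho> X \<in> level \<Xi> (k * d * K)"
    using level_ext_setE[OF k X] by blast
  then have mem: "amp (k * d) K \<rho> X \<in> \<Xi>" by (simp add: level_def)
  note ext = ext_map[OF t k \<rho>(1,2) mem]
  have "amp (k * d) K \<rho> (ext_map t X) \<in> \<Xi>"
    using g_levels[OF t supp_amp[OF k] \<rho>(3)] unfolding ext(2) by (simp add: level_def)
  then show ?thesis using ext(1) \<rho>(2) unfolding level_ext_set[OF k] by blast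
qed

text \<open>In the standard arrangement the amplification is \<open>copies K X\<close>. Since
  \<open>g\<close> respects direct sums it acts there copy by copy, and injectivity of the
  amplification compares the blocks.\<close>

lemma ext_map_extends:
  assumes t: "t \<in> I" and n: "n \<in> nc_supp \<Xi>" and X: "X \<in> level \<Xi> n"
  shows "ext_map t X = g t X"
proof -
  define k where "k = n div d"
  have k: "n = k * d" "k \<ge> 1" using d_dvd[OF n] supp_div_pos[OF n] by (auto simp: k_def)
  have Xc: "X \<in> carrier_mat (k * d) (k * d)" and gX: "g t X \<in> carrier_mat (k * d) (k * d)"
    using level_carrier[OF X] level_carrier[OF g_levels[OF t n X]] k by auto
  let ?\<rho> = "\<lambda>a. (a mod (k * d), a div (k * d))"
  have "amp (k * d) K ?\<rho> X \<in> \<Xi>"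
    using copies_level[OF K_pos X] by (simp add: amp_mod_div[OF Xc] level_def)
  note ext = ext_map[OF t k(2) Xc block_map_mod_div[OF k(2)] this]
  have "amp (k * d) K ?\<rho> (ext_map t X) = amp (k * d) K ?\<rho> (g t X)"
    using ext(2) g_copies[OF t X K_pos] by (simp add: amp_mod_div[OF Xc] amp_mod_div[OF gX])
  then show ?thesis
    using k(2) d_pos by (intro amp_inject[OF bij_betw_mod_div K_pos ext(1) gX]) auto
qed

text \<open>The diagonal blocks of \<open>copies k X\<close> all equal X, and a block map moves
  whole blocks without disturbing their interior, so the permutation leaves no trace. The block
  condition on \<open>\<rho>\<close> is designed for this.\<close>

lemma amp_copies:
  assumes k: "k \<ge> 1" and \<rho>: "block_map (k * d) \<rho>" and X: "X \<in> carrier_mat d d"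
  shows "amp (k * d) K \<rho> (copies k X) = copies (k * K) X"
proof (rule eq_matI)
  have car: "copies (k * K) X \<in> carrier_mat (k * d * K) (k * d * K)"
    using copies_carrier[OF X, of "k * K"] by (simp add: ac_simps)
  then show "dim_row (amp (k * d) K \<rho> (copies k X)) = dim_row (copies (k * K) X)"
    "dim_col (amp (k * d) K \<rho> (copies k X)) = dim_col (copies (k * K) X)" by simp_all
  fix a b assume "a < dim_row (copies (k * K) X)" "b < dim_col (copies (k * K) X)"
  then have ab: "a < k * d * K" "b < k * d * K" using car by auto
  have lt: "fst (\<rho> c) < k * d" if "c < k * d * K" for c
    using \<rho> bij_betwE that unfolding block_map_def by (fastforce simp: mem_Times_iff)
  have blk: "a div d = b div d \<longleftrightarrow> snd (\<rho> a) = snd (\<rho> b) \<and> fst (\<rho> a) div d = fst (\<rho> b) div d"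
    "fst (\<rho> a) mod d = a mod d" "fst (\<rho> b) mod d = b mod d"
    using \<rho> ab unfolding block_map_def by blast+
  have "amp (k * d) K \<rho> (copies k X) $$ (a, b) = (if a div d = b div d then X $$ (a mod d, b mod d) else 0)"
    unfolding amp_index[OF ab] copies_index[OF X lt[OF ab(1)] lt[OF ab(2)]] blk by auto
  moreover have "copies (k * K) X $$ (a, b) = (if a div d = b div d then X $$ (a mod d, b mod d) else 0)"
    using ab by (intro copies_index[OF X]) (simp_all add: ac_simps)
  ultimately show "amp (k * d) K \<rho> (copies k X) $$ (a, b) = copies (k * K) X $$ (a, b)" by simp
qed

lemma total_top_ext_set:
  "total_top nrm I (\<lambda>_. ext_set) n =
     prod_topology (top_of_set I) (subtopology (mat_top nrm n) (level ext_set n))"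
proof -
  have "(SIGMA t:I. level ext_set n) = I \<times> level ext_set n" by simp
  then show ?thesis
    unfolding total_top_def by (simp add: subtopology_Times subtopology_subtopology)
qed

text \<open>On the piece belonging to \<open>\<rho>\<close>, the extended map followed by the
  isometry \<open>amp n K \<rho>\<close> is \<open>g\<close> composed with that isometry. Continuity
  there is inherited from \<open>g\<close> and pulled back, and closed pasting joins the
  pieces.\<close>

lemma continuous_ext_map:
  assumes k: "k \<ge> 1"
  shows "continuous_map (total_top nrm I (\<lambda>_. ext_set) (k * d)) (mat_top nrm (k * d)) (\<lambda>(t, X). ext_map t X)"
proof -
  let ?n = "k * d"
  let ?E = "total_top nrm I (\<lambda>_. ext_set) ?n"
  have n: "?n \<ge> 1" "?n * K \<ge> 1" using k d_pos K_pos by auto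
  have E: "topspace ?E = I \<times> level ext_set ?n"
    unfolding total_top_ext_set using topspace_mat_top[OF n(1)] by (auto simp: level_def)
  have sub: "level ext_set ?n \<subseteq> carrier_mat ?n ?n" by (auto simp: level_def)
  \<comment> \<open>Only values on the finite index range matter; extensional functions on it form a
    finite set, as closed pasting requires.\<close>
  define R where "R = {\<rho> \<in> {..<?n * K} \<rightarrow>\<^sub>E {..<?n} \<times> {..<K}. block_map ?n \<rho>}"
  define P where "P \<rho> = {e \<in> topspace ?E. amp ?n K \<rho> (snd e) \<in> level \<Xi> (?n * K)}" for \<rho>
  have "finite ({..<?n * K} \<rightarrow>\<^sub>E {..<?n} \<times> {..<K})" by (intro finite_PiE) auto
  then have finR: "finite R" unfolding R_def by (rule rev_finite_subset) blast
  have snd_cont: "continuous_map ?E (mat_top nrm ?n) snd"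
    unfolding total_top_ext_set by (metis continuous_map_in_subtopology continuous_map_snd)
  have fst_cont: "continuous_map ?E (top_of_set I) fst"
    unfolding total_top_ext_set by (rule continuous_map_fst)
  have amp_cont: "continuous_map ?E (mat_top nrm (?n * K)) (\<lambda>e. amp ?n K \<rho> (snd e))" if "\<rho> \<in> R" for \<rho>
  proof -
    have "mat_isometry ?n (?n * K) (amp ?n K \<rho>)"
      using that by (intro amp_isometry n K_pos) (simp add: R_def block_map_def)
    then show ?thesis using snd_cont E sub by (subst continuous_map_isometry[OF n]) auto
  qed
  show ?thesis
  proof (rule pasting_lemma_closed[OF finR, where T = P and f = "\<lambda>_. \<lambda>(t, X). ext_map t X"])
    fix \<rho> assume \<rho>: "\<rho> \<in> R"
    have bij: "bij_betw \<rho> {..<?n * K} ({..<?n} \<times> {..<K})" and blk: "block_map ?n \<rho>"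
      using \<rho> by (auto simp: R_def block_map_def)
    have iso: "mat_isometry ?n (?n * K) (amp ?n K \<rho>)" by (rule amp_isometry[OF n(1) K_pos bij])
    have "closedin (mat_top nrm (?n * K)) (level \<Xi> (?n * K))"
      using \<Xi>_closed[OF supp_amp[OF k]] by (simp add: closed_mat_subspace_def)
    then show "closedin ?E (P \<rho>)"
      unfolding P_def by (rule closedin_continuous_map_preimage[OF amp_cont[OF \<rho>]])
    let ?S = "subtopology ?E (P \<rho>)"
    have S: "topspace ?S = P \<rho>" using P_def by auto
    have mem: "t \<in> I" "X \<in> carrier_mat ?n ?n" "amp ?n K \<rho> X \<in> \<Xi>" if "(t, X) \<in> P \<rho>" for t X
      using that sub by (auto simp: P_def E level_def)
    have "continuous_map ?S (subtopology (mat_top nrm (?n * K)) (level \<Xi> (?n * K))) (\<lambda>e. amp ?n K \<rho> (snd e))"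
      unfolding continuous_map_in_subtopology
      using continuous_map_from_subtopology[OF amp_cont[OF \<rho>]] by (auto simp: P_def)
    then have "continuous_map ?S
        (prod_topology (top_of_set I) (subtopology (mat_top nrm (?n * K)) (level \<Xi> (?n * K))))
        (\<lambda>e. (fst e, amp ?n K \<rho> (snd e)))"
      using continuous_map_from_subtopology[OF fst_cont] by (intro continuous_map_pairedI)
    from continuous_map_compose[OF this g_cont[OF supp_amp[OF k]]]
    have "continuous_map ?S (mat_top nrm (?n * K)) (\<lambda>e. g (fst e) (amp ?n K \<rho> (snd e)))"
      by (simp add: o_def continuous_map_in_subtopology)
    then have "continuous_map ?S (mat_top nrm (?n * K)) (\<lambda>e. amp ?n K \<rho> ((\<lambda>(t, X). ext_map t X) e))"
    proof (rule continuous_map_eq)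
      fix e assume "e \<in> topspace ?S"
      then have "(fst e, snd e) \<in> P \<rho>" using S by simp
      note m = mem[OF this]
      show "g (fst e) (amp ?n K \<rho> (snd e)) = amp ?n K \<rho> ((\<lambda>(t, X). ext_map t X) e)"
        using ext_map(2)[OF m(1) k m(2) blk m(3)] by (simp add: case_prod_beta)
    qed
    moreover have "(\<lambda>(t, X). ext_map t X) \<in> topspace ?S \<rightarrow> carrier_mat ?n ?n"
      using S mem ext_map(1)[OF _ k _ blk] by auto
    ultimately show "continuous_map ?S (mat_top nrm ?n) (\<lambda>(t, X). ext_map t X)"
      using continuous_map_isometry[OF n iso] by blast
  next
    fix e assume "e \<in> topspace ?E"
    then obtain t X where e: "e = (t, X)" "t \<in> I" "X \<in> level ext_set ?n" using E by auto
    obtain \<rho> where \<rho>: "block_map ?n \<rho>" "amp ?n K \<rho> X \<in> level \<Xi> (?n * K)"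
      using level_ext_setE[OF k e(3)] by blast
    \<comment> \<open>Restriction makes the arrangement extensional and changes neither the
      amplification nor the block condition.\<close>
    let ?\<rho> = "restrict \<rho> {..<?n * K}"
    have "amp ?n K ?\<rho> X = amp ?n K \<rho> X" by (rule eq_matI) (auto simp: amp_index)
    moreover have "block_map ?n ?\<rho>"
      using \<rho>(1) bij_betw_cong[of "{..<?n * K}" ?\<rho> \<rho>] unfolding block_map_def by simp
    moreover from this have "?\<rho> \<in> R"
      using bij_betwE[of ?\<rho> "{..<?n * K}"] unfolding R_def block_map_def by (auto intro!: PiE_I)
    ultimately show "\<exists>\<rho>. \<rho> \<in> R \<and> e \<in> P \<rho> \<and> (case e of (t, X) \<Rightarrow> ext_map t X) = (case e of (t, X) \<Rightarrow> ext_map t X)"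
      using e \<rho> E by (intro exI[of _ ?\<rho>]) (simp add: P_def)
  qed simp
qed

lemma ext_map_bundle_endomorphism:
  assumes k: "k \<ge> 1"
  shows "bundle_endomorphism (total_top nrm I (\<lambda>_. ext_set) (k * d)) fst (\<lambda>(t, X). (t, ext_map t X))"
proof -
  let ?n = "k * d"
  let ?E = "total_top nrm I (\<lambda>_. ext_set) ?n"
  have n: "?n \<ge> 1" using k d_pos by simp
  have E: "topspace ?E = I \<times> level ext_set ?n"
    unfolding total_top_ext_set using topspace_mat_top[OF n] by (auto simp: level_def)
  have "continuous_map ?E (subtopology (mat_top nrm ?n) (level ext_set ?n)) (\<lambda>(t, X). ext_map t X)"
    unfolding continuous_map_in_subtopology
    using continuous_ext_map[OF k] ext_map_level[OF _ k] E by auto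
  moreover have "continuous_map ?E (top_of_set I) fst"
    unfolding total_top_ext_set by (rule continuous_map_fst)
  ultimately have "continuous_map ?E
      (prod_topology (top_of_set I) (subtopology (mat_top nrm ?n) (level ext_set ?n)))
      (\<lambda>e. (fst e, (\<lambda>(t, X). ext_map t X) e))"
    by (intro continuous_map_pairedI)
  then have "continuous_map ?E ?E (\<lambda>(t, X). (t, ext_map t X))"
    by (simp add: total_top_ext_set split_def)
  then show ?thesis by (auto simp: bundle_endomorphism_def)
qed

lemma fiber_bundle_ext_set:
  assumes k: "k \<ge> 1"
  shows "fiber_bundle (total_top nrm I (\<lambda>_. ext_set) (k * d)) (top_of_set I) fst
     (subtopology (mat_top nrm (k * d)) (level ext_set (k * d)))"
proof -
  have "k * d \<ge> 1" using k d_pos by simp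
  then have "0\<^sub>m (k * d) (k * d) \<in> topspace (subtopology (mat_top nrm (k * d)) (level ext_set (k * d)))"
    using zero_mem_level_ext_set[OF k] by (simp add: topspace_mat_top)
  then have "topspace (subtopology (mat_top nrm (k * d)) (level ext_set (k * d))) \<noteq> {}" by blast
  then show ?thesis unfolding total_top_ext_set by (rule fiber_bundle_trivial)
qed

text \<open>For the estimate, an arrangement is chosen that suits Y. By \<open>amp_copies\<close> it
  suits \<open>copies k X\<close> as well, so both amplifications lie in one level of
  \<open>\<Xi>\<close>, where the Lipschitz condition on \<open>g\<close> applies, and the
  amplification preserves norms.\<close>

lemma ext_map_block_solution:
  assumes t: "t \<in> I" and k: "k \<ge> 1"
    and X: "X \<in> carrier_mat d d" "\<And>n. n \<in> nc_supp \<Xi> \<Longrightarrow> copies (n div d) X \<in> level \<Xi> n"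
    and D: "D \<in> carrier_mat d d" "\<And>n. n \<in> nc_supp \<Xi> \<Longrightarrow> g t (copies (n div d) X) = copies (n div d) D"
  shows "copies k X \<in> level ext_set (k * d)" "ext_map t (copies k X) = copies k D"
    "Y \<in> level ext_set (k * d) \<Longrightarrow> nrm (k * d) (ext_map t Y - copies k D) \<le> C * nrm (k * d) (Y - copies k X)"
proof -
  let ?n = "k * d"
  have n: "?n \<ge> 1" using k d_pos by simp
  note supp = supp_amp[OF k]
  have div: "?n * K div d = k * K" using d_pos by (simp add: ac_simps)
  have cX: "copies k X \<in> carrier_mat ?n ?n" and cD: "copies k D \<in> carrier_mat ?n ?n"
    using X D by (auto intro: copies_carrier)
  have XK: "copies (k * K) X \<in> level \<Xi> (?n * K)" "g t (copies (k * K) X) = copies (k * K) D"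
    using X(2)[OF supp] D(2)[OF supp] by (simp_all add: div)
  have all: "amp ?n K \<rho> (copies k X) \<in> \<Xi>" "g t (amp ?n K \<rho> (copies k X)) = amp ?n K \<rho> (copies k D)"
    if "block_map ?n \<rho>" for \<rho>
    using XK unfolding amp_copies[OF k that X(1)] amp_copies[OF k that D(1)] by (auto simp: level_def)
  note \<rho>0 = block_map_mod_div[OF k]
  show "copies k X \<in> level ext_set ?n"
    using cX \<rho>0 all(1)[OF \<rho>0] unfolding level_ext_set[OF k] by blast
  have ext: "ext_map t (copies k X) \<in> carrier_mat ?n ?n"
    "g t (amp ?n K \<rho> (copies k X)) = amp ?n K \<rho> (ext_map t (copies k X))" if "block_map ?n \<rho>" for \<rho>
    using ext_map[OF t k cX that all(1)[OF that]] .
  show eq: "ext_map t (copies k X) = copies k D"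
    using ext(2)[OF \<rho>0] all(2)[OF \<rho>0] n
    by (intro amp_inject[OF bij_betw_mod_div K_pos ext(1)[OF \<rho>0] cD]) auto
  assume Y: "Y \<in> level ext_set ?n"
  obtain \<rho> where \<rho>: "Y \<in> carrier_mat ?n ?n" "block_map ?n \<rho>" "amp ?n K \<rho> Y \<in> level \<Xi> (?n * K)"
    using level_ext_setE[OF k Y] by blast
  have iso: "mat_isometry ?n (?n * K) (amp ?n K \<rho>)"
    using \<rho>(2) by (intro amp_isometry n K_pos) (simp add: block_map_def)
  have nrm_diff: "nrm (?n * K) (amp ?n K \<rho> A - amp ?n K \<rho> B) = nrm ?n (A - B)"
    if "A \<in> carrier_mat ?n ?n" "B \<in> carrier_mat ?n ?n" for A B
    using iso that unfolding mat_isometry_def by (metis minus_carrier_mat)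
  have mem: "amp ?n K \<rho> Y \<in> \<Xi>" using \<rho>(3) by (simp add: level_def)
  note extY = ext_map[OF t k \<rho>(1,2) mem]
  have "nrm ?n (ext_map t Y - copies k D) = nrm (?n * K) (g t (amp ?n K \<rho> Y) - g t (amp ?n K \<rho> (copies k X)))"
    unfolding extY(2) all(2)[OF \<rho>(2)] by (rule nrm_diff[OF extY(1) cD, symmetric])
  also have "\<dots> \<le> C * nrm (?n * K) (amp ?n K \<rho> Y - amp ?n K \<rho> (copies k X))"
    by (rule g_Lipschitz[OF t supp \<rho>(3) amp_level[OF all(1)[OF \<rho>(2)]]])
  also have "\<dots> = C * nrm ?n (Y - copies k X)" by (simp only: nrm_diff[OF \<rho>(1) cX])
  finally show "nrm ?n (ext_map t Y - copies k D) \<le> C * nrm ?n (Y - copies k X)" .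
qed

end

section \<open>From the block curve to all multiples of \<open>d\<close>\<close>

theorem theorem17:
  fixes smul :: "'f::real_normed_field \<Rightarrow> 'v::ab_group_add \<Rightarrow> 'v"
    and nrm :: "nat \<Rightarrow> 'v mat \<Rightarrow> real"
    and I :: "real set" and t0 :: real
    and \<Xi> :: "'v mat set"
    and X0n :: "nat \<Rightarrow> 'v mat"
    and g :: "real \<Rightarrow> 'v mat \<Rightarrow> 'v mat"
    and C :: real and d :: nat
  assumes V: "operator_space smul nrm"
    and I: "is_interval I" "t0 \<in> interior I"
    and \<Xi>: "nc_set \<Xi>" "\<Xi> \<noteq> {}"
    and \<Xi>_closed: "\<forall>n\<in>nc_supp \<Xi>. closed_mat_subspace smul nrm n (level \<Xi> n)"
    and X0n: "\<forall>n\<in>nc_supp \<Xi>. X0n n \<in> level \<Xi> n" "nc_set (X0n ` nc_supp \<Xi>)"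
    and g_levels: "\<forall>t\<in>I. \<forall>n\<in>nc_supp \<Xi>. \<forall>X\<in>level \<Xi> n. g t X \<in> level \<Xi> n"
    and g_dsums: "\<forall>t\<in>I. respects_dsums \<Xi> (g t)"
    and g_cont: "\<forall>n\<in>nc_supp \<Xi>. continuous_map
           (prod_topology (top_of_set I) (subtopology (mat_top nrm n) (level \<Xi> n)))
           (subtopology (mat_top nrm n) (level \<Xi> n)) (\<lambda>(t, X). g t X)"
    and g_Lipschitz: "C > 0" "\<forall>t\<in>I. \<forall>n\<in>nc_supp \<Xi>. \<forall>X\<in>level \<Xi> n. \<forall>Y\<in>level \<Xi> n.
           nrm n (g t X - g t Y) \<le> C * nrm n (X - Y)"
    and d: "d = Gcd (nc_supp \<Xi>)"
  shows "\<exists>X0 \<in> carrier_mat d d.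
    (\<forall>n\<in>nc_supp \<Xi>. X0n n = copies (n div d) X0) \<and>
    (\<exists>Xs. C1_curve smul nrm d I Xs \<and>
      (\<forall>n\<in>nc_supp \<Xi>.
         ivp_solution smul nrm n I (\<lambda>_. level \<Xi> n) g t0 (X0n n) (\<lambda>t. copies (n div d) (Xs t)) \<and>
         (\<forall>Y. ivp_solution smul nrm n I (\<lambda>_. level \<Xi> n) g t0 (X0n n) Y \<longrightarrow>
            (\<forall>t\<in>I. Y t = copies (n div d) (Xs t)))) \<and>
      ((\<forall>t\<in>I. respects_similarities smul \<Xi> (g t)) \<longrightarrow>
        (\<exists>(\<Xi>t :: real \<Rightarrow> 'v mat set) (gt :: real \<times> 'v mat \<Rightarrow> real \<times> 'v mat).
          (\<forall>t\<in>I. nc_set (\<Xi>t t) \<and> \<Xi> \<subseteq> \<Xi>t t \<and> nc_supp (\<Xi>t t) = {d * k | k. k \<ge> 1}) \<and>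
          (\<forall>n\<in>{d * k | k. k \<ge> 1}. \<exists>F :: 'v mat topology.
             fiber_bundle (total_top nrm I \<Xi>t n) (top_of_set I) fst F) \<and>
          gt ` (SIGMA t:I. \<Xi>t t) \<subseteq> (SIGMA t:I. \<Xi>t t) \<and>
          (\<forall>n\<in>{d * k | k. k \<ge> 1}. bundle_endomorphism (total_top nrm I \<Xi>t n) fst gt) \<and>
          (\<forall>t\<in>I. \<forall>n\<in>nc_supp \<Xi>. \<forall>X\<in>level \<Xi> n. snd (gt (t, X)) = g t X) \<and>
          (\<forall>n\<in>{d * k | k. k \<ge> 1}.
             C1_curve smul nrm n I (\<lambda>t. copies (n div d) (Xs t)) \<and>
             ivp_solution smul nrm n I (\<lambda>t. level (\<Xi>t t) n) (\<lambda>t X. snd (gt (t, X))) t0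
               (copies (n div d) X0) (\<lambda>t. copies (n div d) (Xs t)) \<and>
             (\<forall>Y. C1_curve smul nrm n I Y \<and>
                ivp_solution smul nrm n I (\<lambda>t. level (\<Xi>t t) n) (\<lambda>t X. snd (gt (t, X))) t0
                  (copies (n div d) X0) Y \<longrightarrow>
                (\<forall>t\<in>I. Y t = copies (n div d) (Xs t)))))))"
proof -
  interpret nc: nc_ode smul nrm I t0 \<Xi> X0n g C d
    by (rule nc_ode.intro[OF V nc_ode_axioms.intro[OF I(1) subsetD[OF interior_subset I(2)] \<Xi>
        bspec[OF \<Xi>_closed] bspec[OF X0n(1)] X0n(2) g_levels[rule_format] g_dsums[rule_format]
        g_cont[rule_format] g_Lipschitz(1) g_Lipschitz(2)[rule_format] d]])
  show ?thesis
  proof (rule nc.block_solution)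
    fix X0 Xs Ds assume X0: "X0 \<in> carrier_mat d d" "\<And>n. n \<in> nc_supp \<Xi> \<Longrightarrow> X0n n = copies (n div d) X0"
      and init: "Xs t0 = X0"
      and Xs: "\<And>t. t \<in> I \<Longrightarrow> Xs t \<in> carrier_mat d d" and Ds: "\<And>t. t \<in> I \<Longrightarrow> Ds t \<in> carrier_mat d d"
      and lev: "\<And>t n. t \<in> I \<Longrightarrow> n \<in> nc_supp \<Xi> \<Longrightarrow> copies (n div d) (Xs t) \<in> level \<Xi> n"
      and vel: "\<And>t n. t \<in> I \<Longrightarrow> n \<in> nc_supp \<Xi> \<Longrightarrow> g t (copies (n div d) (Xs t)) = copies (n div d) (Ds t)"
      and der: "\<And>t. t \<in> I \<Longrightarrow> has_mat_deriv smul nrm d I Xs (Ds t) t"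
      and cont: "continuous_map (top_of_set I) (mat_top nrm d) Ds"
    have der_copies: "has_mat_deriv smul nrm (k * d) I (\<lambda>t. copies k (Xs t)) (copies k (Ds t)) t"
      if "k \<ge> 1" "t \<in> I" for k t
      using nc.has_mat_deriv_isometry[where Y = Xs, OF nc.d_pos _ nc.copies_isometry[OF nc.d_pos that(1)] Xs Ds[OF that(2)] that(2)]
        der[OF that(2)] that(1) nc.d_pos by simp
    have C1_copies: "C1_curve smul nrm (k * d) I (\<lambda>t. copies k (Xs t))" if k: "k \<ge> 1" for k
    proof -
      have "continuous_map (top_of_set I) (mat_top nrm (k * d)) (\<lambda>t. copies k (Ds t))"
        using k nc.d_pos Ds cont
        by (subst nc.continuous_map_isometry[OF nc.d_pos _ nc.copies_isometry[OF nc.d_pos k]]) auto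
      then show ?thesis
        unfolding C1_curve_def using copies_carrier[OF Xs] der_copies[OF k]
        by (intro conjI ballI exI[of _ "\<lambda>t. copies k (Ds t)"])
    qed
    have sol: "ivp_solution smul nrm n I (\<lambda>_. level \<Xi> n) g t0 (X0n n) (\<lambda>t. copies (n div d) (Xs t))"
      if n: "n \<in> nc_supp \<Xi>" for n
      unfolding ivp_solution_def
      using lev[OF _ n] vel[OF _ n] init X0(2)[OF n] der_copies[OF nc.supp_div_pos[OF n]] by (simp add: nc.d_dvd[OF n])
    show ?thesis
    proof (intro bexI[of _ X0] conjI exI[of _ Xs] ballI allI impI)
      show "C1_curve smul nrm d I Xs" 
        unfolding C1_curve_def using Xs der cont by (intro conjI ballI exI[of _ Ds])
      fix n assume n: "n \<in> nc_supp \<Xi>"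
      show "X0n n = copies (n div d) X0" by (rule X0(2)[OF n])
      show "ivp_solution smul nrm n I (\<lambda>_. level \<Xi> n) g t0 (X0n n) (\<lambda>t. copies (n div d) (Xs t))"
        by (rule sol[OF n])
      fix Y t assume "ivp_solution smul nrm n I (\<lambda>_. level \<Xi> n) g t0 (X0n n) Y" "t \<in> I"
      then show "Y t = copies (n div d) (Xs t)" by (intro nc.solution_unique[OF n _ _ sol[OF n]])
    next
      assume sim: "\<forall>t\<in>I. respects_similarities smul \<Xi> (g t)"
      \<comment> \<open>Any supported size fixes the number of copies \<open>K = N div d\<close>
        used throughout the extension.\<close>
      obtain N where N: "N \<in> nc_supp \<Xi>" using nc.supp_nonempty by blast
      interpret sim: nc_ode_sim smul nrm I t0 \<Xi> X0n g C d "N div d"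
        by unfold_locales (use sim N in \<open>auto simp: nc.d_dvd\<close>)
      let ?gt = "\<lambda>(t, X). (t, sim.ext_map t X)"
      have mult: "\<exists>k\<ge>1. n = k * d \<and> n div d = k" if "n \<in> {d * k | k. k \<ge> 1}" for n
        using that nc.d_pos by auto
      show "\<exists>(\<Xi>t :: real \<Rightarrow> 'v mat set) (gt :: real \<times> 'v mat \<Rightarrow> real \<times> 'v mat).
            (\<forall>t\<in>I. nc_set (\<Xi>t t) \<and> \<Xi> \<subseteq> \<Xi>t t \<and> nc_supp (\<Xi>t t) = {d * k | k. k \<ge> 1}) \<and>
            (\<forall>n\<in>{d * k | k. k \<ge> 1}. \<exists>F :: 'v mat topology.
               fiber_bundle (total_top nrm I \<Xi>t n) (top_of_set I) fst F) \<and>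
            gt ` (SIGMA t:I. \<Xi>t t) \<subseteq> (SIGMA t:I. \<Xi>t t) \<and>
            (\<forall>n\<in>{d * k | k. k \<ge> 1}. bundle_endomorphism (total_top nrm I \<Xi>t n) fst gt) \<and>
            (\<forall>t\<in>I. \<forall>n\<in>nc_supp \<Xi>. \<forall>X\<in>level \<Xi> n. snd (gt (t, X)) = g t X) \<and>
            (\<forall>n\<in>{d * k | k. k \<ge> 1}.
               C1_curve smul nrm n I (\<lambda>t. copies (n div d) (Xs t)) \<and>
               ivp_solution smul nrm n I (\<lambda>t. level (\<Xi>t t) n) (\<lambda>t X. snd (gt (t, X))) t0
                 (copies (n div d) X0) (\<lambda>t. copies (n div d) (Xs t)) \<and>
               (\<forall>Y. C1_curve smul nrm n I Y \<and>
                  ivp_solution smul nrm n I (\<lambda>t. level (\<Xi>t t) n) (\<lambda>t X. snd (gt (t, X))) t0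
                    (copies (n div d) X0) Y \<longrightarrow>
                  (\<forall>t\<in>I. Y t = copies (n div d) (Xs t))))"
      \<comment> \<open>The fibers are constant in time, so the bundles are trivial and only the map
        depends on t.\<close>
      proof (rule exI[of _ "\<lambda>_. sim.ext_set"], rule exI[of _ ?gt], intro conjI ballI)
        show "nc_set sim.ext_set" "\<Xi> \<subseteq> sim.ext_set" "nc_supp sim.ext_set = {d * k | k. k \<ge> 1}"
          by (rule sim.nc_set_ext_set sim.subset_ext_set sim.nc_supp_ext_set)+
        show "?gt ` (SIGMA t:I. sim.ext_set) \<subseteq> (SIGMA t:I. sim.ext_set)"
        proof clarify
          fix t X assume t: "t \<in> I" and X: "X \<in> sim.ext_set"
          then obtain k where k: "k \<ge> 1" "X \<in> level sim.ext_set (k * d)"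
            unfolding sim.ext_set_def level_def by auto
          show "sim.ext_map t X \<in> sim.ext_set"
            using sim.ext_map_level[OF t k] by (simp add: level_def)
        qed
        show "snd (?gt (t, X)) = g t X" if "t \<in> I" "n \<in> nc_supp \<Xi>" "X \<in> level \<Xi> n" for t n X
          using sim.ext_map_extends[OF that] by simp
      next
        fix n assume "n \<in> {d * k | k. k \<ge> 1}"
        then obtain k where k: "k \<ge> 1" "n = k * d" "n div d = k" using mult by blast
        show "\<exists>F :: 'v mat topology. fiber_bundle (total_top nrm I (\<lambda>_. sim.ext_set) n) (top_of_set I) fst F"
          unfolding k(2) using sim.fiber_bundle_ext_set[OF k(1)] by blast
        show "bundle_endomorphism (total_top nrm I (\<lambda>_. sim.ext_set) n) fst ?gt"
          unfolding k(2) by (rule sim.ext_map_bundle_endomorphism[OF k(1)])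
        show "C1_curve smul nrm n I (\<lambda>t. copies (n div d) (Xs t))"
          unfolding k(3) unfolding k(2) by (rule C1_copies[OF k(1)])
        note blk = sim.ext_map_block_solution[OF _ k(1) Xs lev Ds vel]
        show "ivp_solution smul nrm n I (\<lambda>t. level sim.ext_set n) (\<lambda>t X. snd (?gt (t, X))) t0
            (copies (n div d) X0) (\<lambda>t. copies (n div d) (Xs t))"
          unfolding ivp_solution_def k(3) unfolding k(2)
          using blk(1,2) der_copies[OF k(1)] init by simp
        show "\<forall>Y. C1_curve smul nrm n I Y \<and>
            ivp_solution smul nrm n I (\<lambda>t. level sim.ext_set n) (\<lambda>t X. snd (?gt (t, X))) t0 (copies (n div d) X0) Y \<longrightarrow>
            (\<forall>t\<in>I. Y t = copies (n div d) (Xs t))"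
          unfolding k(3) unfolding k(2)
        proof (intro allI impI ballI, elim conjE)
          fix Y t assume t: "t \<in> I"
            and Y: "ivp_solution smul nrm (k * d) I (\<lambda>t. level sim.ext_set (k * d)) (\<lambda>t X. snd (?gt (t, X))) t0 (copies k X0) Y"
          have Yl: "Y s \<in> level sim.ext_set (k * d)" if "s \<in> I" for s using Y that by (simp add: ivp_solution_def)
          show "Y t = copies k (Xs t)"
          \<comment> \<open>A competing solution is compared with the block curve itself, the one
            comparison for which \<open>blk(3)\<close> supplies the Lipschitz estimate.\<close>
          proof (rule nc.mat_ode_unique[where Y' = "\<lambda>s. sim.ext_map s (Y s)" and Z' = "\<lambda>s. copies k (Ds s)" and C = C])
            show "k * d \<ge> 1" using k(1) nc.d_pos by simp
            show "Y s \<in> carrier_mat (k * d) (k * d)" if "s \<in> I" for s using Yl[OF that] by (simp add: level_def)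
            show "has_mat_deriv smul nrm (k * d) I Y (sim.ext_map s (Y s)) s" if "s \<in> I" for s
              using Y that by (simp add: ivp_solution_def)
            show "copies k (Xs s) \<in> carrier_mat (k * d) (k * d)" if "s \<in> I" for s
              by (rule copies_carrier[OF Xs[OF that]])
            show "nrm (k * d) (sim.ext_map s (Y s) - copies k (Ds s)) \<le> C * nrm (k * d) (Y s - copies k (Xs s))"
              if "s \<in> I" for s using that Yl[OF that] by (intro blk(3))
            show "Y t0 = copies k (Xs t0)" using Y init by (simp add: ivp_solution_def)
          qed (use nc.I nc.C t der_copies[OF k(1)] in auto)
        qed
      qed
    qed (rule X0(1))
  qed
qed

end
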